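(* Assume that there are real constants $\sigma^2>0$ and $\rho$ with $|\rho|<\sigma^2$ such that, for all $n\ge p-1$: (i) for every $k\in\mathbb{G}_{n+1}$, $\varepsilon_k\in L^2$, $\mathbb{E}[\varepsilon_k\mid\mathcal{F}_n]=0$ and $\mathbb{E}[\varepsilon_k^2\mid\mathcal{F}_n]=\sigma^2$ a.s.; (ii) for all different $k,l\in\mathbb{G}_{n+1}$, if $[k/2]=[l/2]$ then $\mathbb{E}[\varepsilon_k\varepsilon_l\mid\mathcal{F}_n]=\rho$ a.s., and otherwise $\varepsilon_k$ and $\varepsilon_l$ are conditionally independent given $\mathcal{F}_n$. Assume also that (iii) $\varepsilon_k\in L^4$ for all $k\in\mathbb{G}_{n+1}$, $n\ge p-1$, and $\sup_{n\ge p-1}\sup_{k\in\mathbb{G}_{n+1}}\mathbb{E}[\varepsilon_k^4\mid\mathcal{F}_n]<\infty$ a.s. Then $$\lim_{n\to\infty}\frac{S_n}{|\mathbb{T}_n|}=L\quad\text{a.s.},$$ where $L$ is the positive definite matrix $$L=\begin{pmatrix}1&\lambda^t\\ \lambda&\ell\end{pmatrix}.$$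
   Context: Fix an integer $p\ge1$. For $n\ge0$ let $\mathbb{G}_n=\{2^n,\dots,2^{n+1}-1\}$, $\mathbb{T}_n=\bigcup_{k=0}^n\mathbb{G}_k$, and for an integer $q\geq 0$ let $\mathbb{T}_{n,q}=\{k\in\mathbb{T}_n:k\ge2^q\}$; $|E|$ denotes cardinality, so $|\mathbb{G}_n|=2^n$, $|\mathbb{T}_n|=2^{n+1}-1$. $[x]$ is the integer part of $x$. The asymmetric BAR($p$) process consists of real random variables $(X_n)_{n\ge1}$ and $(\varepsilon_n)_{n\ge2^p}$ such that for all $n\ge2^{p-1}$ $$X_{2n}=a_0+\sum_{k=1}^pa_kX_{[n/2^{k-1}]}+\varepsilon_{2n},\qquad X_{2n+1}=b_0+\sum_{k=1}^pb_kX_{[n/2^{k-1}]}+\varepsilon_{2n+1},$$ with real parameters $a_0,\dots,a_p,b_0,\dots,b_p$. The initial states satisfy $\mathbb{E}[X_k^8]<\infty$ for $1\le k\le2^p-1$. For $n\ge2^{p-1}$, $\mathbb{X}_n=(X_n,X_{[n/2]},\dots,X_{[n/2^{p-1}]})^t\in\mathbb{R}^p$. $A$ (resp. $B$) is the $p\times p$ companion matrix with first row $(a_1,\dots,a_p)$ (resp. $(b_1,\dots,b_p)$), ones on the subdiagonal and zeros elsewhere. It is assumed that $\beta=\max\{\|A\|,\|B\|\}<1$, where $\|A\|=\sup\{\|Au\|:u\in\mathbb{R}^p,\|u\|=1\}$ is the operator norm induced by a norm on $\mathbb{R}^p$. $\mathcal{F}_n=\sigma\{X_k:k\in\mathbb{T}_n\}$.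 $Y_n=(1,\mathbb{X}_n^t)^t\in\mathbb{R}^{p+1}$ and, for $n\ge p-1$, $S_n=\sum_{k\in\mathbb{T}_{n,p-1}}Y_kY_k^t$. Let $e_1=(1,0,\dots,0)^t\in\mathbb{R}^p$, $\overline a=(a_0+b_0)/2$, $\overline{a^2}=(a_0^2+b_0^2)/2$, $\overline A=(A+B)/2$, $\lambda=\overline a(I_p-\overline A)^{-1}e_1$, and let $\ell$ be the unique solution of $\ell=T+\frac12(A\ell A^t+B\ell B^t)$ with $$T=(\sigma^2+\overline{a^2})e_1e_1^t+\tfrac12\big(a_0(A\lambda e_1^t+e_1\lambda^tA^t)+b_0(B\lambda e_1^t+e_1\lambda^tB^t)\big).$$ *)

theory Defs
  imports
    "HOL-Probability.Probability"
    "Jordan_Normal_Form.Gauss_Jordan_Elimination"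
begin

text \<open>
  \<open>$\<close>, \<open>\<bullet>\<close> and the type \<open>vec\<close> refer to \<^theory>\<open>Jordan_Normal_Form.Matrix\<close> below, so that
  the dimension \<open>p\<close> is an ordinary natural number.  Vectors and matrices are indexed from \<open>0\<close>.
\<close>

unbundle no vec_syntax
no_notation inner (infix \<open>\<bullet>\<close> 70)

section \<open>The binary tree\<close>

definition gen :: "nat \<Rightarrow> nat set" where
  "gen n = {2 ^ n .. 2 ^ (n + 1) - 1}"

definition tree :: "nat \<Rightarrow> nat set" where
  "tree n = (\<Union>k\<in>{0..n}. gen k)"

definition tree_from :: "nat \<Rightarrow> nat \<Rightarrow> nat set" where
  "tree_from n q = {k \<in> tree n. 2 ^ q \<le> k}"

section \<open>Linear algebra\<close>

definition outer :: "real Matrix.vec \<Rightarrow> real Matrix.vec \<Rightarrow> real Matrix.mat" where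
  "outer u v = Matrix.mat (dim_vec u) (dim_vec v) (\<lambda>(i, j). u $ i * v $ j)"

definition norm_on_carrier :: "nat \<Rightarrow> (real Matrix.vec \<Rightarrow> real) \<Rightarrow> bool" where
  "norm_on_carrier p N \<longleftrightarrow>
     (\<forall>u\<in>carrier_vec p. 0 \<le> N u \<and> (N u = 0 \<longleftrightarrow> u = 0\<^sub>v p)) \<and>
     (\<forall>u\<in>carrier_vec p. \<forall>c. N (c \<cdot>\<^sub>v u) = \<bar>c\<bar> * N u) \<and>
     (\<forall>u\<in>carrier_vec p. \<forall>v\<in>carrier_vec p. N (u + v) \<le> N u + N v)"

text \<open>
  The supremum is taken in \<open>\<real>\<close>; for a norm on \<open>\<real>\<^sup>p\<close> with \<open>p \<ge> 1\<close> the set is nonempty and bounded.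
\<close>
definition op_norm :: "nat \<Rightarrow> (real Matrix.vec \<Rightarrow> real) \<Rightarrow> real Matrix.mat \<Rightarrow> real" where
  "op_norm p N M = Sup {N (M *\<^sub>v u) | u. u \<in> carrier_vec p \<and> N u = 1}"

definition positive_definite :: "real Matrix.mat \<Rightarrow> bool" where
  "positive_definite M \<longleftrightarrow>
     M \<in> carrier_mat (dim_row M) (dim_row M) \<and> transpose_mat M = M \<and>
     (\<forall>v\<in>carrier_vec (dim_row M). v \<noteq> 0\<^sub>v (dim_row M) \<longrightarrow> v \<bullet> (M *\<^sub>v v) > 0)"

definition mat_LIMSEQ :: "(nat \<Rightarrow> real Matrix.mat) \<Rightarrow> real Matrix.mat \<Rightarrow> bool" where
  "mat_LIMSEQ Ms M \<longleftrightarrow>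
     (\<forall>n. Ms n \<in> carrier_mat (dim_row M) (dim_col M)) \<and>
     (\<forall>i<dim_row M. \<forall>j<dim_col M. (\<lambda>n. Ms n $$ (i, j)) \<longlonglongrightarrow> M $$ (i, j))"

definition companion :: "nat \<Rightarrow> (nat \<Rightarrow> real) \<Rightarrow> real Matrix.mat" where
  "companion p c =
     Matrix.mat p p (\<lambda>(i, j). if i = 0 then c (j + 1) else if i = j + 1 then 1 else 0)"

section \<open>Filtration and conditional independence\<close>

definition tree_filtration :: "'a measure \<Rightarrow> (nat \<Rightarrow> 'a \<Rightarrow> real) \<Rightarrow> nat \<Rightarrow> 'a measure" where
  "tree_filtration M X n =
     sigma (space M) {X k -` E \<inter> space M | k E. k \<in> tree n \<and> E \<in> sets borel}"

definition cond_indep_var ::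
  "'a measure \<Rightarrow> 'a measure \<Rightarrow> ('a \<Rightarrow> real) \<Rightarrow> ('a \<Rightarrow> real) \<Rightarrow> bool" where
  "cond_indep_var M F U V \<longleftrightarrow>
     (\<forall>E\<in>sets borel. \<forall>E'\<in>sets borel. AE w in M.
        real_cond_exp M F (\<lambda>w. indicator E (U w) * indicator E' (V w)) w =
        real_cond_exp M F (\<lambda>w. indicator E (U w)) w *
        real_cond_exp M F (\<lambda>w. indicator E' (V w)) w)"

section \<open>The BAR(p) process\<close>

definition state_vec :: "nat \<Rightarrow> (nat \<Rightarrow> 'a \<Rightarrow> real) \<Rightarrow> nat \<Rightarrow> 'a \<Rightarrow> real Matrix.vec" where
  "state_vec p X n w = Matrix.vec p (\<lambda>i. X (n div 2 ^ i) w)"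

definition Y_vec :: "nat \<Rightarrow> (nat \<Rightarrow> 'a \<Rightarrow> real) \<Rightarrow> nat \<Rightarrow> 'a \<Rightarrow> real Matrix.vec" where
  "Y_vec p X n w = vCons 1 (state_vec p X n w)"

text \<open>The sum of the matrices \<open>Y\<^sub>k Y\<^sub>k\<^sup>t\<close>, written entrywise since matrices of varying size form no monoid.\<close>
definition S_mat :: "nat \<Rightarrow> (nat \<Rightarrow> 'a \<Rightarrow> real) \<Rightarrow> nat \<Rightarrow> 'a \<Rightarrow> real Matrix.mat" where
  "S_mat p X n w = Matrix.mat (p + 1) (p + 1)
     (\<lambda>(i, j). \<Sum>k\<in>tree_from n (p - 1). outer (Y_vec p X k w) (Y_vec p X k w) $$ (i, j))"

section \<open>The limit matrix\<close>

definition lam :: "nat \<Rightarrow> (nat \<Rightarrow> real) \<Rightarrow> (nat \<Rightarrow> real) \<Rightarrow> real Matrix.vec" where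
  "lam p a b =
     ((a 0 + b 0) / 2) \<cdot>\<^sub>v
     (the (mat_inverse (1\<^sub>m p - (1 / 2) \<cdot>\<^sub>m (companion p a + companion p b))) *\<^sub>v unit_vec p 0)"

definition T_mat ::
  "nat \<Rightarrow> (nat \<Rightarrow> real) \<Rightarrow> (nat \<Rightarrow> real) \<Rightarrow> real \<Rightarrow> real Matrix.mat" where
  "T_mat p a b sigma2 =
     (let A = companion p a; B = companion p b; l = lam p a b; e1 = unit_vec p 0 in
      (sigma2 + ((a 0)\<^sup>2 + (b 0)\<^sup>2) / 2) \<cdot>\<^sub>m outer e1 e1 +
      (1 / 2) \<cdot>\<^sub>m
        (a 0 \<cdot>\<^sub>m (A * outer l e1 + outer e1 l * transpose_mat A) +
         b 0 \<cdot>\<^sub>m (B * outer l e1 + outer e1 l * transpose_mat B)))"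

definition ell ::
  "nat \<Rightarrow> (nat \<Rightarrow> real) \<Rightarrow> (nat \<Rightarrow> real) \<Rightarrow> real \<Rightarrow> real Matrix.mat" where
  "ell p a b sigma2 =
     (THE l. l \<in> carrier_mat p p \<and>
        l = T_mat p a b sigma2 + (1 / 2) \<cdot>\<^sub>m
              (companion p a * l * transpose_mat (companion p a) +
               companion p b * l * transpose_mat (companion p b)))"

definition L_mat ::
  "nat \<Rightarrow> (nat \<Rightarrow> real) \<Rightarrow> (nat \<Rightarrow> real) \<Rightarrow> real \<Rightarrow> real Matrix.mat" where
  "L_mat p a b sigma2 =
     four_block_mat (1\<^sub>m 1) (mat_of_rows p [lam p a b])
       (mat_of_cols p [lam p a b]) (ell p a b sigma2)"

end

(*
  Let D be the unit ball of the norm dual to N.  The transposes of both companion matrices map D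
  into beta D, so the averages over generation n of phi . X_k and (phi . X_k) (psi . X_k), for phi and
  psi in D, obey recursions that are contractions up to noise, with fixed points lambda and ell.
  The noise terms are averages over a generation of variables such as eps_{2k} X_k.  Those with
  different k are orthogonal by conditional independence and have bounded second moments, so the
  second moments of the averages are O(2^-n), hence summable; for the squares of the noise one first
  truncates on the event that their conditional variance is at most m.  Averages over
  the tree then follow from those over generations.  Positivity of ell - lambda lambda^t comes from
  the inequality q(phi) >= sigma^2 phi_0^2 + (q(A^t phi) + q(B^t phi)) / 2 for its quadratic form q.
*)

theory Submission
  imports Defs "Jordan_Normal_Form.Determinant"
begin

text \<open>The state of a child is A X_k or B X_k plus a multiple of e_1. Tested with \<phi>, it is
  the parent tested with A^t \<phi> or B^t \<phi>, plus intercept and noise times \<phi>_0. As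
  \<phi>_0 is bounded on D, all error bounds are uniform over D. A and B occur mixed along a line of
  descent, so a contraction bound in one common norm is essential: spectral radii of A and B alone
  do not control such products. Even and odd children are averaged separately, so two different
  noise terms in one average have different parents and are conditionally independent. That notion
  speaks of events only, so orthogonality has to be built up from indicators. The bound on the
  conditional fourth moments is a finite random variable without known integrability, so the squared
  noise has no evident uniform variance bound. The truncation event lies in F_n, hence keeps the
  terms conditionally centred, and on almost every path it discards nothing once m is large.
  Probability enters the limit only through three kinds of noise averages; the recursions are then
  solved path by path.\<close>

section \<open>Contracting recursions with vanishing perturbation\<close>

lemma affine_recursion_tendsto_0:
  fixes y r :: "nat \<Rightarrow> real"
  assumes "0 \<le> \<beta>" "\<beta> < 1" and r: "r \<longlonglongrightarrow> 0"
    and step: "\<And>n. y (Suc n) = \<beta> * y n + r n"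
  shows "y \<longlonglongrightarrow> 0"
proof (rule LIMSEQ_I)
  fix e :: real assume e: "0 < e"
  \<comment> \<open>This choice makes e / 2 the fixed point of u -> \<beta> u + d, so perturbations
    below d contribute at most e / 2 in total.\<close>
  define d where "d = e / 2 * (1 - \<beta>)"
  have d: "d > 0" using e assms by (simp add: d_def)
  obtain N where N: "\<And>n. n \<ge> N \<Longrightarrow> \<bar>r n\<bar> < d"
    using LIMSEQ_D[OF r d] by auto
  have bound: "\<bar>y (N + m)\<bar> \<le> \<beta> ^ m * \<bar>y N\<bar> + e / 2" for m
  proof (induction m)
    case (Suc m)
    have "\<bar>y (N + Suc m)\<bar> \<le> \<beta> * \<bar>y (N + m)\<bar> + \<bar>r (N + m)\<bar>"
      using step[of "N + m"] abs_triangle_ineq[of "\<beta> * y (N + m)" "r (N + m)"] \<open>0 \<le> \<beta>\<close>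
      by (simp add: abs_mult)
    also have "\<dots> \<le> \<beta> * (\<beta> ^ m * \<bar>y N\<bar> + e / 2) + d"
      by (intro add_mono mult_left_mono Suc.IH less_imp_le[OF N] \<open>0 \<le> \<beta>\<close>) simp
    also have "\<dots> = \<beta> ^ Suc m * \<bar>y N\<bar> + e / 2"
      by (simp add: d_def field_simps)
    finally show ?case .
  qed (use e in simp)
  have "(\<lambda>m. \<beta> ^ m * \<bar>y N\<bar>) \<longlonglongrightarrow> 0 * \<bar>y N\<bar>"
    using assms by (intro tendsto_intros LIMSEQ_power_zero) auto
  then obtain m0 where m0: "\<And>m. m \<ge> m0 \<Longrightarrow> \<bar>\<beta> ^ m * \<bar>y N\<bar>\<bar> < e / 2"
    using e by (fastforce dest: LIMSEQ_D[where r="e/2"])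
  have "norm (y n - 0) < e" if "n \<ge> N + m0" for n
  proof -
    have "\<beta> ^ (n - N) * \<bar>y N\<bar> < e / 2" using m0[of "n - N"] that by linarith
    then show ?thesis using bound[of "n - N"] that by simp
  qed
  then show "\<exists>n0. \<forall>n\<ge>n0. norm (y n - 0) < e" by blast
qed

text \<open>Any common bound at stage n yields a common bound at stage n + 1, so iterating the
  affine recursion from \<open>y0\<close> dominates the whole family without forming a supremum over
  \<open>D\<close>. With \<open>r\<close> = 0 and \<open>e\<close> constant in n it shows that a
  fixed quantity vanishes.\<close>

lemma uniform_contraction_tendsto_0:
  fixes e :: "nat \<Rightarrow> 'd \<Rightarrow> real" and r :: "nat \<Rightarrow> real"
  assumes "0 \<le> \<beta>" "\<beta> < 1" and r: "r \<longlonglongrightarrow> 0"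
    and start: "\<And>d. d \<in> D \<Longrightarrow> \<bar>e n0 d\<bar> \<le> y0"
    and step: "\<And>n y d. n \<ge> n0 \<Longrightarrow> (\<And>d. d \<in> D \<Longrightarrow> \<bar>e n d\<bar> \<le> y) \<Longrightarrow> d \<in> D \<Longrightarrow>
      \<bar>e (Suc n) d\<bar> \<le> \<beta> * y + r n"
  obtains y where "y \<longlonglongrightarrow> 0" "\<And>n d. n \<ge> n0 \<Longrightarrow> d \<in> D \<Longrightarrow> \<bar>e n d\<bar> \<le> y n"
proof -
  define z where "z = rec_nat y0 (\<lambda>m v. \<beta> * v + r (m + n0))"
  have z: "z 0 = y0" "\<And>m. z (Suc m) = \<beta> * z m + r (m + n0)" by (simp_all add: z_def)
  have "z \<longlonglongrightarrow> 0"
    using assms(1,2) LIMSEQ_ignore_initial_segment[OF r] z(2)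
    by (rule affine_recursion_tendsto_0)
  then have lim: "(\<lambda>n. z (n - n0)) \<longlonglongrightarrow> 0"
    by (intro LIMSEQ_offset[where k = n0 and f = "\<lambda>n. z (n - n0)"]) simp
  have zb: "\<bar>e (n0 + m) d\<bar> \<le> z m" if "d \<in> D" for m d
    using that
  proof (induction m arbitrary: d)
    case 0
    then show ?case using start z by simp
  next
    case (Suc m)
    show ?case using step[of "n0 + m" "z m" d] Suc by (simp add: z add.commute)
  qed
  have "\<bar>e n d\<bar> \<le> z (n - n0)" if "n \<ge> n0" "d \<in> D" for n d
    using zb[of d "n - n0"] that by simp
  with lim show ?thesis by (rule that)
qed

section \<open>Companion matrices and bilinear forms\<close>

text \<open>The coordinates of \<open>A\<^sup>t \<phi>\<close>, where \<open>A\<close> is the companion matrix of \<open>a\<close>.\<close>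

definition adj :: "nat \<Rightarrow> (nat \<Rightarrow> real) \<Rightarrow> (nat \<Rightarrow> real) \<Rightarrow> nat \<Rightarrow> real" where
  "adj p a \<phi> j = a (j + 1) * \<phi> 0 + (if j + 1 < p then \<phi> (j + 1) else 0)"

definition lin :: "nat \<Rightarrow> (nat \<Rightarrow> real) \<Rightarrow> (nat \<Rightarrow> real) \<Rightarrow> real" where
  "lin p u \<phi> = (\<Sum>i<p. \<phi> i * u i)"

definition bil :: "nat \<Rightarrow> (nat \<Rightarrow> nat \<Rightarrow> real) \<Rightarrow> (nat \<Rightarrow> real) \<Rightarrow> (nat \<Rightarrow> real) \<Rightarrow> real" where
  "bil p l \<phi> \<psi> = (\<Sum>i<p. \<Sum>j<p. \<phi> i * l i j * \<psi> j)"

definition delta :: "nat \<Rightarrow> nat \<Rightarrow> real" where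
  "delta i = (\<lambda>j. if j = i then 1 else 0)"

lemma lin_delta: "i < p \<Longrightarrow> lin p u (delta i) = u i"
  by (simp add: lin_def delta_def if_distrib[of "\<lambda>x. x * _"] cong: if_cong)

lemma bil_delta:
  assumes "i < p" "j < p" shows "bil p l (delta i) (delta j) = l i j"
proof -
  have "(\<Sum>m<p. delta i k * l k m * delta j m) = delta i k * l k j" for k
    using assms by (simp add: delta_def if_distrib[of "\<lambda>x. _ * x"] cong: if_cong)
  then show ?thesis
    using assms by (simp add: bil_def delta_def if_distrib[of "\<lambda>x. x * _"] cong: if_cong)
qed

lemma lin_scale: "lin p u (\<lambda>i. s * \<phi> i) = s * lin p u \<phi>"
  by (simp add: lin_def sum_distrib_left mult.assoc)

lemma bil_scale: "bil p l (\<lambda>i. s * \<phi> i) (\<lambda>i. t * \<psi> i) = s * t * bil p l \<phi> \<psi>"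
  by (simp add: bil_def sum_distrib_left mult_ac)

lemma bil_sum_left:
  "bil p l (\<lambda>k. \<Sum>i\<in>I. \<phi> i * g i k) \<psi> = (\<Sum>i\<in>I. \<phi> i * bil p l (g i) \<psi>)"
proof -
  have "bil p l (\<lambda>k. \<Sum>i\<in>I. \<phi> i * g i k) \<psi> = (\<Sum>k<p. \<Sum>m<p. \<Sum>i\<in>I. \<phi> i * (g i k * l k m * \<psi> m))"
    by (simp add: bil_def sum_distrib_right sum_distrib_left mult_ac)
  also have "\<dots> = (\<Sum>k<p. \<Sum>i\<in>I. \<Sum>m<p. \<phi> i * (g i k * l k m * \<psi> m))"
    by (intro sum.cong refl sum.swap)
  also have "\<dots> = (\<Sum>i\<in>I. \<Sum>k<p. \<Sum>m<p. \<phi> i * (g i k * l k m * \<psi> m))"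
    by (rule sum.swap)
  finally show ?thesis by (simp add: bil_def sum_distrib_left)
qed

lemma bil_swap: "bil p l \<phi> \<psi> = bil p (\<lambda>i j. l j i) \<psi> \<phi>"
  unfolding bil_def by (subst sum.swap) (simp add: mult_ac)

lemma bil_sum_right:
  "bil p l \<psi> (\<lambda>k. \<Sum>i\<in>I. \<phi> i * g i k) = (\<Sum>i\<in>I. \<phi> i * bil p l \<psi> (g i))"
  by (simp add: bil_swap[of p l] bil_sum_left)

lemma bil_cong:
  assumes "\<And>i. i < p \<Longrightarrow> \<phi> i = \<phi>' i" "\<And>i. i < p \<Longrightarrow> \<psi> i = \<psi>' i"
    "\<And>i j. i < p \<Longrightarrow> j < p \<Longrightarrow> l i j = l' i j"
  shows "bil p l \<phi> \<psi> = bil p l' \<phi>' \<psi>'"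
  unfolding bil_def using assms by (intro sum.cong refl) auto

lemma lin_cong:
  assumes "\<And>i. i < p \<Longrightarrow> \<phi> i = \<phi>' i" "\<And>i. i < p \<Longrightarrow> u i = u' i"
  shows "lin p u \<phi> = lin p u' \<phi>'"
  unfolding lin_def using assms by (intro sum.cong refl) auto

text \<open>Linearity of A^t in the form of a basis expansion. It holds at every index k, not only
  below \<open>p\<close>, so it is an equation between functions and can be substituted without
  congruence conditions.\<close>

lemma adj_expand:
  assumes "p \<ge> 1" shows "adj p a \<phi> = (\<lambda>k. \<Sum>i<p. \<phi> i * adj p a (delta i) k)"
proof
  fix k
  have "(\<Sum>i<p. \<phi> i * adj p a (delta i) k) =
    (\<Sum>i<p. if i = 0 then \<phi> i * a (k + 1) else 0) +
    (\<Sum>i<p. if i = k + 1 then \<phi> i else 0)"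
    unfolding sum.distrib[symmetric]
    by (intro sum.cong refl) (auto simp: adj_def delta_def)
  also have "\<dots> = adj p a \<phi> k"
    using assms by (auto simp: adj_def)
  finally show "adj p a \<phi> k = (\<Sum>i<p. \<phi> i * adj p a (delta i) k)" by simp
qed

text \<open>The duality \<phi> . (A u) = (A^t \<phi>) . u, with A u given by its
  coordinates.\<close>

lemma lin_adj:
  assumes "p \<ge> 1" shows "(\<Sum>i<p. \<phi> i * lin p u (adj p a (delta i))) = lin p u (adj p a \<phi>)"
proof -
  have "lin p u (adj p a \<phi>) = (\<Sum>k<p. \<Sum>i<p. \<phi> i * (adj p a (delta i) k * u k))"
    by (subst adj_expand[OF assms]) (simp add: lin_def sum_distrib_right mult.assoc)
  also have "\<dots> = (\<Sum>i<p. \<Sum>k<p. \<phi> i * (adj p a (delta i) k * u k))"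
    by (rule sum.swap)
  finally show ?thesis by (simp add: lin_def sum_distrib_left)
qed

text \<open>The matrix on the left is A l A^t entry by entry; its form is the form of l pulled back
  along A^t.\<close>

lemma bil_adj:
  assumes "p \<ge> 1"
  shows "bil p (\<lambda>i j. bil p l (adj p a (delta i)) (adj p a (delta j))) \<phi> \<psi> =
    bil p l (adj p a \<phi>) (adj p a \<psi>)"
  by (subst (3 4) adj_expand[OF assms], subst bil_sum_left, subst bil_sum_right)
    (simp add: bil_def[of p "\<lambda>i j. bil p l (adj p a (delta i)) (adj p a (delta j))"]
      sum_distrib_left mult_ac)

lemma bil_add: "bil p (\<lambda>i j. f i j + g i j) \<phi> \<psi> = bil p f \<phi> \<psi> + bil p g \<phi> \<psi>"
  by (simp add: bil_def algebra_simps sum.distrib)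

lemma bil_diff: "bil p (\<lambda>i j. f i j - g i j) \<phi> \<psi> = bil p f \<phi> \<psi> - bil p g \<phi> \<psi>"
  by (simp add: bil_def algebra_simps sum_subtractf)

lemma bil_divide: "bil p (\<lambda>i j. f i j / s) \<phi> \<psi> = bil p f \<phi> \<psi> / s"
  by (simp add: bil_def sum_divide_distrib)

text \<open>
  The locale abstracts the unit ball \<open>D\<close> of the dual norm, whose elements are read as coefficient
  functions restricted to indices below \<open>p\<close>: the transposes of both companion matrices map \<open>D\<close>
  into \<open>\<beta> D\<close>.
\<close>

locale dual_ball =
  fixes p :: nat and a b :: "nat \<Rightarrow> real" and D :: "(nat \<Rightarrow> real) set" and \<beta> c C :: real
  assumes p: "p \<ge> 1" and \<beta>: "0 < \<beta>" "\<beta> < 1" and c: "0 < c"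
    and D_a: "\<phi> \<in> D \<Longrightarrow> (\<lambda>i. adj p a \<phi> i / \<beta>) \<in> D"
    and D_b: "\<phi> \<in> D \<Longrightarrow> (\<lambda>i. adj p b \<phi> i / \<beta>) \<in> D"
    and D_bound: "\<phi> \<in> D \<Longrightarrow> i < p \<Longrightarrow> \<bar>\<phi> i\<bar> \<le> C"
    and D_box: "(\<And>i. i < p \<Longrightarrow> \<bar>\<phi> i\<bar> \<le> c) \<Longrightarrow> \<phi> \<in> D"
begin

lemma C_ge: "c \<le> C"
  using D_bound[OF D_box, of "\<lambda>_. c" 0] c p by auto

lemma C_pos: "0 < C" using C_ge c by linarith

text \<open>\<open>D\<close> contains a box around 0, hence absorbs every \<phi>; homogeneous
  statements proved on \<open>D\<close> thereby extend to all coefficient functions.\<close>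

lemma scaled_in_D: obtains s where "s > 0" "(\<lambda>i. s * \<phi> i) \<in> D"
proof -
  define K where "K = 1 + (\<Sum>i<p. \<bar>\<phi> i\<bar>)"
  have K: "K > 0" unfolding K_def by (simp add: add_pos_nonneg sum_nonneg)
  have "\<bar>\<phi> i\<bar> \<le> K" if "i < p" for i
    using member_le_sum[of i "{..<p}" "\<lambda>i. \<bar>\<phi> i\<bar>"] that by (simp add: K_def)
  then have "\<bar>c / K * \<phi> i\<bar> \<le> c" if "i < p" for i
    using that c K mult_left_mono[of "\<bar>\<phi> i\<bar>" K c] by (simp add: abs_mult field_simps)
  then show ?thesis using c K D_box[of "\<lambda>i. c / K * \<phi> i"] that[of "c / K"] by simp
qed

lemma c_delta_in_D: "(\<lambda>j. c * delta i j) \<in> D"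
  using c by (intro D_box) (auto simp: delta_def)

text \<open>A^t \<phi> lies in \<beta> D, where the coordinates are at most \<beta> C, and \<beta> <
  1.\<close>

lemma adj_bound:
  assumes "\<phi> \<in> D" "i < p" shows "\<bar>adj p a \<phi> i\<bar> \<le> C" "\<bar>adj p b \<phi> i\<bar> \<le> C"
  using D_bound[OF D_a[OF assms(1)] assms(2)] D_bound[OF D_b[OF assms(1)] assms(2)] \<beta> C_pos
    mult_left_mono[of \<beta> 1 C]
  by (auto simp: field_simps intro: order_trans)

lemma lin_bound: 
  assumes "\<And>i. i < p \<Longrightarrow> \<bar>\<phi> i\<bar> \<le> C" shows "\<bar>lin p u \<phi>\<bar> \<le> C * (\<Sum>i<p. \<bar>u i\<bar>)"
proof -
  have "\<bar>lin p u \<phi>\<bar> \<le> (\<Sum>i<p. \<bar>\<phi> i * u i\<bar>)" unfolding lin_def by (rule sum_abs)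
  also have "\<dots> \<le> (\<Sum>i<p. C * \<bar>u i\<bar>)"
    using assms by (intro sum_mono) (simp add: abs_mult mult_right_mono)
  finally show ?thesis by (simp add: sum_distrib_left)
qed

lemma bil_bound:
  assumes "\<phi> \<in> D" "\<psi> \<in> D" shows "\<bar>bil p l \<phi> \<psi>\<bar> \<le> C * C * (\<Sum>i<p. \<Sum>j<p. \<bar>l i j\<bar>)"
proof -
  have "\<bar>bil p l \<phi> \<psi>\<bar> \<le> (\<Sum>i<p. \<Sum>j<p. \<bar>\<phi> i * l i j * \<psi> j\<bar>)"
    unfolding bil_def by (rule order_trans[OF sum_abs]) (intro sum_mono sum_abs)
  also have "\<dots> \<le> (\<Sum>i<p. \<Sum>j<p. (C * C) * \<bar>l i j\<bar>)"
  proof (intro sum_mono)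
    fix i j assume "i \<in> {..<p}" "j \<in> {..<p}"
    then have "\<bar>\<phi> i\<bar> * \<bar>\<psi> j\<bar> \<le> C * C"
      using D_bound assms C_pos by (intro mult_mono) auto
    then have "\<bar>\<phi> i\<bar> * \<bar>\<psi> j\<bar> * \<bar>l i j\<bar> \<le> C * C * \<bar>l i j\<bar>"
      by (rule mult_right_mono) simp
    then show "\<bar>\<phi> i * l i j * \<psi> j\<bar> \<le> C * C * \<bar>l i j\<bar>" by (simp add: abs_mult mult_ac)
  qed
  finally show ?thesis by (simp add: sum_distrib_left)
qed

text \<open>A^t \<phi> is \<beta> times an element of \<open>D\<close>, and homogeneity pulls
  \<beta> out. Only homogeneity of \<open>e\<close> is assumed, so the lemma applies to errors such
  as \<open>avg1 n \<phi> - lamf \<phi>\<close> as well as to \<open>lin\<close>.\<close>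

lemma lin_adj_bound:
  assumes "\<And>\<phi>. \<phi> \<in> D \<Longrightarrow> \<bar>e \<phi>\<bar> \<le> y" "\<phi> \<in> D"
    and e: "\<And>s \<phi>. e (\<lambda>i. s * \<phi> i) = s * e \<phi>"
  shows "\<bar>e (adj p a \<phi>)\<bar> \<le> \<beta> * y" "\<bar>e (adj p b \<phi>)\<bar> \<le> \<beta> * y"
proof -
  have *: "\<bar>e \<phi>'\<bar> \<le> \<beta> * y" if "(\<lambda>i. \<phi>' i / \<beta>) \<in> D" for \<phi>'
  proof -
    have "e \<phi>' = \<beta> * e (\<lambda>i. \<phi>' i / \<beta>)"
      using e[of \<beta> "\<lambda>i. \<phi>' i / \<beta>"] \<beta> by simp
    then show ?thesis using assms(1)[OF that] \<beta> by (simp add: abs_mult mult_left_mono)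
  qed
  show "\<bar>e (adj p a \<phi>)\<bar> \<le> \<beta> * y" "\<bar>e (adj p b \<phi>)\<bar> \<le> \<beta> * y"
    using D_a D_b assms(2) by (auto intro!: *)
qed

text \<open>Both arguments are scaled, hence the square of \<beta>.\<close>

lemma bil_adj_bound:
  assumes "\<And>\<phi> \<psi>. \<phi> \<in> D \<Longrightarrow> \<psi> \<in> D \<Longrightarrow> \<bar>e \<phi> \<psi>\<bar> \<le> y" "\<phi> \<in> D" "\<psi> \<in> D"
    and e: "\<And>s t \<phi> \<psi>. e (\<lambda>i. s * \<phi> i) (\<lambda>i. t * \<psi> i) = s * t * e \<phi> \<psi>"
  shows "\<bar>e (adj p a \<phi>) (adj p a \<psi>)\<bar> \<le> \<beta>\<^sup>2 * y" "\<bar>e (adj p b \<phi>) (adj p b \<psi>)\<bar> \<le> \<beta>\<^sup>2 * y"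
proof -
  have *: "\<bar>e \<phi>' \<psi>'\<bar> \<le> \<beta>\<^sup>2 * y"
    if "(\<lambda>i. \<phi>' i / \<beta>) \<in> D" "(\<lambda>i. \<psi>' i / \<beta>) \<in> D" for \<phi>' \<psi>'
  proof -
    have "e \<phi>' \<psi>' = \<beta>\<^sup>2 * e (\<lambda>i. \<phi>' i / \<beta>) (\<lambda>i. \<psi>' i / \<beta>)"
      using e[of \<beta> "\<lambda>i. \<phi>' i / \<beta>" \<beta> "\<lambda>i. \<psi>' i / \<beta>"] \<beta> by (simp add: power2_eq_square)
    then show ?thesis using assms(1)[OF that] by (simp add: abs_mult mult_left_mono)
  qed
  show "\<bar>e (adj p a \<phi>) (adj p a \<psi>)\<bar> \<le> \<beta>\<^sup>2 * y" "\<bar>e (adj p b \<phi>) (adj p b \<psi>)\<bar> \<le> \<beta>\<^sup>2 * y"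
    using D_a D_b assms(2,3) by (auto intro!: *)
qed

lemma \<beta>2: "0 \<le> \<beta>\<^sup>2" "\<beta>\<^sup>2 < 1"
  using \<beta> by (auto simp: power_less_one_iff abs_square_less_1)

text \<open>\<open>d\<close> stands for the difference of two solutions. Its form is bounded on
  \<open>D\<close> and does not exceed \<beta>^2 times any bound for itself, so it vanishes there;
  testing with multiples of basis vectors reads off the entries.\<close>

lemma fixed_point_unique:
  assumes "\<And>\<phi> \<psi>. bil p d \<phi> \<psi> =
      (bil p d (adj p a \<phi>) (adj p a \<psi>) + bil p d (adj p b \<phi>) (adj p b \<psi>)) / 2"
    and "i < p" "j < p"
  shows "d i j = 0"
proof -
  let ?e = "\<lambda>(n::nat) (\<phi>, \<psi>). bil p d \<phi> \<psi>"
  obtain y where y: "y \<longlonglongrightarrow> 0" "\<And>n f. f \<in> D \<times> D \<Longrightarrow> \<bar>?e n f\<bar> \<le> y n"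
  proof (rule uniform_contraction_tendsto_0[where e = ?e and D = "D \<times> D" and r = "\<lambda>_. 0" and ?n0.0 = 0,
        OF \<beta>2])
    show "\<bar>?e 0 f\<bar> \<le> C * C * (\<Sum>i<p. \<Sum>j<p. \<bar>d i j\<bar>)" if "f \<in> D \<times> D" for f
      using that bil_bound by auto
  next
    fix n y and f assume *: "\<And>f. f \<in> D \<times> D \<Longrightarrow> \<bar>?e n f\<bar> \<le> y" and f: "f \<in> D \<times> D"
    obtain \<phi> \<psi> where [simp]: "f = (\<phi>, \<psi>)" and "\<phi> \<in> D" "\<psi> \<in> D" using f by auto
    note bil_adj_bound[of "bil p d" y, OF _ this(2,3) bil_scale]
    then show "\<bar>?e (Suc n) f\<bar> \<le> \<beta>\<^sup>2 * y + 0"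
      using * assms(1)[of \<phi> \<psi>] by fastforce
  qed auto
  have "\<bar>bil p d (\<lambda>k. c * delta i k) (\<lambda>k. c * delta j k)\<bar> \<le> 0"
    using y(2)[of "(\<lambda>k. c * delta i k, \<lambda>k. c * delta j k)"] c_delta_in_D
    by (intro LIMSEQ_le_const[OF y(1)]) auto
  then show ?thesis using c assms(2,3) by (simp add: bil_scale bil_delta)
qed

text \<open>The solution is the Neumann series of the map l -> (A l A^t + B l B^t) / 2 applied to
  \<open>T\<close>. On \<open>D\<close> the n-th term has a form of size at most \<beta>^(2n) times
  a constant, so every entry is dominated by a geometric series.\<close>

lemma fixed_point_exists:
  obtains l where "\<And>\<phi> \<psi>. bil p l \<phi> \<psi> = bil p T \<phi> \<psi> +
      (bil p l (adj p a \<phi>) (adj p a \<psi>) + bil p l (adj p b \<phi>) (adj p b \<psi>)) / 2"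
proof -
  define \<Phi> where "\<Phi> l i j = (bil p l (adj p a (delta i)) (adj p a (delta j)) +
      bil p l (adj p b (delta i)) (adj p b (delta j))) / 2" for l i j
  have \<Phi>: "bil p (\<Phi> l) \<phi> \<psi> =
      (bil p l (adj p a \<phi>) (adj p a \<psi>) + bil p l (adj p b \<phi>) (adj p b \<psi>)) / 2" for l \<phi> \<psi>
    unfolding \<Phi>_def bil_divide bil_add bil_adj[OF p] ..
  define K where "K = C * C * (\<Sum>i<p. \<Sum>j<p. \<bar>T i j\<bar>)"
  define d where "d n = (\<Phi> ^^ n) T" for n
  have d_Suc: "bil p (d (Suc n)) \<phi> \<psi> =
      (bil p (d n) (adj p a \<phi>) (adj p a \<psi>) + bil p (d n) (adj p b \<phi>) (adj p b \<psi>)) / 2" for n \<phi> \<psi>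
    by (simp add: d_def \<Phi>)
  have d_bound: "\<bar>bil p (d n) \<phi> \<psi>\<bar> \<le> (\<beta>\<^sup>2) ^ n * K" if "\<phi> \<in> D" "\<psi> \<in> D" for n \<phi> \<psi>
    using that
  proof (induction n arbitrary: \<phi> \<psi>)
    case 0
    then show ?case using bil_bound[of \<phi> \<psi> T] by (simp add: d_def K_def)
  next
    case (Suc n)
    have "\<bar>bil p (d n) (adj p a \<phi>) (adj p a \<psi>)\<bar> \<le> \<beta>\<^sup>2 * ((\<beta>\<^sup>2) ^ n * K)"
      "\<bar>bil p (d n) (adj p b \<phi>) (adj p b \<psi>)\<bar> \<le> \<beta>\<^sup>2 * ((\<beta>\<^sup>2) ^ n * K)"
      by (intro bil_adj_bound Suc.IH Suc.prems bil_scale; assumption)+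
    then show ?case unfolding d_Suc power_Suc mult.assoc add_divide_distrib by linarith
  qed
  have "summable (\<lambda>n. d n i j)" if "i < p" "j < p" for i j
  proof (rule summable_comparison_test')
    show "summable (\<lambda>n. (\<beta>\<^sup>2) ^ n * (K / (c * c)))"
      using \<beta>2 by (intro summable_mult2 summable_geometric) auto
    fix n :: nat
    show "norm (d n i j) \<le> (\<beta>\<^sup>2) ^ n * (K / (c * c))"
    proof -
      have "\<bar>c * c * d n i j\<bar> \<le> (\<beta>\<^sup>2) ^ n * K"
        using d_bound[OF c_delta_in_D[of i] c_delta_in_D[of j], of n]
        unfolding bil_scale bil_delta[OF that] .
      then have "(c * c) * \<bar>d n i j\<bar> \<le> (\<beta>\<^sup>2) ^ n * K"
        using c by (simp add: abs_mult)
      then show ?thesis using c by (simp add: pos_le_divide_eq mult.commute)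
    qed
  qed
  then have sums: "(\<lambda>n. d n i j) sums (\<Sum>n. d n i j)" if "i < p" "j < p" for i j
    using that by (simp add: summable_sums)
  define l where "l i j = (\<Sum>n. d n i j)" for i j
  have bil_sums: "(\<lambda>n. bil p (d n) \<phi> \<psi>) sums bil p l \<phi> \<psi>" for \<phi> \<psi>
    unfolding bil_def l_def
    by (intro sums_sum sums_mult2 sums_mult sums) auto
  have "bil p l \<phi> \<psi> = bil p T \<phi> \<psi> +
      (bil p l (adj p a \<phi>) (adj p a \<psi>) + bil p l (adj p b \<phi>) (adj p b \<psi>)) / 2" for \<phi> \<psi>
  proof -
    have "(\<lambda>n. bil p (d (Suc n)) \<phi> \<psi>) sums
       ((bil p l (adj p a \<phi>) (adj p a \<psi>) + bil p l (adj p b \<phi>) (adj p b \<psi>)) / 2)"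
      unfolding d_Suc by (intro sums_divide sums_add bil_sums)
    \<comment> \<open>Prepending the term of index 0, which is the form of \<open>T\<close>, turns
      the sum of the shifted series into the right-hand side of the equation; uniqueness of sums
      then identifies it with the form of \<open>l\<close>.\<close>
    then have "(\<lambda>n. bil p (d n) \<phi> \<psi>) sums
       ((bil p l (adj p a \<phi>) (adj p a \<psi>) + bil p l (adj p b \<phi>) (adj p b \<psi>)) / 2 + bil p (d 0) \<phi> \<psi>)"
      by (rule sums_Suc)
    with bil_sums[of \<phi> \<psi>] show ?thesis
      by (auto dest: sums_unique2 simp: d_def)
  qed
  then show ?thesis by (rule that)
qed

text \<open>The inequality makes the negative part of \<open>q\<close> contract by \<beta>^2 on
  \<open>D\<close>, so it vanishes and q is nonnegative. If then q \<phi> = 0, both nonnegative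
  contributions on the right vanish, which gives \<phi>_0 = 0 and passes q = 0 on to A^t \<phi>;
  repeating this uncovers one coordinate after another.\<close>

lemma quadratic_form_positive:
  fixes q :: "(nat \<Rightarrow> real) \<Rightarrow> real"
  assumes s: "s > 0"
    and q: "\<And>\<phi>. q \<phi> \<ge> s * (\<phi> 0)\<^sup>2 + (q (adj p a \<phi>) + q (adj p b \<phi>)) / 2"
    and hom: "\<And>t \<phi>. q (\<lambda>i. t * \<phi> i) = t\<^sup>2 * q \<phi>"
    and bnd: "\<And>\<phi>. \<phi> \<in> D \<Longrightarrow> \<bar>q \<phi>\<bar> \<le> K"
  shows "q \<phi> \<ge> 0" and "q \<phi> = 0 \<Longrightarrow> i < p \<Longrightarrow> \<phi> i = 0"
proof -
  let ?e = "\<lambda>(n::nat) \<phi>. min (q \<phi>) 0"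
  obtain y where y: "y \<longlonglongrightarrow> 0" "\<And>n f. f \<in> D \<Longrightarrow> \<bar>?e n f\<bar> \<le> y n"
  proof (rule uniform_contraction_tendsto_0[where e = ?e and D = D and r = "\<lambda>_. 0" and ?n0.0 = 0,
        OF \<beta>2])
    show "\<bar>?e 0 \<phi>\<bar> \<le> K" if "\<phi> \<in> D" for \<phi>
      using bnd[OF that] by auto
  next
    fix n y \<phi> assume *: "\<And>f. f \<in> D \<Longrightarrow> \<bar>?e n f\<bar> \<le> y" and \<phi>: "\<phi> \<in> D"
    \<comment> \<open>The bound is applied at A^t \<phi> / \<beta> and B^t \<phi> / \<beta>, which
      lie in \<open>D\<close>; the factor 1 / \<beta>^2 comes from homogeneity of degree
      two.\<close>
    have "- q (adj p a \<phi>) / \<beta>\<^sup>2 \<le> y" "- q (adj p b \<phi>) / \<beta>\<^sup>2 \<le> y" "0 \<le> y"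
      using *[OF D_a[OF \<phi>]] *[OF D_b[OF \<phi>]]  
        hom[of "1 / \<beta>" "adj p a \<phi>"] hom[of "1 / \<beta>" "adj p b \<phi>"]
      by (auto simp: power_divide)
    then have "- q (adj p a \<phi>) \<le> \<beta>\<^sup>2 * y" "- q (adj p b \<phi>) \<le> \<beta>\<^sup>2 * y" "0 \<le> \<beta>\<^sup>2 * y"
      using \<beta> by (simp_all add: field_simps)
    moreover have "s * (\<phi> 0)\<^sup>2 \<ge> 0" using s by simp
    ultimately show "\<bar>?e (Suc n) \<phi>\<bar> \<le> \<beta>\<^sup>2 * y + 0"
      using q[of \<phi>] unfolding add_divide_distrib by linarith
  qed auto
  show nonneg: "q \<phi> \<ge> 0" for \<phi>
  proof -
    obtain t where t: "t > 0" "(\<lambda>i. t * \<phi> i) \<in> D" by (rule scaled_in_D)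
    have "\<bar>min (q (\<lambda>i. t * \<phi> i)) 0\<bar> \<le> 0"
      using y(1) y(2)[OF t(2)] by (intro LIMSEQ_le_const) auto
    then have "t\<^sup>2 * q \<phi> \<ge> 0" unfolding hom by linarith
    then show ?thesis using t(1) by (simp add: zero_le_mult_iff)
  qed
  show "\<phi> i = 0" if "q \<phi> = 0" "i < p"
    using that
  proof (induction i arbitrary: \<phi>)
    case 0
    have "s * (\<phi> 0)\<^sup>2 \<le> 0"
      using q[of \<phi>] nonneg[of "adj p a \<phi>"] nonneg[of "adj p b \<phi>"] 0
      unfolding add_divide_distrib by linarith
    then show ?case using s by (simp add: mult_le_0_iff)
  next
    case (Suc i)
    have "0 \<le> s * (\<phi> 0)\<^sup>2" using s by simp
    then have "s * (\<phi> 0)\<^sup>2 = 0" "q (adj p a \<phi>) = 0"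
      using q[of \<phi>] nonneg[of "adj p a \<phi>"] nonneg[of "adj p b \<phi>"] Suc.prems
      unfolding add_divide_distrib by linarith+
    \<comment> \<open>Once \<phi>_0 = 0, the transpose A^t acts on \<phi> as a shift, so its
      coordinate i is coordinate i + 1 of \<phi>.\<close>
    then have "\<phi> 0 = 0" "adj p a \<phi> i = 0"
      using s Suc.IH Suc.prems by auto
    then show ?case using Suc.prems by (simp add: adj_def)
  qed
qed

end

lemma companion_carrier: "companion p a \<in> carrier_mat p p"
  by (simp add: companion_def)

lemma companion_adj: "i < p \<Longrightarrow> k < p \<Longrightarrow> companion p a $$ (i, k) = adj p a (delta i) k"
  by (auto simp: companion_def adj_def delta_def)

lemma companion_mult_vec:
  assumes "u \<in> carrier_vec p" "i < p"
  shows "(companion p a *\<^sub>v u) $ i = lin p (($) u) (adj p a (delta i))"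
  using assms companion_carrier[of p a]
  by (simp add: scalar_prod_def lin_def companion_adj atLeast0LessThan)

lemma lin_companion_mult_vec:
  assumes "p \<ge> 1" "u \<in> carrier_vec p"
  shows "lin p (($) (companion p a *\<^sub>v u)) \<phi> = lin p (($) u) (adj p a \<phi>)"
  using lin_adj[OF assms(1), of \<phi> "($) u" a]
  by (simp add: lin_def[of p "($) (companion p a *\<^sub>v u)"] companion_mult_vec[OF assms(2)])

lemma companion_sandwich:
  assumes l: "l \<in> carrier_mat p p" and "i < p" "j < p"
  shows "(companion p a * l * transpose_mat (companion p a)) $$ (i, j) =
    bil p (\<lambda>i j. l $$ (i, j)) (adj p a (delta i)) (adj p a (delta j))"
proof -
  have "(companion p a * l * transpose_mat (companion p a)) $$ (i, j) =
     (\<Sum>k<p. adj p a (delta i) k * (\<Sum>m<p. l $$ (k, m) * adj p a (delta j) m))"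
    using assms companion_carrier[of p a]
    by (simp add: scalar_prod_def companion_adj atLeast0LessThan)
  then show ?thesis by (simp add: bil_def sum_distrib_left mult.assoc)
qed

section \<open>Norms and dual unit balls\<close>

text \<open>The triangle inequality for the basis expansion. The induction truncates the vector
  after its first k coordinates and adds one coordinate at a time.\<close>

lemma norm_sum_bound:
  assumes N: "norm_on_carrier p N"
  shows "N (Matrix.vec p f) \<le> (\<Sum>i<p. \<bar>f i\<bar> * N (unit_vec p i))"
proof -
  have "N (Matrix.vec p (\<lambda>i. if i < k then f i else 0)) \<le> (\<Sum>i<k. \<bar>f i\<bar> * N (unit_vec p i))" if "k \<le> p" for k
    using that
  proof (induction k)
    case 0
    have "Matrix.vec p (\<lambda>i. if i < 0 then f i else 0) = 0\<^sub>v p" by auto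
    moreover have "N (0\<^sub>v p) = 0" using N zero_carrier_vec unfolding norm_on_carrier_def by blast
    ultimately show ?case by simp
  next
    case (Suc k)
    let ?v = "Matrix.vec p (\<lambda>i. if i < k then f i else 0)"
    have "Matrix.vec p (\<lambda>i. if i < Suc k then f i else 0) = ?v + f k \<cdot>\<^sub>v unit_vec p k"
      using Suc.prems by (intro eq_vecI) (auto simp: unit_vec_def less_Suc_eq)
    also have "N \<dots> \<le> N ?v + N (f k \<cdot>\<^sub>v unit_vec p k)"
      using N vec_carrier smult_carrier_vec unit_vec_carrier
      unfolding norm_on_carrier_def by blast
    also have "N (f k \<cdot>\<^sub>v unit_vec p k) = \<bar>f k\<bar> * N (unit_vec p k)"
      using N unfolding norm_on_carrier_def by simp
    finally show ?case using Suc by simp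
  qed
  moreover have "Matrix.vec p (\<lambda>i. if i < p then f i else 0) = Matrix.vec p f" by auto
  ultimately show ?thesis by (metis order_refl)
qed

text \<open>Continuity is for the product topology on \<open>nat \<Rightarrow> real\<close>, where
  compact sets are available as products. It holds because N is Lipschitz in the finitely many
  coordinates below \<open>p\<close>.\<close>

lemma continuous_norm_vec:
  assumes N: "norm_on_carrier p N"
  shows "continuous_on UNIV (\<lambda>f. N (Matrix.vec p f))"
proof -
  have tri: "N (Matrix.vec p f) - N (Matrix.vec p g) \<le> (\<Sum>i<p. \<bar>f i - g i\<bar> * N (unit_vec p i))" for f g
  proof -
    have "Matrix.vec p f = Matrix.vec p g + Matrix.vec p (\<lambda>i. f i - g i)" by auto
    then have "N (Matrix.vec p f) \<le> N (Matrix.vec p g) + N (Matrix.vec p (\<lambda>i. f i - g i))"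
      using N unfolding norm_on_carrier_def by (metis vec_carrier)
    then show ?thesis using norm_sum_bound[OF N, of "\<lambda>i. f i - g i"] by simp
  qed
  have "((\<lambda>f. N (Matrix.vec p f)) \<longlongrightarrow> N (Matrix.vec p g)) (at g)" for g
  proof (rule Lim_null[THEN iffD2, OF Lim_null_comparison])
    show "\<forall>\<^sub>F f in at g. norm (N (Matrix.vec p f) - N (Matrix.vec p g)) \<le> (\<Sum>i<p. \<bar>f i - g i\<bar> * N (unit_vec p i))"
      using tri[of _ g] tri[of g] by (intro always_eventually) (simp add: abs_le_iff abs_minus_commute)
    have "((\<lambda>f. \<Sum>i<p. \<bar>f i - g i\<bar> * N (unit_vec p i)) \<longlongrightarrow> (\<Sum>i<p. \<bar>g i - g i\<bar> * N (unit_vec p i))) (at g)"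
      by (intro tendsto_intros
          continuous_on_product_coordinates[unfolded continuous_on_def, rule_format, OF UNIV_I])
    then show "((\<lambda>f. \<Sum>i<p. \<bar>f i - g i\<bar> * N (unit_vec p i)) \<longlongrightarrow> 0) (at g)" by simp
  qed
  then show ?thesis by (simp add: continuous_on_def)
qed

text \<open>Equivalence of N with the maximum norm: on the unit sphere \<open>S\<close> of the
  latter, which is compact, N attains a minimum m > 0, and \<kappa> = 1 / m.\<close>

lemma norm_coordinate_bound:
  assumes N: "norm_on_carrier p N" and p: "p \<ge> 1"
  obtains \<kappa> where "\<kappa> > 0" "\<And>u i. u \<in> carrier_vec p \<Longrightarrow> i < p \<Longrightarrow> \<bar>u $ i\<bar> \<le> \<kappa> * N u"
proof -
  \<comment> \<open>The coordinates from \<open>p\<close> on are pinned to 0, which makes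
    \<open>K\<close> a product of compact sets over all of \<open>nat\<close>.\<close>
  define K where "K = PiE UNIV (\<lambda>i. if i < p then {-1..1} else {0::real})"
  define S where "S = K \<inter> (\<Union>i<p. {f. \<bar>f i\<bar> = 1})"
  have "compact K"
    unfolding K_def compact_def[symmetric]
    by (simp add: compactin_PiE flip: compactin_euclidean_iff euclidean_product_topology)
      (simp add: compactin_euclidean_iff)
  moreover have "closed (\<Union>i<p. {f :: nat \<Rightarrow> real. \<bar>f i\<bar> = 1})"
    by (intro closed_UN ballI closed_Collect_eq continuous_on_rabs continuous_on_const
        continuous_on_product_coordinates) auto
  ultimately have "compact S" unfolding S_def by (rule compact_Int_closed)
  moreover have "delta 0 \<in> S" using p by (auto simp: S_def K_def delta_def intro!: bexI[of _ 0])
  ultimately obtain f0 where f0: "f0 \<in> S" "\<And>f. f \<in> S \<Longrightarrow> N (Matrix.vec p f0) \<le> N (Matrix.vec p f)"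
    using continuous_attains_inf[of S "\<lambda>f. N (Matrix.vec p f)"]
      continuous_on_subset[OF continuous_norm_vec[OF N]] by blast
  define m where "m = N (Matrix.vec p f0)"
  have "Matrix.vec p f0 \<noteq> 0\<^sub>v p"
    using f0(1) by (auto simp: S_def vec_eq_iff)
  then have m: "m > 0"
    using N unfolding norm_on_carrier_def m_def by (metis order_less_le vec_carrier)
  have "\<bar>u $ i\<bar> \<le> 1 / m * N u" if u: "u \<in> carrier_vec p" and i: "i < p" for u i
  proof (cases "u = 0\<^sub>v p")
    case True
    moreover have "0 \<le> N u" using N u unfolding norm_on_carrier_def by blast
    ultimately show ?thesis using i m by simp
  next
    case False
    define t where "t = Max ((\<lambda>i. \<bar>u $ i\<bar>) ` {..<p})"
    have le: "\<bar>u $ j\<bar> \<le> t" if "j < p" for j using that by (auto simp: t_def)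
    obtain k where k: "k < p" "\<bar>u $ k\<bar> = t"
    proof -
      have "t \<in> (\<lambda>i. \<bar>u $ i\<bar>) ` {..<p}"
        unfolding t_def using p by (intro Max_in) (auto simp: lessThan_empty_iff)
      then show ?thesis using that by auto
    qed
    have "t > 0"
    proof (rule ccontr)
      assume "\<not> t > 0"
      then have "u $ j = 0" if "j < p" for j using le[OF that] by linarith
      then have "u = 0\<^sub>v p" using u by (intro eq_vecI) auto
      with False show False by simp
    qed
    \<comment> \<open>u divided by its maximum norm \<open>t\<close>, hence a point of
      \<open>S\<close>.\<close>
    define f where "f j = (if j < p then u $ j / t else 0)" for j
    have "f \<in> S" using le k \<open>t > 0\<close>
      by (force simp: S_def K_def f_def PiE_iff abs_le_iff field_simps)
    moreover have "Matrix.vec p f = (1 / t) \<cdot>\<^sub>v u" using u by (intro eq_vecI) (auto simp: f_def)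
    ultimately have "m \<le> N u / t"
      using f0(2)[of f] N u \<open>t > 0\<close> unfolding norm_on_carrier_def m_def by simp
    then have "t \<le> 1 / m * N u" using m \<open>t > 0\<close> by (simp add: field_simps)
    then show ?thesis using le[OF i] by linarith
  qed
  then show ?thesis using m by (intro that[of "1 / m"]) auto
qed

text \<open>\<open>op_norm\<close> is a supremum of reals and says nothing until its set is known to
  be bounded; the coordinate bound supplies this. The inequality itself is the definition applied to
  u / N u.\<close>

lemma norm_mult_mat_vec_le:
  assumes N: "norm_on_carrier p N" and p: "p \<ge> 1" and A: "A \<in> carrier_mat p p"
    and u: "u \<in> carrier_vec p"
  shows "N (A *\<^sub>v u) \<le> op_norm p N A * N u"
proof -
  obtain \<kappa> where \<kappa>: "\<kappa> > 0" "\<And>u i. u \<in> carrier_vec p \<Longrightarrow> i < p \<Longrightarrow> \<bar>u $ i\<bar> \<le> \<kappa> * N u"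
    using norm_coordinate_bound[OF N p] by blast
  have N0: "0 \<le> N u" if "u \<in> carrier_vec p" for u using N that unfolding norm_on_carrier_def by blast
  have "N (A *\<^sub>v v) \<le> (\<Sum>i<p. (\<Sum>j<p. \<bar>A $$ (i, j)\<bar> * \<kappa>) * N (unit_vec p i))"
    if v: "v \<in> carrier_vec p" "N v = 1" for v
  proof -
    have "A *\<^sub>v v = Matrix.vec p (($) (A *\<^sub>v v))" using A by auto
    then have "N (A *\<^sub>v v) \<le> (\<Sum>i<p. \<bar>(A *\<^sub>v v) $ i\<bar> * N (unit_vec p i))"
      using norm_sum_bound[OF N] by metis
    also have "\<dots> \<le> (\<Sum>i<p. (\<Sum>j<p. \<bar>A $$ (i, j)\<bar> * \<kappa>) * N (unit_vec p i))"
    proof (intro sum_mono mult_right_mono N0)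
      fix i assume i: "i \<in> {..<p}"
      then have "\<bar>(A *\<^sub>v v) $ i\<bar> = \<bar>\<Sum>j<p. A $$ (i, j) * v $ j\<bar>"
        using A v by (simp add: scalar_prod_def atLeast0LessThan)
      also have "\<dots> \<le> (\<Sum>j<p. \<bar>A $$ (i, j) * v $ j\<bar>)" by (rule sum_abs)
      also have "\<dots> \<le> (\<Sum>j<p. \<bar>A $$ (i, j)\<bar> * \<kappa>)"
        using \<kappa>(2)[OF v(1)] v(2) by (intro sum_mono) (simp add: abs_mult mult_left_mono)
      finally show "\<bar>(A *\<^sub>v v) $ i\<bar> \<le> (\<Sum>j<p. \<bar>A $$ (i, j)\<bar> * \<kappa>)" .
    qed simp
    finally show ?thesis .
  qed
  then have bdd: "bdd_above {N (A *\<^sub>v u) | u. u \<in> carrier_vec p \<and> N u = 1}"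
    by (auto intro!: bdd_aboveI)
  show ?thesis
  proof (cases "u = 0\<^sub>v p")
    case True
    then have "A *\<^sub>v u = 0\<^sub>v p" using A by auto
    moreover have "N (0\<^sub>v p) = 0" using N zero_carrier_vec unfolding norm_on_carrier_def by blast
    ultimately show ?thesis using True by simp
  next
    case False
    then have t: "N u > 0" using N u unfolding norm_on_carrier_def by (metis order_less_le)
    define v where "v = (1 / N u) \<cdot>\<^sub>v u"
    have v: "v \<in> carrier_vec p" "N v = 1"
      using u N t unfolding norm_on_carrier_def v_def by auto
    have "A *\<^sub>v v = (1 / N u) \<cdot>\<^sub>v (A *\<^sub>v u)"
      unfolding v_def using A u by (rule mult_mat_vec)
    then have "N (A *\<^sub>v v) = N (A *\<^sub>v u) / N u"
      using N t A u unfolding norm_on_carrier_def by (simp add: mult_mat_vec_carrier)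
    moreover have "N (A *\<^sub>v v) \<le> op_norm p N A"
      unfolding op_norm_def using v by (intro cSup_upper bdd) auto
    ultimately show ?thesis using t by (simp add: pos_divide_le_eq)
  qed
qed

text \<open>\<open>D\<close> is the polar of the unit ball of N. It is stable under the transposes
  divided by \<beta>, because \<bar>(A^t \<phi>) . u\<bar> = \<bar>\<phi> . (A u)\<bar> \<le> N (A
  u) \<le> \<beta> N u.\<close>

lemma dual_ball_exists:
  assumes N: "norm_on_carrier p N" and p: "p \<ge> 1"
    and op: "max (op_norm p N (companion p a)) (op_norm p N (companion p b)) < 1"
  obtains D \<beta> c C where "dual_ball p a b D \<beta> c C"
proof -
  obtain \<kappa> where \<kappa>: "\<kappa> > 0" "\<And>u i. u \<in> carrier_vec p \<Longrightarrow> i < p \<Longrightarrow> \<bar>u $ i\<bar> \<le> \<kappa> * N u"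
    using norm_coordinate_bound[OF N p] by blast
  have N0: "0 \<le> N u" if "u \<in> carrier_vec p" for u using N that unfolding norm_on_carrier_def by blast
  \<comment> \<open>The lower bound 1 / 2 keeps \<beta> positive, so that one may divide by it even
    when both operator norms are 0.\<close>
  define \<beta> where "\<beta> = max (1 / 2) (max (op_norm p N (companion p a)) (op_norm p N (companion p b)))"
  have \<beta>0: "\<beta> > 0" by (simp add: \<beta>_def)
  define D where "D = {\<phi>. \<forall>u\<in>carrier_vec p. \<bar>lin p (($) u) \<phi>\<bar> \<le> N u}"
  have D_adj: "(\<lambda>i. adj p x \<phi> i / \<beta>) \<in> D"
    if \<phi>: "\<phi> \<in> D" and x: "op_norm p N (companion p x) \<le> \<beta>" for x \<phi>
    unfolding D_def
  proof safe
    fix u :: "real Matrix.vec" assume u: "u \<in> carrier_vec p"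
    have "\<bar>lin p (($) u) (adj p x \<phi>)\<bar> = \<bar>lin p (($) (companion p x *\<^sub>v u)) \<phi>\<bar>"
      by (simp add: lin_companion_mult_vec[OF p u])
    also have "\<dots> \<le> N (companion p x *\<^sub>v u)"
      using \<phi> u companion_carrier[of p x] mult_mat_vec_carrier unfolding D_def by blast
    also have "\<dots> \<le> op_norm p N (companion p x) * N u"
      by (rule norm_mult_mat_vec_le[OF N p companion_carrier u])
    also have "\<dots> \<le> \<beta> * N u" using x N0[OF u] by (rule mult_right_mono)
    finally show "\<bar>lin p (($) u) (\<lambda>i. adj p x \<phi> i / \<beta>)\<bar> \<le> N u"
      using lin_scale[of p "($) u" "1 / \<beta>" "adj p x \<phi>"] \<beta>0
      by (simp add: pos_divide_le_eq mult.commute)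
  qed
  \<comment> \<open>If all \<bar>\<phi>_i\<bar> are at most 1 / (\<kappa> p), then \<phi> . u is a
    sum of p terms, each at most N u / p. The other constant comes from pairing \<phi> with the unit
    vectors, where \<phi>_i is at most N (e_i).\<close>
  have "dual_ball p a b D \<beta> (1 / (\<kappa> * p)) (\<Sum>i<p. N (unit_vec p i))"
  proof
    show "0 < \<beta>" "\<beta> < 1" using op by (auto simp: \<beta>_def)
    show "0 < 1 / (\<kappa> * p)" using \<kappa>(1) p by simp
    show "(\<lambda>i. adj p a \<phi> i / \<beta>) \<in> D" "(\<lambda>i. adj p b \<phi> i / \<beta>) \<in> D" if "\<phi> \<in> D" for \<phi>
      by (intro D_adj that; simp add: \<beta>_def)+
    show "\<bar>\<phi> i\<bar> \<le> (\<Sum>i<p. N (unit_vec p i))" if "\<phi> \<in> D" "i < p" for \<phi> i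
    proof -
      have "lin p (($) (unit_vec p i)) \<phi> = (\<Sum>j<p. if j = i then \<phi> j else 0)"
        unfolding lin_def using that by (intro sum.cong) auto
      then have "\<bar>\<phi> i\<bar> \<le> N (unit_vec p i)"
        using that unfolding D_def by (force dest: bspec[OF _ unit_vec_carrier[of p i]])
      also have "\<dots> \<le> (\<Sum>i<p. N (unit_vec p i))"
        using that N0 by (intro member_le_sum) auto
      finally show ?thesis .
    qed
    show "\<phi> \<in> D" if \<phi>: "\<And>i. i < p \<Longrightarrow> \<bar>\<phi> i\<bar> \<le> 1 / (\<kappa> * p)" for \<phi>
      unfolding D_def
    proof safe
      fix u :: "real Matrix.vec" assume u: "u \<in> carrier_vec p"
      have "\<bar>lin p (($) u) \<phi>\<bar> \<le> (\<Sum>i<p. \<bar>\<phi> i * u $ i\<bar>)" unfolding lin_def by (rule sum_abs)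
      also have "\<dots> \<le> (\<Sum>i<p. 1 / (\<kappa> * p) * (\<kappa> * N u))"
        unfolding abs_mult using \<phi> \<kappa> u p by (intro sum_mono mult_mono) auto
      also have "\<dots> = N u" using \<kappa>(1) p by simp
      finally show "\<bar>lin p (($) u) \<phi>\<bar> \<le> N u" .
    qed
  qed (use p in auto)
  then show ?thesis by (rule that)
qed

section \<open>The limit matrix\<close>

context dual_ball
begin

text \<open>The linear counterpart of \<open>fixed_point_unique\<close>: the averaged companion
  matrix does not have 1 as an eigenvalue.\<close>

lemma lin_fixed_point_unique:
  assumes "\<And>\<phi>. lin p u \<phi> = (lin p u (adj p a \<phi>) + lin p u (adj p b \<phi>)) / 2"
    and "i < p"
  shows "u i = 0"
proof -
  let ?e = "\<lambda>(n::nat) \<phi>. lin p u \<phi>"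
  obtain y where y: "y \<longlonglongrightarrow> 0" "\<And>n f. f \<in> D \<Longrightarrow> \<bar>?e n f\<bar> \<le> y n"
  proof (rule uniform_contraction_tendsto_0[where e = ?e and D = D and r = "\<lambda>_. 0" and ?n0.0 = 0
        and \<beta> = \<beta>])
    show "\<bar>?e 0 \<phi>\<bar> \<le> C * (\<Sum>i<p. \<bar>u i\<bar>)" if "\<phi> \<in> D" for \<phi>
      using that D_bound by (intro lin_bound)
  next
    fix n y \<phi> assume *: "\<And>f. f \<in> D \<Longrightarrow> \<bar>?e n f\<bar> \<le> y" and \<phi>: "\<phi> \<in> D"
    have "\<bar>lin p u (adj p a \<phi>)\<bar> \<le> \<beta> * y" "\<bar>lin p u (adj p b \<phi>)\<bar> \<le> \<beta> * y"
      by (intro lin_adj_bound * \<phi> lin_scale; assumption)+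
    then show "\<bar>?e (Suc n) \<phi>\<bar> \<le> \<beta> * y + 0"
      using assms(1)[of \<phi>] unfolding add_divide_distrib by linarith
  qed (use \<beta> in auto)
  have "\<bar>lin p u (\<lambda>k. c * delta i k)\<bar> \<le> 0"
    using y(2)[of "\<lambda>k. c * delta i k"] c_delta_in_D by (intro LIMSEQ_le_const[OF y(1)]) auto
  then show ?thesis using c assms(2) by (simp add: lin_scale lin_delta)
qed

definition "abar = (a 0 + b 0) / 2"

definition "lamf \<phi> = lin p (($) (lam p a b)) \<phi>"

lemma lamf_scale: "lamf (\<lambda>i. s * \<phi> i) = s * lamf \<phi>"
  by (simp add: lamf_def lin_scale)

text \<open>\<open>lam\<close> is built from \<open>the (mat_inverse _)\<close>, so nothing is known
  about it before I - (A + B) / 2 is shown invertible. A kernel vector would solve the homogeneous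
  fixed point equation and is therefore 0. The recursion for \<open>lamf\<close> is the equation (I
  - (A + B) / 2) lambda = abar e_1 tested with \<phi>.\<close>

lemma lam_carrier_eq:
  shows lam_carrier: "lam p a b \<in> carrier_vec p"
    and lamf_eq: "lamf \<phi> = (lamf (adj p a \<phi>) + lamf (adj p b \<phi>)) / 2 + abar * \<phi> 0"
proof -
  define A B where "A = companion p a" and "B = companion p b"
  define Q where "Q = 1\<^sub>m p - (1 / 2) \<cdot>\<^sub>m (A + B)"
  have AB [simp]: "A \<in> carrier_mat p p" "B \<in> carrier_mat p p"
    using companion_carrier by (auto simp: A_def B_def)
  have Q: "Q \<in> carrier_mat p p" unfolding Q_def using AB by (intro minus_carrier_mat smult_carrier_mat add_carrier_mat)
  have Qv: "Q *\<^sub>v v = v - (1 / 2) \<cdot>\<^sub>v (A *\<^sub>v v + B *\<^sub>v v)" if v: "v \<in> carrier_vec p" for v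
  proof -
    have "Q *\<^sub>v v = 1\<^sub>m p *\<^sub>v v - ((1 / 2) \<cdot>\<^sub>m (A + B)) *\<^sub>v v"
      unfolding Q_def using v by (intro minus_mult_distrib_mat_vec) auto
    also have "((1 / 2) \<cdot>\<^sub>m (A + B)) *\<^sub>v v = (1 / 2) \<cdot>\<^sub>v ((A + B) *\<^sub>v v)"
    proof (rule eq_vecI)
      fix i assume "i < dim_vec ((1 / 2) \<cdot>\<^sub>v ((A + B) *\<^sub>v v))"
      then have i: "i < p" using AB(2) by simp
      then have "Matrix.row (A + B) i \<in> carrier_vec p" using AB by auto
      moreover have "dim_row A = p" "dim_col A = p" "dim_row B = p" "dim_col B = p"
        using AB by (auto simp del: AB)
      ultimately show "(((1 / 2) \<cdot>\<^sub>m (A + B)) *\<^sub>v v) $ i = ((1 / 2) \<cdot>\<^sub>v ((A + B) *\<^sub>v v)) $ i"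
        using i v smult_scalar_prod_distrib[of "Matrix.row (A + B) i" p v "1 / 2"] by simp
    qed auto
    also have "(A + B) *\<^sub>v v = A *\<^sub>v v + B *\<^sub>v v"
      by (rule add_mult_distrib_mat_vec[OF AB v])
    finally show ?thesis using v by simp
  qed
  have Qlin: "lin p (($) (Q *\<^sub>v v)) \<phi> =
      lin p (($) v) \<phi> - (lin p (($) v) (adj p a \<phi>) + lin p (($) v) (adj p b \<phi>)) / 2"
    if v: "v \<in> carrier_vec p" for v \<phi>
  proof -
    have "(Q *\<^sub>v v) $ i = v $ i - ((A *\<^sub>v v) $ i + (B *\<^sub>v v) $ i) / 2" if "i < p" for i
    proof -
      have "A *\<^sub>v v \<in> carrier_vec p" "B *\<^sub>v v \<in> carrier_vec p"
        using v AB mult_mat_vec_carrier by blast+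
      then have "dim_vec (A *\<^sub>v v) = p" "dim_vec (B *\<^sub>v v) = p" by (auto simp only: carrier_vecD)
      with that v show ?thesis by (simp add: Qv del: index_mult_mat_vec dim_mult_mat_vec)
    qed
    then have "lin p (($) (Q *\<^sub>v v)) \<phi> =
        (\<Sum>i<p. \<phi> i * (v $ i - ((A *\<^sub>v v) $ i + (B *\<^sub>v v) $ i) / 2))"
      unfolding lin_def by (intro sum.cong refl) simp
    also have "\<dots> = lin p (($) v) \<phi> - (lin p (($) (A *\<^sub>v v)) \<phi> + lin p (($) (B *\<^sub>v v)) \<phi>) / 2"
      by (simp add: lin_def sum_subtractf sum.distrib algebra_simps sum_divide_distrib
          add_divide_distrib del: index_mult_mat_vec)
    finally show ?thesis using v p by (simp add: A_def B_def lin_companion_mult_vec)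
  qed
  have "v = 0\<^sub>v p" if v: "v \<in> carrier_vec p" and "Q *\<^sub>v v = 0\<^sub>v p" for v
  proof -
    have "lin p (($) (Q *\<^sub>v v)) \<phi> = 0" for \<phi> using that by (simp add: lin_def)
    then have "lin p (($) v) \<phi> = (lin p (($) v) (adj p a \<phi>) + lin p (($) v) (adj p b \<phi>)) / 2" for \<phi>
      using Qlin[OF v, of \<phi>] by simp
    then have "v $ i = 0" if "i < p" for i using that by (rule lin_fixed_point_unique)
    then show ?thesis using v by auto
  qed
  then have "det Q \<noteq> 0" using det_0_iff_vec_prod_zero[OF Q] by blast
  then have "Q \<in> Units (ring_mat TYPE(real) p ())" by (rule det_non_zero_imp_unit[OF Q])
  then obtain R where R: "mat_inverse Q = Some R"
    using mat_inverse(1)[OF Q, of "()"] by (cases "mat_inverse Q") blast+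
  have QR: "Q * R = 1\<^sub>m p" and Rc [simp]: "R \<in> carrier_mat p p" using mat_inverse(2)[OF Q R] by auto
  have lam: "lam p a b = abar \<cdot>\<^sub>v (R *\<^sub>v unit_vec p 0)"
    using R by (simp add: lam_def abar_def Q_def A_def B_def)
  show l: "lam p a b \<in> carrier_vec p" unfolding lam
    using mult_mat_vec_carrier[OF Rc unit_vec_carrier[of p 0]] by simp
  have "Q *\<^sub>v lam p a b = abar \<cdot>\<^sub>v (Q *\<^sub>v (R *\<^sub>v unit_vec p 0))"
    unfolding lam by (intro mult_mat_vec[OF Q] mult_mat_vec_carrier[OF Rc]) auto
  also have "Q *\<^sub>v (R *\<^sub>v unit_vec p 0) = unit_vec p 0"
    using assoc_mult_mat_vec[OF Q Rc unit_vec_carrier[of p 0]] QR by simp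
  finally have "lin p (($) (Q *\<^sub>v lam p a b)) \<phi> = lin p (\<lambda>i. abar * delta 0 i) \<phi>"
    by (intro lin_cong) (auto simp: delta_def unit_vec_def)
  also have "\<dots> = abar * \<phi> 0"
    using p by (simp add: lin_def delta_def if_distrib[of "\<lambda>x. _ * x"] cong: if_cong)
  finally show "lamf \<phi> = (lamf (adj p a \<phi>) + lamf (adj p b \<phi>)) / 2 + abar * \<phi> 0"
    using Qlin[OF l, of \<phi>] by (simp add: lamf_def)
qed

text \<open>The bilinear form of \<open>T_mat\<close>: \<phi> . e_1 is \<open>\<phi> 0\<close>, and
  \<phi> . (A lambda) is \<open>lamf (adj p a \<phi>)\<close>.\<close>

definition "Tf s \<phi> \<psi> = (s + ((a 0)\<^sup>2 + (b 0)\<^sup>2) / 2) * (\<phi> 0 * \<psi> 0) +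
  (a 0 * (lamf (adj p a \<phi>) * \<psi> 0 + \<phi> 0 * lamf (adj p a \<psi>)) +
   b 0 * (lamf (adj p b \<phi>) * \<psi> 0 + \<phi> 0 * lamf (adj p b \<psi>))) / 2"

lemma T_mat_carrier: "T_mat p a b s \<in> carrier_mat p p"
  using lam_carrier companion_carrier[of p a] companion_carrier[of p b]
  by (auto simp: T_mat_def Let_def outer_def intro!: add_carrier_mat)

lemma bil_rank1: "bil p (\<lambda>i j. f i * g j) \<phi> \<psi> = lin p f \<phi> * lin p g \<psi>"
  by (simp add: bil_def lin_def sum_product mult_ac)

lemma lin_cmult: "lin p (\<lambda>i. t * f i) \<phi> = t * lin p f \<phi>"
  by (simp add: lin_def sum_distrib_left mult_ac)

lemma lin_delta0: "lin p (\<lambda>j. delta j 0) \<phi> = \<phi> 0"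
  using p by (simp add: lin_def delta_def if_distrib[of "\<lambda>x. _ * x"] cong: if_cong)

lemma T_mat_index:
  assumes "i < p" "j < p" shows "T_mat p a b s $$ (i, j) = Tf s (delta i) (delta j)"
proof -
  have *: "(companion p x * outer (lam p a b) (unit_vec p 0)) $$ (i, j) =
      lamf (adj p x (delta i)) * delta j 0"
    "(outer (unit_vec p 0) (lam p a b) * transpose_mat (companion p x)) $$ (i, j) =
      delta i 0 * lamf (adj p x (delta j))" for x
    using assms lam_carrier companion_carrier[of p x]
    by (simp_all add: scalar_prod_def outer_def companion_adj lamf_def lin_def delta_def atLeast0LessThan
        sum_distrib_left sum_distrib_right mult.commute)
  have entry: "(t \<cdot>\<^sub>m E + (1 / 2) \<cdot>\<^sub>m (u \<cdot>\<^sub>m (P + Q) + v \<cdot>\<^sub>m (P' + Q'))) $$ (i, j) =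
      t * E $$ (i, j) + (u * (P $$ (i, j) + Q $$ (i, j)) + v * (P' $$ (i, j) + Q' $$ (i, j))) / 2"
    if "E \<in> carrier_mat p p" "P \<in> carrier_mat p p" "Q \<in> carrier_mat p p"
      "P' \<in> carrier_mat p p" "Q' \<in> carrier_mat p p" for t u v and E P Q P' Q' :: "real Matrix.mat"
    using assms that by simp
  have outer: "outer (unit_vec p 0) (unit_vec p 0) $$ (i, j) = delta i 0 * delta j 0"
    using assms by (simp add: outer_def delta_def)
  have carrier: "outer u v \<in> carrier_mat p p" if "u \<in> carrier_vec p" "v \<in> carrier_vec p" for u v
    using that by (simp add: outer_def)
  have P: "companion p x * outer (lam p a b) (unit_vec p 0) \<in> carrier_mat p p"
    and Q: "outer (unit_vec p 0) (lam p a b) * transpose_mat (companion p x) \<in> carrier_mat p p" for x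
    using companion_carrier[of p x] carrier lam_carrier
    by (auto intro!: mult_carrier_mat[where n = p])
  show ?thesis
    unfolding T_mat_def Let_def
    by (subst entry[OF carrier[OF unit_vec_carrier unit_vec_carrier] P Q P Q])
      (simp add: * outer Tf_def algebra_simps)
qed

text \<open>\<open>T_mat\<close> is a combination of rank one matrices, and the form of each factors
  into two linear forms.\<close>

lemma bil_T: "bil p (\<lambda>i j. Tf s (delta i) (delta j)) \<phi> \<psi> = Tf s \<phi> \<psi>"
proof -
  let ?L = "\<lambda>x i. lamf (adj p x (delta i))" and ?d = "\<lambda>i. delta i 0"
  have L: "lin p (?L x) \<phi> = lamf (adj p x \<phi>)" for x \<phi>
    unfolding lamf_def by (subst lin_def) (rule lin_adj[OF p])
  have "bil p (\<lambda>i j. Tf s (delta i) (delta j)) \<phi> \<psi> =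
    bil p (\<lambda>i j. ((s + ((a 0)\<^sup>2 + (b 0)\<^sup>2) / 2) * ?d i) * ?d j +
      (((a 0 * ?L a i) * ?d j + (a 0 * ?d i) * ?L a j) +
       ((b 0 * ?L b i) * ?d j + (b 0 * ?d i) * ?L b j)) / 2) \<phi> \<psi>"
    by (intro bil_cong refl) (simp add: Tf_def algebra_simps)
  also have "\<dots> = Tf s \<phi> \<psi>"
    unfolding bil_add bil_divide bil_rank1 
    unfolding lin_cmult L lin_delta0 Tf_def by (simp add: algebra_simps)
  finally show ?thesis .
qed

definition "ellf s \<phi> \<psi> = bil p (\<lambda>i j. ell p a b s $$ (i, j)) \<phi> \<psi>"

lemma ellf_scale: "ellf s (\<lambda>i. t * \<phi> i) (\<lambda>i. t' * \<psi> i) = t * t' * ellf s \<phi> \<psi>"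
  by (simp add: ellf_def bil_scale)

text \<open>\<open>ell\<close> is a definite description, so existence and uniqueness of the
  solution come first. Both are transferred from forms to matrices by testing with basis vectors;
  afterwards the matrix equation is used only as an identity of forms.\<close>

lemma ell_carrier_eq:
  shows ell_carrier: "ell p a b s \<in> carrier_mat p p"
    and ellf_eq: "ellf s \<phi> \<psi> = Tf s \<phi> \<psi> +
      (ellf s (adj p a \<phi>) (adj p a \<psi>) + ellf s (adj p b \<phi>) (adj p b \<psi>)) / 2"
proof -
  let ?F = "\<lambda>l. T_mat p a b s + (1 / 2) \<cdot>\<^sub>m
              (companion p a * l * transpose_mat (companion p a) +
               companion p b * l * transpose_mat (companion p b))"
  let ?P = "\<lambda>l. l \<in> carrier_mat p p \<and> l = ?F l"
  let ?f = "\<lambda>l i j. l $$ (i, j)"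
  have Fc: "?F l \<in> carrier_mat p p" for l
    using T_mat_carrier companion_carrier[of p a] companion_carrier[of p b] by auto
  have F: "?F l $$ (i, j) = Tf s (delta i) (delta j) +
      (bil p (?f l) (adj p a (delta i)) (adj p a (delta j)) +
       bil p (?f l) (adj p b (delta i)) (adj p b (delta j))) / 2"
    if "l \<in> carrier_mat p p" "i < p" "j < p" for l i j
    using that companion_sandwich[OF that] T_mat_index[OF that(2,3)] T_mat_carrier
      companion_carrier[of p a] companion_carrier[of p b]
    by (simp del: index_mult_mat(1) assoc_mult_mat)
  have P_bil: "bil p (?f l) \<phi> \<psi> = Tf s \<phi> \<psi> +
      (bil p (?f l) (adj p a \<phi>) (adj p a \<psi>) + bil p (?f l) (adj p b \<phi>) (adj p b \<psi>)) / 2"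
    if l: "?P l" for l \<phi> \<psi>
  proof -
    have "bil p (?f l) \<phi> \<psi> = bil p (\<lambda>i j. Tf s (delta i) (delta j) +
      (bil p (?f l) (adj p a (delta i)) (adj p a (delta j)) +
       bil p (?f l) (adj p b (delta i)) (adj p b (delta j))) / 2) \<phi> \<psi>"
      by (intro bil_cong refl
          trans[OF arg_cong[OF conjunct2[OF l], of "\<lambda>m. m $$ (_, _)"] F[OF conjunct1[OF l]]])
    then show ?thesis unfolding bil_add bil_divide bil_adj[OF p] bil_T .
  qed
  have uniq: "l = l'" if l: "?P l" and l': "?P l'" for l l'
  proof (rule eq_matI)
    fix i j assume "i < dim_row l'" "j < dim_col l'"
    then have "i < p" "j < p" using l' by auto
    moreover have "bil p (\<lambda>i j. l $$ (i, j) - l' $$ (i, j)) \<phi> \<psi> =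
      (bil p (\<lambda>i j. l $$ (i, j) - l' $$ (i, j)) (adj p a \<phi>) (adj p a \<psi>) +
       bil p (\<lambda>i j. l $$ (i, j) - l' $$ (i, j)) (adj p b \<phi>) (adj p b \<psi>)) / 2" for \<phi> \<psi>
      unfolding bil_diff using P_bil[OF l, of \<phi> \<psi>] P_bil[OF l', of \<phi> \<psi>]
      by (simp add: field_simps)
    ultimately have "l $$ (i, j) - l' $$ (i, j) = 0"
      by (intro fixed_point_unique[of "\<lambda>i j. l $$ (i, j) - l' $$ (i, j)"])
    then show "l $$ (i, j) = l' $$ (i, j)" by simp
  qed (use l l' in auto)
  obtain m where m: "\<And>\<phi> \<psi>. bil p m \<phi> \<psi> = bil p (\<lambda>i j. Tf s (delta i) (delta j)) \<phi> \<psi> +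
      (bil p m (adj p a \<phi>) (adj p a \<psi>) + bil p m (adj p b \<phi>) (adj p b \<psi>)) / 2"
    using fixed_point_exists by blast
  define l where "l = Matrix.mat p p (\<lambda>(i, j). m i j)"
  have lm: "bil p (?f l) \<phi> \<psi> = bil p m \<phi> \<psi>" for \<phi> \<psi>
    by (intro bil_cong) (auto simp: l_def)
  have l: "l \<in> carrier_mat p p" by (simp add: l_def)
  have "l = ?F l"
  proof (rule eq_matI)
    show "dim_row l = dim_row (?F l)" "dim_col l = dim_col (?F l)" using l Fc[of l] by auto
    fix i j assume "i < dim_row (?F l)" "j < dim_col (?F l)"
    then have ij: "i < p" "j < p" using Fc[of l] by auto
    have "l $$ (i, j) = bil p m (delta i) (delta j)" using ij by (simp add: l_def bil_delta)
    also have "\<dots> = ?F l $$ (i, j)" unfolding F[OF l ij] lm by (subst m) (simp add: bil_T)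
    finally show "l $$ (i, j) = ?F l $$ (i, j)" .
  qed
  with l have "?P l" by simp
  then have "?P (THE l. ?P l)" by (rule theI) (rule uniq[OF _ \<open>?P l\<close>])
  then have P: "?P (ell p a b s)" unfolding ell_def .
  then show "ell p a b s \<in> carrier_mat p p" by blast
  show "ellf s \<phi> \<psi> = Tf s \<phi> \<psi> +
      (ellf s (adj p a \<phi>) (adj p a \<psi>) + ellf s (adj p b \<phi>) (adj p b \<psi>)) / 2"
    using P_bil[OF P] unfolding ellf_def .
qed

lemma Tf_commute: "Tf s \<phi> \<psi> = Tf s \<psi> \<phi>"
  by (simp add: Tf_def algebra_simps)

text \<open>Since \<open>Tf\<close> is symmetric, the difference of ell and its transpose solves the
  homogeneous equation and vanishes.\<close>

lemma ell_symmetric: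
  assumes "i < p" "j < p" shows "ell p a b s $$ (i, j) = ell p a b s $$ (j, i)"
proof -
  let ?l = "\<lambda>i j. ell p a b s $$ (i, j)"
  have "?l i j - ?l j i = 0"
  proof (rule fixed_point_unique[of "\<lambda>i j. ?l i j - ?l j i", OF _ assms])
    fix \<phi> \<psi>
    have *: "bil p (\<lambda>i j. ?l i j - ?l j i) \<phi> \<psi> = ellf s \<phi> \<psi> - ellf s \<psi> \<phi>" for \<phi> \<psi>
      unfolding bil_diff ellf_def bil_swap[of p "\<lambda>i j. ?l j i"] ..
    show "bil p (\<lambda>i j. ?l i j - ?l j i) \<phi> \<psi> =
      (bil p (\<lambda>i j. ?l i j - ?l j i) (adj p a \<phi>) (adj p a \<psi>) +
       bil p (\<lambda>i j. ?l i j - ?l j i) (adj p b \<phi>) (adj p b \<psi>)) / 2"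
      unfolding * using ellf_eq[of s \<phi> \<psi>] ellf_eq[of s \<psi> \<phi>] Tf_commute[of s \<phi> \<psi>]
      by (simp add: field_simps)
  qed
  then show ?thesis by simp
qed

lemma L_mat_carrier: "L_mat p a b s \<in> carrier_mat (Suc p) (Suc p)"
  unfolding L_mat_def using four_block_carrier_mat[OF one_carrier_mat[of 1] ell_carrier[of s]] by simp

lemma L_mat_index:
  assumes "i < p" "j < p"
  shows "L_mat p a b s $$ (0, 0) = 1" "L_mat p a b s $$ (0, Suc j) = lam p a b $ j"
    "L_mat p a b s $$ (Suc i, 0) = lam p a b $ i" "L_mat p a b s $$ (Suc i, Suc j) = ell p a b s $$ (i, j)"
  using ell_carrier[of s] lam_carrier assms by (auto simp: L_mat_def mat_of_rows_def mat_of_cols_def)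

section \<open>Positive definiteness of the limit\<close>

text \<open>Completing the square in the first coordinate of v leaves the form \<open>q\<close> of
  the Schur complement ell - lambda lambda^t, to which \<open>quadratic_form_positive\<close>
  applies.\<close>

lemma positive_definite_L_mat:
  assumes s: "s > 0" shows "positive_definite (L_mat p a b s)"
proof -
  let ?L = "L_mat p a b s"
  have Lc: "?L \<in> carrier_mat (Suc p) (Suc p)" by (rule L_mat_carrier)
  have sym: "?L $$ (i, j) = ?L $$ (j, i)" if "i < Suc p" "j < Suc p" for i j
    using that L_mat_index[of "i - 1" "j - 1" s] L_mat_index[of "j - 1" "i - 1" s]
      ell_symmetric[of "i - 1" "j - 1" s] p
    by (cases i; cases j) (auto intro: L_mat_index L_mat_index[symmetric])
  define q where "q \<phi> = ellf s \<phi> \<phi> - (lamf \<phi>)\<^sup>2" for \<phi>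
  have q_rec: "q \<phi> \<ge> s * (\<phi> 0)\<^sup>2 + (q (adj p a \<phi>) + q (adj p b \<phi>)) / 2" for \<phi>
  proof -
    define x y z where "x = lamf (adj p a \<phi>)" and "y = lamf (adj p b \<phi>)" and "z = \<phi> 0"
    \<comment> \<open>The defect is the variance of the two-point distribution giving weight 1 / 2
      to x + a_0 z and to y + b_0 z, the limiting means of even and odd children tested with
      \<phi>.\<close>
    have "q \<phi> - (s * z\<^sup>2 + (q (adj p a \<phi>) + q (adj p b \<phi>)) / 2) = ((x + a 0 * z - y - b 0 * z) / 2)\<^sup>2"
      unfolding q_def ellf_eq[of s \<phi> \<phi>] Tf_def lamf_eq[of \<phi>] abar_def
        x_def[symmetric] y_def[symmetric] z_def[symmetric]
      by (simp add: field_simps power2_eq_square)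
    then show ?thesis unfolding z_def by (smt (verit) zero_le_power2)
  qed
  have q_scale: "q (\<lambda>i. t * \<phi> i) = t\<^sup>2 * q \<phi>" for t \<phi>
    by (simp add: q_def ellf_scale lamf_scale power2_eq_square algebra_simps)
  define K where "K = C * C * (\<Sum>i<p. \<Sum>j<p. \<bar>ell p a b s $$ (i, j)\<bar>) + (C * (\<Sum>i<p. \<bar>lam p a b $ i\<bar>))\<^sup>2"
  have q_bound: "\<bar>q \<phi>\<bar> \<le> K" if "\<phi> \<in> D" for \<phi>
  proof -
    have "\<bar>lamf \<phi>\<bar>\<^sup>2 \<le> (C * (\<Sum>i<p. \<bar>lam p a b $ i\<bar>))\<^sup>2"
      unfolding lamf_def using that D_bound by (intro power_mono lin_bound) auto
    then show ?thesis
      using bil_bound[OF that that, of "\<lambda>i j. ell p a b s $$ (i, j)"]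
        zero_le_power2[of "lamf \<phi>"]
      unfolding q_def K_def ellf_def power2_abs by linarith
  qed
  note q = quadratic_form_positive[of s q, OF s q_rec q_scale q_bound]
  show ?thesis
    unfolding positive_definite_def
  proof (intro conjI ballI impI)
    show "?L \<in> carrier_mat (dim_row ?L) (dim_row ?L)" using Lc by auto
    show "transpose_mat ?L = ?L" using Lc sym by (intro eq_matI) auto
    fix v :: "real Matrix.vec" assume v: "v \<in> carrier_vec (dim_row ?L)" "v \<noteq> 0\<^sub>v (dim_row ?L)"
    define \<phi> where "\<phi> i = v $ Suc i" for i
    have v_c: "v \<in> carrier_vec (Suc p)" using v Lc by auto
    have "v \<bullet> (?L *\<^sub>v v) = (\<Sum>i<Suc p. v $ i * (\<Sum>j<Suc p. ?L $$ (i, j) * v $ j))"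
      using v_c Lc by (simp add: scalar_prod_def atLeast0LessThan del: sum.lessThan_Suc)
    also have "\<dots> = v $ 0 * (v $ 0 + lamf \<phi>) + (\<Sum>i<p. \<phi> i * (lam p a b $ i * v $ 0 +
        (\<Sum>j<p. ell p a b s $$ (i, j) * \<phi> j)))"
      unfolding sum.lessThan_Suc_shift
      using p L_mat_index(1)[of 0 0 s] by (simp add: L_mat_index(2-) lamf_def lin_def \<phi>_def mult.commute)
    also have "\<dots> = (v $ 0 + lamf \<phi>)\<^sup>2 + q \<phi>"
      by (simp add: q_def ellf_def bil_def lamf_def lin_def algebra_simps sum.distrib
          sum_distrib_left sum_distrib_right power2_eq_square)
    finally have eq: "v \<bullet> (?L *\<^sub>v v) = (v $ 0 + lamf \<phi>)\<^sup>2 + q \<phi>" .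
    show "v \<bullet> (?L *\<^sub>v v) > 0"
    proof (rule ccontr)
      assume "\<not> ?thesis"
      then have "(v $ 0 + lamf \<phi>)\<^sup>2 = 0" and q0: "q \<phi> = 0"
        using eq q(1)[of \<phi>] by (smt (verit) zero_le_power2)+
      moreover have "\<phi> i = 0" if "i < p" for i using q(2)[OF _ q0 that] by blast
      ultimately have "v $ 0 = 0" "\<And>i. i < p \<Longrightarrow> v $ Suc i = 0"
        by (auto simp: \<phi>_def lamf_def lin_def)
      then have "v $ i = 0" if "i < Suc p" for i using that by (cases i) auto
      then have "v = 0\<^sub>v (dim_row ?L)" using v_c Lc by auto
      with v show False by blast
    qed
  qed
qed

end

section \<open>Conditional independence and orthogonality\<close>

text \<open>The hypothesis on indicators says that the conditional expectation of \<open>W\<close>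
  given the sigma-algebra generated by \<open>U\<close> is 0; then \<open>U\<close> is pulled out.
  This is the passage from indicators to the variable itself.\<close>

lemma integral_mult_eq_0I:
  fixes U W :: "'a \<Rightarrow> real"
  assumes "finite_measure M" and [measurable]: "U \<in> borel_measurable M" and W: "integrable M W"
    and UW: "integrable M (\<lambda>x. U x * W x)"
    and ind: "\<And>E. E \<in> sets borel \<Longrightarrow> (\<integral>x. indicator E (U x) * W x \<partial>M) = 0"
  shows "(\<integral>x. U x * W x \<partial>M) = 0"
proof -
  define G where "G = vimage_algebra (space M) U borel"
  have "subalgebra M G"
    using measurable_sets[OF assms(2)] by (auto simp: subalgebra_def G_def sets_vimage_algebra2)
  then interpret finite_measure_subalgebra M G
    using assms(1) by (simp add: finite_measure_subalgebra_def finite_measure_subalgebra_axioms_def)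
  have U: "U \<in> borel_measurable G" unfolding G_def by (rule measurable_vimage_algebra1) auto
  have "AE x in M. real_cond_exp M G W x = 0"
  proof (rule real_cond_exp_charact)
    fix A assume "A \<in> sets G"
    then obtain E where E: "E \<in> sets borel" "A = U -` E \<inter> space M"
      by (auto simp: G_def sets_vimage_algebra2)
    have "(\<integral>x\<in>A. W x \<partial>M) = (\<integral>x. indicator E (U x) * W x \<partial>M)"
      unfolding set_lebesgue_integral_def E(2)
      by (intro Bochner_Integration.integral_cong) (auto simp: indicator_def)
    then show "(\<integral>x\<in>A. W x \<partial>M) = (\<integral>x\<in>A. 0 \<partial>M)" using ind[OF E(1)] by simp
  qed (use W in auto)
  then have "AE x in M. U x * real_cond_exp M G W x = 0" by eventually_elim simp
  then have "(\<integral>x. U x * real_cond_exp M G W x \<partial>M) = (\<integral>x. 0 \<partial>M)"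
    by (intro integral_cong_AE) (use W in measurable)
  then show ?thesis using real_cond_exp_intg(2)[OF UW U] W by simp
qed

lemma cond_indep_var_compose:
  assumes "cond_indep_var M F U V" "f \<in> borel_measurable borel" "g \<in> borel_measurable borel"
  shows "cond_indep_var M F (\<lambda>w. f (U w)) (\<lambda>w. g (V w))"
  unfolding cond_indep_var_def
proof (intro ballI)
  fix E E' :: "real set" assume "E \<in> sets borel" "E' \<in> sets borel"
  then have "f -` E \<in> sets borel" "g -` E' \<in> sets borel"
    using measurable_sets[OF assms(2)] measurable_sets[OF assms(3)] by auto
  then have "AE w in M. real_cond_exp M F (\<lambda>w. indicator (f -` E) (U w) * indicator (g -` E') (V w)) w =
        real_cond_exp M F (\<lambda>w. indicator (f -` E) (U w)) w * real_cond_exp M F (\<lambda>w. indicator (g -` E') (V w)) w"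
    using assms(1) unfolding cond_indep_var_def by blast
  then show "AE w in M. real_cond_exp M F (\<lambda>w. indicator E (f (U w)) * indicator E' (g (V w))) w =
        real_cond_exp M F (\<lambda>w. indicator E (f (U w))) w * real_cond_exp M F (\<lambda>w. indicator E' (g (V w))) w"
    by (simp add: indicator_def vimage_def)
qed

lemma integrable_mult_of_squares:
  fixes f g :: "'a \<Rightarrow> real"
  assumes [measurable]: "f \<in> borel_measurable M" "g \<in> borel_measurable M"
    and "integrable M (\<lambda>x. (f x)\<^sup>2)" "integrable M (\<lambda>x. (g x)\<^sup>2)"
  shows "integrable M (\<lambda>x. f x * g x)"
proof (rule Bochner_Integration.integrable_bound)
  show "integrable M (\<lambda>x. (f x)\<^sup>2 + (g x)\<^sup>2)" using assms by simp
  have "\<bar>f x * g x\<bar> \<le> (f x)\<^sup>2 + (g x)\<^sup>2" for x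
  proof -
    have "2 * \<bar>f x * g x\<bar> \<le> (f x)\<^sup>2 + (g x)\<^sup>2"
      using sum_squares_bound[of "\<bar>f x\<bar>" "\<bar>g x\<bar>"] by (simp add: abs_mult mult.assoc)
    then show ?thesis by simp
  qed
  then show "AE x in M. norm (f x * g x) \<le> norm ((f x)\<^sup>2 + (g x)\<^sup>2)"
    by (intro AE_I2) (simp add: abs_le_iff)
qed measurable

context finite_measure_subalgebra
begin

lemma integrable_of_square:
  fixes f :: "'a \<Rightarrow> real"
  assumes "f \<in> borel_measurable M" "integrable M (\<lambda>x. (f x)\<^sup>2)" shows "integrable M f"
  using integrable_mult_of_squares[of f M "\<lambda>_. 1"] assms by simp

lemma indicator_mult_cond_exp:
  assumes [measurable]: "A \<in> sets F" and f: "integrable M f"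
  shows "(\<integral>x. indicator A x * real_cond_exp M F f x \<partial>M) = (\<integral>x. indicator A x * f x \<partial>M)"
  using real_cond_exp_intA[OF f assms(1)] by (simp add: set_lebesgue_integral_def)

lemma sets_subalgebraD: "A \<in> sets F \<Longrightarrow> A \<in> sets M"
  using subalg by (auto simp: subalgebra_def)

text \<open>Conditional independence is available only for indicators of \<open>U\<close> and
  \<open>V\<close>. The passage to the product U V has two stages, each through
  \<open>integral_mult_eq_0I\<close>: first the indicator of \<open>U\<close> is replaced by
  \<open>U\<close>, then that of \<open>V\<close> by \<open>V\<close>.\<close>

lemma cond_indep_var_orthogonal:
  assumes ind: "cond_indep_var M F U V"
    and [measurable]: "U \<in> borel_measurable M" "V \<in> borel_measurable M"
    and U2: "integrable M (\<lambda>x. (U x)\<^sup>2)" and V2: "integrable M (\<lambda>x. (V x)\<^sup>2)"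
    and U0: "AE x in M. real_cond_exp M F U x = 0"
  shows "AE x in M. real_cond_exp M F (\<lambda>x. U x * V x) x = 0"
proof -
  note [simp] = integrable_mult_of_squares integrable_of_square
  have U1: "integrable M U" and UV: "integrable M (\<lambda>x. U x * V x)" using U2 V2 by auto
  have step: "(\<integral>x. U x * (indicator A x * indicator E (V x)) \<partial>M) = 0"
    if A: "A \<in> sets F" and [measurable]: "E \<in> sets borel" for A E
  proof -
    have [measurable]: "A \<in> sets M" using A by (rule sets_subalgebraD)
    define q where "q = real_cond_exp M F (\<lambda>x. indicator E (V x))"
    have qF: "q \<in> borel_measurable F" by (simp add: q_def)
    have [measurable]: "q \<in> borel_measurable M" by (simp add: q_def)
    have iE: "integrable M (\<lambda>x. indicator E (V x) :: real)"
      by (rule integrable_const_bound[where B = 1]) auto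
    have q1: "AE x in M. \<bar>q x\<bar> \<le> 1"
    proof -
      have "AE x in M. q x \<ge> 0" "AE x in M. q x \<le> 1"
        unfolding q_def using iE by (auto intro!: real_cond_exp_ge_c real_cond_exp_le_c simp: indicator_def)
      then show ?thesis by eventually_elim simp
    qed
    \<comment> \<open>The part of the indicator of V that is left after subtracting its conditional
      expectation, restricted to \<open>A\<close>. Conditional independence makes it orthogonal to
      all indicators of \<open>U\<close>, hence to \<open>U\<close>.\<close>
    define W where "W x = indicator A x * (indicator E (V x) - q x)" for x
    have [measurable]: "W \<in> borel_measurable M" by (simp add: W_def[abs_def])
    have W2: "AE x in M. \<bar>W x\<bar> \<le> 2"
      using q1 by eventually_elim (auto simp: W_def indicator_def abs_if split: if_splits)
    have W: "integrable M W"
      using W2 by (intro integrable_const_bound[where B = 2]) auto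
    have UW: "integrable M (\<lambda>x. U x * W x)"
    proof (rule Bochner_Integration.integrable_bound[where f = "\<lambda>x. 2 * U x"])
      show "AE x in M. norm (U x * W x) \<le> norm (2 * U x)"
        using W2 by eventually_elim (simp add: abs_mult mult.commute[of 2] mult_left_mono)
    qed (use U1 in auto)
    have UAq: "integrable M (\<lambda>x. (indicator A x * q x) * U x)"
    proof (rule Bochner_Integration.integrable_bound[where f = U])
      show "AE x in M. norm ((indicator A x * q x) * U x) \<le> norm (U x)"
        using q1 by eventually_elim (auto simp: abs_mult indicator_def intro!: mult_left_le_one_le)
    qed (use U1 in auto)
    have UAE: "integrable M (\<lambda>x. U x * (indicator A x * indicator E (V x)))"
      by (rule Bochner_Integration.integrable_bound[where f = U])
        (use U1 in \<open>auto simp: abs_mult indicator_def\<close>)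
    have "(\<integral>x. U x * W x \<partial>M) = 0"
    proof (rule integral_mult_eq_0I[OF finite_measure_axioms _ W UW])
      fix E' :: "real set" assume [measurable]: "E' \<in> sets borel"
      have iE': "integrable M (\<lambda>x. indicator E' (U x) :: real)"
        and iEE': "integrable M (\<lambda>x. indicator E' (U x) * indicator E (V x) :: real)"
        by (rule integrable_const_bound[where B = 1]; auto simp: indicator_def)+
      have iAqE: "integrable M (\<lambda>x. (indicator A x * q x) * indicator E' (U x))"
        by (rule integrable_const_bound[where B = 1]) 
          (use q1 in \<open>auto elim!: eventually_mono simp: indicator_def\<close>)
      have iAE: "integrable M (\<lambda>x. indicator A x * (indicator E' (U x) * indicator E (V x)) :: real)"
        by (rule integrable_const_bound[where B = 1]) (auto simp: indicator_def)
      have "(\<integral>x. indicator A x * (indicator E' (U x) * indicator E (V x)) \<partial>M) =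
        (\<integral>x. indicator A x * real_cond_exp M F (\<lambda>x. indicator E' (U x) * indicator E (V x)) x \<partial>M)"
        by (rule indicator_mult_cond_exp[OF A iEE', symmetric])
      also have "\<dots> = (\<integral>x. (indicator A x * q x) * real_cond_exp M F (\<lambda>x. indicator E' (U x)) x \<partial>M)"
      proof (rule integral_cong_AE)
        have "AE x in M. real_cond_exp M F (\<lambda>x. indicator E' (U x) * indicator E (V x)) x =
           real_cond_exp M F (\<lambda>x. indicator E' (U x)) x * q x"
          using ind unfolding cond_indep_var_def q_def by simp
        then show "AE x in M. indicator A x * real_cond_exp M F (\<lambda>x. indicator E' (U x) * indicator E (V x)) x =
            (indicator A x * q x) * real_cond_exp M F (\<lambda>x. indicator E' (U x)) x"
          by eventually_elim simp
      qed measurable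
      also have "\<dots> = (\<integral>x. (indicator A x * q x) * indicator E' (U x) \<partial>M)"
        using A qF by (intro real_cond_exp_intg(2)[OF iAqE]) auto
      finally have "(\<integral>x. indicator A x * (indicator E' (U x) * indicator E (V x)) -
          (indicator A x * q x) * indicator E' (U x) \<partial>M) = 0"
        by (subst Bochner_Integration.integral_diff[OF iAE iAqE]) simp
      then show "(\<integral>x. indicator E' (U x) * W x \<partial>M) = 0"
        by (simp add: W_def algebra_simps)
    qed measurable
    moreover have "(\<integral>x. U x * W x \<partial>M) =
        (\<integral>x. U x * (indicator A x * indicator E (V x)) - (indicator A x * q x) * U x \<partial>M)"
      by (intro Bochner_Integration.integral_cong) (auto simp: W_def algebra_simps)
    \<comment> \<open>The subtracted part contributes nothing: its weight is F-measurable and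
      \<open>U\<close> is conditionally centred.\<close>
    moreover have "(\<integral>x. (indicator A x * q x) * U x \<partial>M) =
        (\<integral>x. (indicator A x * q x) * real_cond_exp M F U x \<partial>M)"
      using A qF by (intro real_cond_exp_intg(2)[OF UAq, symmetric]) auto
    moreover have "(\<integral>x. (indicator A x * q x) * real_cond_exp M F U x \<partial>M) = (\<integral>x. 0 \<partial>M)"
      by (rule integral_cong_AE) (use U0 in auto)
    ultimately show ?thesis using Bochner_Integration.integral_diff[OF UAE UAq] by simp
  qed
  show ?thesis
  proof (rule real_cond_exp_charact[OF _ UV])
    fix A assume A: "A \<in> sets F"
    have [measurable]: "A \<in> sets M" using A by (rule sets_subalgebraD)
    \<comment> \<open>Second stage: \<open>step\<close> provides the orthogonality of the restricted
      \<open>U\<close> to all indicators of \<open>V\<close>.\<close>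
    have "(\<integral>x. V x * (indicator A x * U x) \<partial>M) = 0"
    proof (rule integral_mult_eq_0I[OF finite_measure_axioms])
      show "integrable M (\<lambda>x. indicator A x * U x)"
        using integrable_mult_indicator[OF \<open>A \<in> sets M\<close> U1] by simp
      show "integrable M (\<lambda>x. V x * (indicator A x * U x))"
        using integrable_mult_indicator[OF \<open>A \<in> sets M\<close> UV] by (simp add: mult_ac)
      show "(\<integral>x. indicator E (V x) * (indicator A x * U x) \<partial>M) = 0" if "E \<in> sets borel" for E
        using step[OF A that] by (simp add: mult_ac)
    qed measurable
    then show "(\<integral>x\<in>A. U x * V x \<partial>M) = (\<integral>x\<in>A. 0 \<partial>M)"
      by (simp add: set_lebesgue_integral_def mult_ac)
  qed auto
qed

text \<open>\<open>real_cond_exp\<close> is the difference of the nonnegative conditional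
  expectations of the positive and negative parts; here the second is 0 and the first is finite
  almost everywhere.\<close>

lemma nn_cond_exp_eq_real_cond_exp:
  assumes f: "integrable M f" and pos: "\<And>x. f x \<ge> 0"
  shows "AE x in M. nn_cond_exp M F (\<lambda>x. ennreal (f x)) x = ennreal (real_cond_exp M F f x)"
proof -
  have [measurable]: "f \<in> borel_measurable M" using f by auto
  have "AE x in M. (0::ennreal) = nn_cond_exp M F (\<lambda>x. ennreal (- f x)) x"
    using pos by (intro nn_cond_exp_charact) (auto simp: ennreal_neg)
  moreover have "(\<integral>\<^sup>+x. nn_cond_exp M F (\<lambda>x. ennreal (f x)) x \<partial>M) = (\<integral>\<^sup>+x. ennreal (f x) \<partial>M)"
    using nn_cond_exp_intg[of "\<lambda>_. 1" "\<lambda>x. ennreal (f x)"] by simp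
  then have "AE x in M. nn_cond_exp M F (\<lambda>x. ennreal (f x)) x \<noteq> \<infinity>"
    using f pos by (intro nn_integral_PInf_AE) (auto simp: nn_integral_eq_integral)
  ultimately show ?thesis
    by eventually_elim (simp add: real_cond_exp_def ennreal_enn2real_if flip: infinity_ennreal_def)
qed

text \<open>The weight \<open>h\<close> may be unbounded, so pulling it out of
  \<open>real_cond_exp\<close> would presuppose the integrability to be shown. The nonnegative
  conditional expectation allows this without integrability and gives the bound at the same
  time.\<close>

lemma weighted_square_integrable:
  assumes [measurable]: "h \<in> borel_measurable F" "V \<in> borel_measurable M"
    and V2: "integrable M (\<lambda>x. (V x)\<^sup>2)" and H: "integrable M H"
    and le: "AE x in M. (h x)\<^sup>2 * real_cond_exp M F (\<lambda>x. (V x)\<^sup>2) x \<le> H x"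
  shows "integrable M (\<lambda>x. (h x * V x)\<^sup>2)" "(\<integral>x. (h x * V x)\<^sup>2 \<partial>M) \<le> (\<integral>x. H x \<partial>M)"
proof -
  have [measurable]: "h \<in> borel_measurable M" by (rule measurable_from_subalg[OF subalg assms(1)])
  have Hpos: "AE x in M. 0 \<le> H x"
  proof -
    have "AE x in M. 0 \<le> real_cond_exp M F (\<lambda>x. (V x)\<^sup>2) x" by (intro real_cond_exp_pos) auto
    with le show ?thesis
      by eventually_elim (meson mult_nonneg_nonneg order_trans zero_le_power2)
  qed
  have "(\<integral>\<^sup>+x. ennreal ((h x * V x)\<^sup>2) \<partial>M) = (\<integral>\<^sup>+x. ennreal ((h x)\<^sup>2) * ennreal ((V x)\<^sup>2) \<partial>M)"
    by (simp add: power_mult_distrib ennreal_mult)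
  also have "\<dots> = (\<integral>\<^sup>+x. ennreal ((h x)\<^sup>2) * nn_cond_exp M F (\<lambda>x. ennreal ((V x)\<^sup>2)) x \<partial>M)"
    by (intro nn_cond_exp_intg[symmetric]) auto
  also have "\<dots> \<le> (\<integral>\<^sup>+x. ennreal (H x) \<partial>M)"
  proof (rule nn_integral_mono_AE)
    show "AE x in M. ennreal ((h x)\<^sup>2) * nn_cond_exp M F (\<lambda>x. ennreal ((V x)\<^sup>2)) x \<le> ennreal (H x)"
      using le nn_cond_exp_eq_real_cond_exp[OF V2 zero_le_power2]
      by eventually_elim (simp add: ennreal_mult'[symmetric] ennreal_leI)
  qed
  also have "\<dots> = ennreal (\<integral>x. H x \<partial>M)" using H Hpos by (rule nn_integral_eq_integral)
  finally have *: "(\<integral>\<^sup>+x. ennreal ((h x * V x)\<^sup>2) \<partial>M) \<le> ennreal (\<integral>x. H x \<partial>M)" .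
  show int: "integrable M (\<lambda>x. (h x * V x)\<^sup>2)"
    using * by (intro integrableI_bounded) (auto simp: le_less_trans[OF _ ennreal_less_top])
  have "ennreal (\<integral>x. (h x * V x)\<^sup>2 \<partial>M) \<le> ennreal (\<integral>x. H x \<partial>M)"
    using * nn_integral_eq_integral[OF int] by simp
  then show "(\<integral>x. (h x * V x)\<^sup>2 \<partial>M) \<le> (\<integral>x. H x \<partial>M)"
    using integral_nonneg_AE[OF Hpos] by (simp add: ennreal_le_iff)
qed

end

section \<open>Almost sure convergence from summable second moments\<close>

text \<open>By monotone convergence the sum of the squares has finite integral, so it is finite
  almost everywhere and its terms tend to 0.\<close>

lemma AE_tendsto_0_of_summable_square_integrals:
  fixes Z :: "nat \<Rightarrow> 'a \<Rightarrow> real"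
  assumes Z: "\<And>n. integrable M (\<lambda>x. (Z n x)\<^sup>2)"
    and le: "\<And>n. (\<integral>x. (Z n x)\<^sup>2 \<partial>M) \<le> r n" and r: "summable r"
  shows "AE x in M. (\<lambda>n. Z n x) \<longlonglongrightarrow> 0"
proof -
  have r0: "0 \<le> r n" for n using order_trans[OF Bochner_Integration.integral_nonneg le] by simp
  have [measurable]: "(\<lambda>x. (Z n x)\<^sup>2) \<in> borel_measurable M" for n using Z by auto
  have "(\<integral>\<^sup>+x. (\<Sum>n. ennreal ((Z n x)\<^sup>2)) \<partial>M) = (\<Sum>n. \<integral>\<^sup>+x. ennreal ((Z n x)\<^sup>2) \<partial>M)"
    by (rule nn_integral_suminf) simp
  also have "\<dots> \<le> (\<Sum>n. ennreal (r n))"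
    using le by (intro suminf_le) (simp_all add: nn_integral_eq_integral[OF Z] ennreal_leI)
  also have "\<dots> < \<infinity>" using r r0 by (simp add: ennreal_suminf_neq_top less_top)
  finally have "AE x in M. (\<Sum>n. ennreal ((Z n x)\<^sup>2)) \<noteq> \<infinity>"
    by (intro nn_integral_PInf_AE) auto
  then show ?thesis
  proof eventually_elim
    case (elim x)
    then have "summable (\<lambda>n. (Z n x)\<^sup>2)" by (intro summable_suminf_not_top) auto
    then have "(\<lambda>n. (Z n x)\<^sup>2) \<longlonglongrightarrow> 0" by (rule summable_LIMSEQ_zero)
    then have "(\<lambda>n. sqrt ((Z n x)\<^sup>2)) \<longlonglongrightarrow> sqrt 0" by (rule tendsto_real_sqrt)
    then show ?case by (simp add: tendsto_rabs_zero_iff)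
  qed
qed

lemma AE_generation_average_tendsto_0:
  fixes V :: "nat \<Rightarrow> nat \<Rightarrow> 'a \<Rightarrow> real"
  assumes fin: "\<And>n. finite (I n)" and card: "\<And>n. card (I n) = 2 ^ n"
    and meas: "\<And>n k. n \<ge> n0 \<Longrightarrow> k \<in> I n \<Longrightarrow> V n k \<in> borel_measurable M"
    and sq: "\<And>n k. n \<ge> n0 \<Longrightarrow> k \<in> I n \<Longrightarrow> integrable M (\<lambda>x. (V n k x)\<^sup>2)"
    and bound: "\<And>n k. n \<ge> n0 \<Longrightarrow> k \<in> I n \<Longrightarrow> (\<integral>x. (V n k x)\<^sup>2 \<partial>M) \<le> K"
    and orth: "\<And>n k l. n \<ge> n0 \<Longrightarrow> k \<in> I n \<Longrightarrow> l \<in> I n \<Longrightarrow> k \<noteq> l \<Longrightarrow>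
      (\<integral>x. V n k x * V n l x \<partial>M) = 0"
  shows "AE x in M. (\<lambda>n. (\<Sum>k\<in>I n. V n k x) / 2 ^ n) \<longlonglongrightarrow> 0"
proof -
  have "AE x in M. (\<lambda>n. (\<Sum>k\<in>I (n + n0). V (n + n0) k x) / 2 ^ (n + n0)) \<longlonglongrightarrow> 0"
  proof (rule AE_tendsto_0_of_summable_square_integrals)
    fix n :: nat
    let ?n = "n + n0"
    have eq: "(\<Sum>k\<in>I ?n. V ?n k x)\<^sup>2 = (\<Sum>k\<in>I ?n. \<Sum>l\<in>I ?n. V ?n k x * V ?n l x)" for x
      by (simp add: power2_eq_square sum_product)
    have int: "integrable M (\<lambda>x. V ?n k x * V ?n l x)" if "k \<in> I ?n" "l \<in> I ?n" for k l
      using that by (intro integrable_mult_of_squares meas sq) auto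
    show "integrable M (\<lambda>x. ((\<Sum>k\<in>I ?n. V ?n k x) / 2 ^ ?n)\<^sup>2)"
      unfolding power_divide eq using int by (intro integrable_divide Bochner_Integration.integrable_sum)
    have "(\<integral>x. ((\<Sum>k\<in>I ?n. V ?n k x) / 2 ^ ?n)\<^sup>2 \<partial>M) =
        (\<Sum>k\<in>I ?n. \<Sum>l\<in>I ?n. \<integral>x. V ?n k x * V ?n l x \<partial>M) / (2 ^ ?n)\<^sup>2"
      unfolding power_divide eq by (simp add: int)
    also have "(\<Sum>k\<in>I ?n. \<Sum>l\<in>I ?n. \<integral>x. V ?n k x * V ?n l x \<partial>M) =
        (\<Sum>k\<in>I ?n. \<Sum>l\<in>I ?n. if l = k then \<integral>x. (V ?n k x)\<^sup>2 \<partial>M else 0)"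
      using orth[of ?n] by (intro sum.cong refl) (auto simp: power2_eq_square)
    also have "\<dots> = (\<Sum>k\<in>I ?n. \<integral>x. (V ?n k x)\<^sup>2 \<partial>M)" by (simp add: fin)
    also have "\<dots> \<le> (\<Sum>k\<in>I ?n. K)" by (intro sum_mono bound) auto
    also have "\<dots> = 2 ^ ?n * K" by (simp add: card)
    \<comment> \<open>Only the diagonal is left: at most 2^n K over 4^n, with n shifted by
      \<open>n0\<close>.\<close>
    finally show "(\<integral>x. ((\<Sum>k\<in>I ?n. V ?n k x) / 2 ^ ?n)\<^sup>2 \<partial>M) \<le> (1 / 2) ^ n * (K / 2 ^ n0)"
      by (simp add: divide_right_mono power2_eq_square field_simps power_add)
  qed (intro summable_mult2 summable_geometric, simp)
  then show ?thesis
    by (rule eventually_mono) (rule LIMSEQ_offset)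
qed

section \<open>Sums over the binary tree\<close>

lemma gen_eq: "gen n = {2 ^ n..<2 ^ Suc n}"
proof -
  have "(0::nat) < 2 ^ Suc n" by simp
  then have "{2 ^ n..2 ^ Suc n - 1} = {2 ^ n..<2 ^ Suc n :: nat}" by (intro Set.set_eqI) (simp only: atLeastAtMost_iff atLeastLessThan_iff; linarith)
  then show ?thesis by (simp add: gen_def)
qed

lemma finite_gen [simp]: "finite (gen n)"
  by (simp add: gen_eq)

lemma gen_ge:
  assumes "m \<le> n" "k \<in> gen n" shows "2 ^ m \<le> k"
proof -
  have "(2::nat) ^ m \<le> 2 ^ n" using assms(1) by (intro power_increasing) auto
  also have "\<dots> \<le> k" using assms(2) by (simp add: gen_eq)
  finally show ?thesis .
qed

lemma card_gen: "card (gen n) = 2 ^ n"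
  by (simp add: gen_eq)

lemma mem_tree_iff: "k \<in> tree n \<longleftrightarrow> 1 \<le> k \<and> k < 2 ^ Suc n"
proof (induction n)
  case 0
  show ?case by (auto simp: tree_def gen_def)
next
  case (Suc n)
  have "tree (Suc n) = tree n \<union> gen (Suc n)"
    by (auto simp: tree_def atLeast0_atMost_Suc)
  moreover have "(1::nat) \<le> 2 ^ Suc n" by simp
  ultimately show ?case using Suc by (auto simp: gen_eq)
qed

lemma card_tree: "card (tree n) = 2 ^ Suc n - 1"
proof -
  have "tree n = {1..<2 ^ Suc n}" by (auto simp: mem_tree_iff)
  then show ?thesis by simp
qed

lemma children_in_gen: "k \<in> gen n \<Longrightarrow> j < 2 \<Longrightarrow> 2 * k + j \<in> gen (Suc n)"
  by (auto simp: gen_eq)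

lemma ancestor_in_tree:
  assumes "k \<in> gen n" "i \<le> n" shows "k div 2 ^ i \<in> tree n"
proof -
  have "2 ^ i \<le> k" using assms by (intro gen_ge)
  then have "1 \<le> k div 2 ^ i" by (simp add: div_greater_zero_iff Suc_le_eq)
  then show ?thesis
    using assms(1) by (auto simp: mem_tree_iff gen_eq intro: le_less_trans[OF div_le_dividend])
qed

lemma sum_gen_Suc:
  fixes f :: "nat \<Rightarrow> 'b::comm_monoid_add"
  shows "sum f (gen (Suc n)) = (\<Sum>k\<in>gen n. f (2 * k)) + (\<Sum>k\<in>gen n. f (2 * k + 1))"
proof -
  have "gen (Suc n) = (\<lambda>k. 2 * k) ` gen n \<union> (\<lambda>k. 2 * k + 1) ` gen n"
  proof (intro Set.set_eqI iffI)
    fix m assume m: "m \<in> gen (Suc n)"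
    then have "m div 2 \<in> gen n" by (auto simp: gen_eq)
    moreover have "m = 2 * (m div 2) \<or> m = 2 * (m div 2) + 1" by presburger
    ultimately show "m \<in> (\<lambda>k. 2 * k) ` gen n \<union> (\<lambda>k. 2 * k + 1) ` gen n" by blast
  qed (auto simp: gen_eq)
  moreover have "(\<lambda>k. 2 * k) ` gen n \<inter> (\<lambda>k. 2 * k + 1) ` gen n = {}" by (auto; presburger)
  ultimately show ?thesis
    by (simp add: sum.union_disjoint sum.reindex inj_on_def)
qed

text \<open>A generation makes up about half of the tree that it completes, so the error of the tree
  average satisfies a recursion with factor 1 / 2 driven by the error of the generation average. The
  part of the tree below 2^q is forgotten.\<close>

lemma tendsto_tree_average:
  fixes f :: "nat \<Rightarrow> real"
  assumes "(\<lambda>n. (\<Sum>k\<in>gen n. f k) / 2 ^ n) \<longlonglongrightarrow> L"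
  shows "(\<lambda>n. (\<Sum>k\<in>tree_from n q. f k) / real (card (tree n))) \<longlonglongrightarrow> L"
proof -
  define s where "s n = (\<Sum>k\<in>tree_from n q. f k)" for n
  have step: "s (Suc n) = s n + (\<Sum>k\<in>gen (Suc n). f k)" if "q \<le> n" for n
  proof -
    have "(2::nat) ^ q \<le> 2 ^ Suc n" using that by (intro power_increasing) auto
    then have "tree_from (Suc n) q = tree_from n q \<union> gen (Suc n)"
      by (auto simp: tree_from_def mem_tree_iff gen_eq)
    moreover have "tree_from n q \<inter> gen (Suc n) = {}"
      by (auto simp: tree_from_def mem_tree_iff gen_eq)
    moreover have "finite (tree_from n q)"
      by (rule finite_subset[of _ "{..<2 ^ Suc n}"]) (auto simp: tree_from_def mem_tree_iff)
    ultimately show ?thesis by (simp add: s_def sum.union_disjoint)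
  qed
  \<comment> \<open>Normalising by 2^(n+1) instead of the cardinality 2^(n+1) - 1 makes the
    recursion exact; the quotient of the two, which tends to 1, is corrected at the end.\<close>
  define y r where "y n = s (n + q) / 2 ^ Suc (n + q) - L"
    and "r n = ((\<Sum>k\<in>gen (Suc (n + q)). f k) / 2 ^ Suc (n + q) - L) / 2" for n
  have "r \<longlonglongrightarrow> (L - L) / 2"
    unfolding r_def
    using LIMSEQ_ignore_initial_segment[OF assms, of "Suc q"] by (intro tendsto_intros) simp_all
  then have "r \<longlonglongrightarrow> 0" by simp
  moreover have "y (Suc n) = 1 / 2 * y n + r n" for n
    using step[of "n + q"] by (simp add: y_def r_def field_simps)
  ultimately have "y \<longlonglongrightarrow> 0" by (intro affine_recursion_tendsto_0[of "1 / 2" r y]) auto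
  then have "(\<lambda>n. s (n + q) / 2 ^ Suc (n + q) - L + L) \<longlonglongrightarrow> 0 + L"
    unfolding y_def by (intro tendsto_intros)
  then have lim: "(\<lambda>n. s n / 2 ^ Suc n) \<longlonglongrightarrow> L"
    using LIMSEQ_offset[of "\<lambda>n. s n / 2 ^ Suc n" q] by simp
  have "(\<lambda>n. (1 / 2 :: real) ^ Suc n) \<longlonglongrightarrow> 0"
    using LIMSEQ_Suc[OF LIMSEQ_power_zero[of "1 / 2 :: real"]] by simp
  then have "(\<lambda>n. (s n / 2 ^ Suc n) / (1 - (1 / 2) ^ Suc n)) \<longlonglongrightarrow> L / (1 - 0)"
    using lim by (intro tendsto_intros) auto
  moreover have eq: "(s n / 2 ^ Suc n) / (1 - (1 / 2) ^ Suc n) = s n / real (card (tree n))" for n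
  proof -
    have "real (card (tree n)) = 2 ^ Suc n - 1" by (simp add: card_tree of_nat_diff)
    moreover have "1 - (1 / 2 :: real) ^ Suc n = (2 ^ Suc n - 1) / 2 ^ Suc n"
      by (simp add: power_divide diff_divide_distrib)
    ultimately show ?thesis by (simp del: power_Suc)
  qed
  ultimately show ?thesis unfolding eq unfolding s_def by simp
qed

section \<open>Convergence along a path\<close>

lemma abs_half_sum_le:
  fixes x y r :: real
  assumes "\<bar>x\<bar> \<le> K" "\<bar>y\<bar> \<le> K" "\<bar>r\<bar> \<le> R" shows "\<bar>x / 2 + y / 2 + r\<bar> \<le> K + R"
  using assms by linarith

text \<open>With \<open>u\<close> the state of a parent and \<open>u'\<close> that of its child, u'
  = A u + t e_1: the new value enters in front and the older ones move down by one place.\<close>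

lemma lin_companion_step:
  assumes "p \<ge> 1" and "u' 0 = (\<Sum>k = 1..p. a k * u (k - 1)) + t" and "\<And>i. u' (Suc i) = u i"
  shows "lin p u' \<phi> = lin p u (adj p a \<phi>) + \<phi> 0 * t"
proof -
  obtain q where q: "p = Suc q" using assms(1) by (cases p) auto
  have "(\<Sum>k = 1..p. a k * u (k - 1)) = (\<Sum>j<p. a (Suc j) * u j)"
    by (rule sum.reindex_bij_witness[of _ Suc "\<lambda>k. k - 1"]) auto
  then have "lin p u' \<phi> = \<phi> 0 * ((\<Sum>j<p. a (Suc j) * u j) + t) + (\<Sum>i<q. \<phi> (Suc i) * u i)"
    unfolding lin_def q sum.lessThan_Suc_shift using assms(2,3) q by simp
  moreover have "lin p u (adj p a \<phi>) = \<phi> 0 * (\<Sum>j<p. a (Suc j) * u j) + (\<Sum>i<q. \<phi> (Suc i) * u i)"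
  proof -
    have "(\<Sum>j<p. (if Suc j < p then \<phi> (Suc j) else 0) * u j) = (\<Sum>i<q. \<phi> (Suc i) * u i)"
      unfolding q by simp
    moreover have "lin p u (adj p a \<phi>) =
        (\<Sum>j<p. \<phi> 0 * (a (Suc j) * u j) + (if Suc j < p then \<phi> (Suc j) else 0) * u j)"
      unfolding lin_def by (intro sum.cong refl) (simp add: adj_def algebra_simps)
    ultimately show ?thesis by (simp add: sum.distrib sum_distrib_left)
  qed
  ultimately show ?thesis by (simp add: algebra_simps)
qed

text \<open>One realisation of the process, with the almost sure limits as assumptions.
  \<open>noise_state\<close> is required for each coordinate rather than for each \<phi> in
  \<open>D\<close>: finitely many limits suffice, whereas an uncountable family could not be handled
  almost surely one by one.\<close>

locale bar_path = dual_ball +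
  fixes x e :: "nat \<Rightarrow> real" and s :: real
  assumes even: "n \<ge> 2 ^ (p - 1) \<Longrightarrow>
      x (2 * n) = a 0 + (\<Sum>k = 1..p. a k * x (n div 2 ^ (k - 1))) + e (2 * n)"
    and odd: "n \<ge> 2 ^ (p - 1) \<Longrightarrow>
      x (2 * n + 1) = b 0 + (\<Sum>k = 1..p. b k * x (n div 2 ^ (k - 1))) + e (2 * n + 1)"
    and noise: "j < 2 \<Longrightarrow> (\<lambda>n. (\<Sum>k\<in>gen n. e (2 * k + j)) / 2 ^ n) \<longlonglongrightarrow> 0"
    and noise_state: "j < 2 \<Longrightarrow> i < p \<Longrightarrow>
      (\<lambda>n. (\<Sum>k\<in>gen n. e (2 * k + j) * x (k div 2 ^ i)) / 2 ^ n) \<longlonglongrightarrow> 0"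
    and noise_square: "j < 2 \<Longrightarrow> (\<lambda>n. (\<Sum>k\<in>gen n. (e (2 * k + j))\<^sup>2 - s) / 2 ^ n) \<longlonglongrightarrow> 0"
begin

definition "state \<phi> k = lin p (\<lambda>i. x (k div 2 ^ i)) \<phi>"
definition "avg1 n \<phi> = (\<Sum>k\<in>gen n. state \<phi> k) / 2 ^ n"
definition "avg2 n \<phi> \<psi> = (\<Sum>k\<in>gen n. state \<phi> k * state \<psi> k) / 2 ^ n"
definition "m j n = (\<Sum>k\<in>gen n. e (2 * k + j)) / 2 ^ n"
definition "v j n = (\<Sum>k\<in>gen n. (e (2 * k + j))\<^sup>2 - s) / 2 ^ n"
definition "z j n \<phi> = (\<Sum>k\<in>gen n. e (2 * k + j) * state \<phi> k) / 2 ^ n"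
text \<open>C times this quantity dominates \<open>z j n \<phi>\<close> uniformly for coefficients
  bounded by C.\<close>

definition "Z j n = (\<Sum>i<p. \<bar>(\<Sum>k\<in>gen n. e (2 * k + j) * x (k div 2 ^ i)) / 2 ^ n\<bar>)"

lemma state_scale: "state (\<lambda>i. t * \<phi> i) k = t * state \<phi> k"
  by (simp add: state_def lin_scale)

lemma avg1_scale: "avg1 n (\<lambda>i. t * \<phi> i) = t * avg1 n \<phi>"
  by (simp add: avg1_def state_scale sum_distrib_left)

lemma avg2_scale: "avg2 n (\<lambda>i. t * \<phi> i) (\<lambda>i. t' * \<psi> i) = t * t' * avg2 n \<phi> \<psi>"
  by (simp add: avg2_def state_scale sum_distrib_left mult_ac)

lemma state_even:
  assumes "k \<ge> 2 ^ (p - 1)"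
  shows "state \<phi> (2 * k) = state (adj p a \<phi>) k + \<phi> 0 * (a 0 + e (2 * k))"
  unfolding state_def using even[OF assms] p by (intro lin_companion_step) auto

lemma state_odd:
  assumes "k \<ge> 2 ^ (p - 1)"
  shows "state \<phi> (2 * k + 1) = state (adj p b \<phi>) k + \<phi> 0 * (b 0 + e (2 * k + 1))"
  unfolding state_def using odd[OF assms] p by (intro lin_companion_step) (auto simp: div_mult2_eq)

lemma state_bound: "\<phi> \<in> D \<Longrightarrow> \<bar>state \<phi> k\<bar> \<le> C * (\<Sum>i<p. \<bar>x (k div 2 ^ i)\<bar>)"
  unfolding state_def by (rule lin_bound) (rule D_bound)

lemma avg1_Suc:
  assumes n: "n \<ge> p - 1"
  shows "avg1 (Suc n) \<phi> = (avg1 n (adj p a \<phi>) + avg1 n (adj p b \<phi>)) / 2 +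
    \<phi> 0 * (abar + (m 0 n + m 1 n) / 2)"
proof -
  have "(\<Sum>k\<in>gen (Suc n). state \<phi> k) =
      (\<Sum>k\<in>gen n. state (adj p a \<phi>) k + \<phi> 0 * (a 0 + e (2 * k + 0))) +
      (\<Sum>k\<in>gen n. state (adj p b \<phi>) k + \<phi> 0 * (b 0 + e (2 * k + 1)))"
    unfolding sum_gen_Suc using gen_ge[OF n]
    by (intro arg_cong2[where f = "(+)"] sum.cong refl) (simp_all add: state_even state_odd[simplified])
  also have "\<dots> = 2 ^ n * (avg1 n (adj p a \<phi>) + avg1 n (adj p b \<phi>) + \<phi> 0 * (a 0 + m 0 n + (b 0 + m 1 n)))"
    unfolding sum.distrib sum_distrib_left[symmetric] avg1_def m_def
    by (simp add: card_gen field_simps)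
  finally show ?thesis
    by (simp add: avg1_def[of "Suc n"] abar_def field_simps)
qed

text \<open>The squared noise is split as (e^2 - s) + s: the first part goes into the vanishing
  \<open>v\<close>, the second produces the variance term of \<open>Tf\<close>.\<close>

lemma sum_state_product:
  shows "(\<Sum>k\<in>gen n. (state f k + \<phi> 0 * (t + e (2 * k + j))) * (state g k + \<psi> 0 * (t + e (2 * k + j)))) =
    2 ^ n * (avg2 n f g + t * (\<phi> 0 * avg1 n g + \<psi> 0 * avg1 n f) + \<phi> 0 * z j n g + \<psi> 0 * z j n f +
      \<phi> 0 * \<psi> 0 * (t\<^sup>2 + 2 * t * m j n + v j n + s))"
proof -
  have "(\<Sum>k\<in>gen n. (state f k + \<phi> 0 * (t + e (2 * k + j))) * (state g k + \<psi> 0 * (t + e (2 * k + j)))) =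
     (\<Sum>k\<in>gen n. state f k * state g k + t * \<phi> 0 * state g k + t * \<psi> 0 * state f k +
        \<phi> 0 * (e (2 * k + j) * state g k) + \<psi> 0 * (e (2 * k + j) * state f k) +
        \<phi> 0 * \<psi> 0 * (t\<^sup>2 + s) + 2 * t * \<phi> 0 * \<psi> 0 * e (2 * k + j) +
        \<phi> 0 * \<psi> 0 * ((e (2 * k + j))\<^sup>2 - s))"
    by (intro sum.cong refl) (simp add: algebra_simps power2_eq_square)
  also have "\<dots> = 2 ^ n * (avg2 n f g + t * (\<phi> 0 * avg1 n g + \<psi> 0 * avg1 n f) + \<phi> 0 * z j n g + \<psi> 0 * z j n f +
      \<phi> 0 * \<psi> 0 * (t\<^sup>2 + 2 * t * m j n + v j n + s))"
    unfolding sum.distrib sum_distrib_left[symmetric] avg1_def avg2_def m_def z_def v_def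
    by (simp add: card_gen field_simps)
  finally show ?thesis .
qed

lemma avg2_Suc:
  assumes n: "n \<ge> p - 1"
  shows "avg2 (Suc n) \<phi> \<psi> =
    ((avg2 n (adj p a \<phi>) (adj p a \<psi>) +
      a 0 * (\<phi> 0 * avg1 n (adj p a \<psi>) + \<psi> 0 * avg1 n (adj p a \<phi>)) +
      \<phi> 0 * z 0 n (adj p a \<psi>) + \<psi> 0 * z 0 n (adj p a \<phi>) +
      \<phi> 0 * \<psi> 0 * ((a 0)\<^sup>2 + 2 * a 0 * m 0 n + v 0 n + s)) +
     (avg2 n (adj p b \<phi>) (adj p b \<psi>) +
      b 0 * (\<phi> 0 * avg1 n (adj p b \<psi>) + \<psi> 0 * avg1 n (adj p b \<phi>)) +
      \<phi> 0 * z 1 n (adj p b \<psi>) + \<psi> 0 * z 1 n (adj p b \<phi>) +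
      \<phi> 0 * \<psi> 0 * ((b 0)\<^sup>2 + 2 * b 0 * m 1 n + v 1 n + s))) / 2"
proof -
  have "(\<Sum>k\<in>gen (Suc n). state \<phi> k * state \<psi> k) =
      (\<Sum>k\<in>gen n. (state (adj p a \<phi>) k + \<phi> 0 * (a 0 + e (2 * k + 0))) *
         (state (adj p a \<psi>) k + \<psi> 0 * (a 0 + e (2 * k + 0)))) +
      (\<Sum>k\<in>gen n. (state (adj p b \<phi>) k + \<phi> 0 * (b 0 + e (2 * k + 1))) *
         (state (adj p b \<psi>) k + \<psi> 0 * (b 0 + e (2 * k + 1))))"
    unfolding sum_gen_Suc using gen_ge[OF n]
    by (intro arg_cong2[where f = "(+)"] sum.cong refl) (simp_all add: state_even state_odd[simplified])
  then show ?thesis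
    unfolding avg2_def[of "Suc n"] sum_state_product distrib_left[symmetric] by simp
qed

text \<open>Subtracting the fixed point equation \<open>lamf_eq\<close> cancels the intercept; what
  remains of the perturbation depends on \<phi> only through \<phi>_0, which is at most C. The
  recursion is valid from generation p - 1 on, and \<open>K\<close> bounds the error there.\<close>

lemma avg1_tendsto:
  obtains y where "y \<longlonglongrightarrow> 0"
    "\<And>n \<phi>. n \<ge> p - 1 \<Longrightarrow> \<phi> \<in> D \<Longrightarrow> \<bar>avg1 n \<phi> - lamf \<phi>\<bar> \<le> y n"
proof -
  define r where "r n = C * \<bar>(m 0 n + m 1 n) / 2\<bar>" for n
  have "r \<longlonglongrightarrow> C * \<bar>(0 + 0) / 2\<bar>"
    unfolding r_def m_def by (intro tendsto_intros noise) auto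
  then have r: "r \<longlonglongrightarrow> 0" by simp
  define K where "K = (\<Sum>k\<in>gen (p - 1). C * (\<Sum>i<p. \<bar>x (k div 2 ^ i)\<bar>)) / 2 ^ (p - 1) +
    C * (\<Sum>i<p. \<bar>lam p a b $ i\<bar>)"
  show ?thesis
  proof (rule uniform_contraction_tendsto_0[where \<beta> = \<beta> and D = D and r = r and ?n0.0 = "p - 1" and
        e = "\<lambda>n \<phi>. avg1 n \<phi> - lamf \<phi>", OF _ \<beta>(2) r _ _ that])
    fix \<phi> assume \<phi>: "\<phi> \<in> D"
    have "\<bar>\<Sum>k\<in>gen (p - 1). state \<phi> k\<bar> \<le> (\<Sum>k\<in>gen (p - 1). C * (\<Sum>i<p. \<bar>x (k div 2 ^ i)\<bar>))"
      by (intro order_trans[OF sum_abs] sum_mono state_bound \<phi>)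
    then have "\<bar>avg1 (p - 1) \<phi>\<bar> \<le> (\<Sum>k\<in>gen (p - 1). C * (\<Sum>i<p. \<bar>x (k div 2 ^ i)\<bar>)) / 2 ^ (p - 1)"
      by (simp add: avg1_def divide_right_mono)
    moreover have "\<bar>lamf \<phi>\<bar> \<le> C * (\<Sum>i<p. \<bar>lam p a b $ i\<bar>)"
      unfolding lamf_def by (intro lin_bound D_bound[OF \<phi>])
    ultimately show "\<bar>avg1 (p - 1) \<phi> - lamf \<phi>\<bar> \<le> K" unfolding K_def by linarith
  next
    fix n y \<phi> assume n: "n \<ge> p - 1" and \<phi>: "\<phi> \<in> D"
      and y: "\<And>\<phi>. \<phi> \<in> D \<Longrightarrow> \<bar>avg1 n \<phi> - lamf \<phi>\<bar> \<le> y"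
    let ?d = "\<lambda>\<phi>. avg1 n \<phi> - lamf \<phi>"
    have hom: "?d (\<lambda>i. s * \<phi> i) = s * ?d \<phi>" for s \<phi>
      by (simp add: avg1_scale lamf_scale algebra_simps)
    have bounds: "\<bar>?d (adj p a \<phi>)\<bar> \<le> \<beta> * y" "\<bar>?d (adj p b \<phi>)\<bar> \<le> \<beta> * y"
      by (rule lin_adj_bound[of ?d, OF _ \<phi> hom], erule y)+
    have eq: "avg1 (Suc n) \<phi> - lamf \<phi> =
      ?d (adj p a \<phi>) / 2 + ?d (adj p b \<phi>) / 2 + \<phi> 0 * ((m 0 n + m 1 n) / 2)"
      unfolding avg1_Suc[OF n] lamf_eq[of \<phi>] by (simp add: field_simps)
    have "\<bar>\<phi> 0 * ((m 0 n + m 1 n) / 2)\<bar> \<le> r n"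
      unfolding abs_mult r_def using D_bound[OF \<phi>, of 0] p by (intro mult_right_mono) auto
    then show "\<bar>avg1 (Suc n) \<phi> - lamf \<phi>\<bar> \<le> \<beta> * y + r n"
      unfolding eq by (intro abs_half_sum_le bounds)
  qed (use \<beta> in auto)
qed

lemma Z_tendsto: "j < 2 \<Longrightarrow> Z j \<longlonglongrightarrow> 0"
proof -
  assume j: "j < 2"
  have "Z j \<longlonglongrightarrow> (\<Sum>i<p. \<bar>0\<bar>)"
    unfolding Z_def[abs_def] by (intro tendsto_sum tendsto_rabs noise_state j) auto
  then show ?thesis by simp
qed

lemma z_bound:
  assumes "\<And>i. i < p \<Longrightarrow> \<bar>\<phi> i\<bar> \<le> C" shows "\<bar>z j n \<phi>\<bar> \<le> C * Z j n"
proof -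
  let ?w = "\<lambda>i. \<Sum>k\<in>gen n. e (2 * k + j) * x (k div 2 ^ i)"
  have "(\<Sum>k\<in>gen n. e (2 * k + j) * state \<phi> k) =
      (\<Sum>k\<in>gen n. \<Sum>i<p. \<phi> i * (e (2 * k + j) * x (k div 2 ^ i)))"
    by (simp add: state_def lin_def sum_distrib_left mult.left_commute)
  also have "\<dots> = (\<Sum>i<p. \<Sum>k\<in>gen n. \<phi> i * (e (2 * k + j) * x (k div 2 ^ i)))"
    by (rule sum.swap)
  also have "\<dots> = (\<Sum>i<p. \<phi> i * ?w i)"
    by (simp only: sum_distrib_left)
  finally have "z j n \<phi> = lin p (\<lambda>i. ?w i / 2 ^ n) \<phi>"
    unfolding z_def lin_def by (simp only:) (subst sum_divide_distrib, simp only: times_divide_eq_right)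
  then show ?thesis unfolding Z_def by (simp only:) (intro lin_bound assms)
qed

text \<open>After subtracting \<open>ellf_eq\<close>, the recursion for second-order averages still
  contains first-order errors. By \<open>avg1_tendsto\<close> these vanish uniformly on
  \<open>D\<close>, so they join the noise in the perturbation \<open>r\<close>.\<close>

lemma avg2_tendsto:
  obtains y where "y \<longlonglongrightarrow> 0"
    "\<And>n \<phi> \<psi>. n \<ge> p - 1 \<Longrightarrow> \<phi> \<in> D \<Longrightarrow> \<psi> \<in> D \<Longrightarrow> \<bar>avg2 n \<phi> \<psi> - ellf s \<phi> \<psi>\<bar> \<le> y n"
proof -
  obtain y1 where y1: "y1 \<longlonglongrightarrow> 0"
    "\<And>n \<phi>. n \<ge> p - 1 \<Longrightarrow> \<phi> \<in> D \<Longrightarrow> \<bar>avg1 n \<phi> - lamf \<phi>\<bar> \<le> y1 n"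
    using avg1_tendsto by blast
  \<comment> \<open>The perturbation from children of parity j with intercept t: the noise against
    the states, the first-order error and the moments of the noise, in this order. Two halved cross
    terms, each at most C (C Z), give the first summand.\<close>
  define R where "R t j n = C * (C * Z j n) + (\<bar>t\<bar> * (C * (\<beta> * y1 n)) + C * C * \<bar>(2 * t * m j n + v j n) / 2\<bar>)" for t j n
  have R: "R t j \<longlonglongrightarrow> 0" if j: "j < 2" for t j
  proof -
    have "R t j \<longlonglongrightarrow> C * (C * 0) + (\<bar>t\<bar> * (C * (\<beta> * 0)) + C * C * \<bar>(2 * t * 0 + 0) / 2\<bar>)"
      unfolding R_def[abs_def] m_def v_def
      by (intro tendsto_intros y1(1) Z_tendsto noise noise_square j) auto
    then show ?thesis by simp
  qed
  define r where "r n = R (a 0) 0 n + R (b 0) 1 n" for n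
  have "r \<longlonglongrightarrow> 0 + 0" unfolding r_def by (intro tendsto_add R) auto
  then have r: "r \<longlonglongrightarrow> 0" by simp
  define K where "K = (\<Sum>k\<in>gen (p - 1). (C * (\<Sum>i<p. \<bar>x (k div 2 ^ i)\<bar>)) * (C * (\<Sum>i<p. \<bar>x (k div 2 ^ i)\<bar>)))
      / 2 ^ (p - 1) + C * C * (\<Sum>i<p. \<Sum>j<p. \<bar>ell p a b s $$ (i, j)\<bar>)"
  have R_bound: "\<bar>(t * (\<phi> 0 * d\<psi> + \<psi> 0 * d\<phi>) + \<phi> 0 * z\<psi> + \<psi> 0 * z\<phi> +
        \<phi> 0 * \<psi> 0 * (2 * t * m j n + v j n)) / 2\<bar> \<le> R t j n"
    if "\<phi> \<in> D" "\<psi> \<in> D" "\<bar>d\<phi>\<bar> \<le> \<beta> * y1 n" "\<bar>d\<psi>\<bar> \<le> \<beta> * y1 n"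
      "\<bar>z\<phi>\<bar> \<le> C * Z j n" "\<bar>z\<psi>\<bar> \<le> C * Z j n" for \<phi> \<psi> d\<phi> d\<psi> z\<phi> z\<psi> t j n
  proof -
    have 0: "\<bar>\<phi> 0\<bar> \<le> C" "\<bar>\<psi> 0\<bar> \<le> C" using D_bound that p by auto
    have prod: "\<bar>f * d\<bar> \<le> C * K" if "\<bar>f\<bar> \<le> C" "\<bar>d\<bar> \<le> K" for f d K :: real
      unfolding abs_mult using that C_pos by (intro mult_mono) auto
    have 1: "\<bar>t * ((\<phi> 0 * d\<psi> + \<psi> 0 * d\<phi>) / 2)\<bar> \<le> \<bar>t\<bar> * (C * (\<beta> * y1 n))"
      unfolding abs_mult[of t] using prod[OF 0(1) that(4)] prod[OF 0(2) that(3)]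
      by (intro mult_left_mono) auto
    have 2: "\<bar>\<phi> 0 * z\<psi>\<bar> \<le> C * (C * Z j n)" "\<bar>\<psi> 0 * z\<phi>\<bar> \<le> C * (C * Z j n)"
      using prod[OF 0(1) that(6)] prod[OF 0(2) that(5)] .
    have 3: "\<bar>\<phi> 0 * \<psi> 0 * ((2 * t * m j n + v j n) / 2)\<bar> \<le> C * C * \<bar>(2 * t * m j n + v j n) / 2\<bar>"
      unfolding abs_mult[of "\<phi> 0 * \<psi> 0"] using prod[OF 0] by (intro mult_right_mono) auto
    have eq: "(t * (\<phi> 0 * d\<psi> + \<psi> 0 * d\<phi>) + \<phi> 0 * z\<psi> + \<psi> 0 * z\<phi> + \<phi> 0 * \<psi> 0 * (2 * t * m j n + v j n)) / 2 =
      (\<phi> 0 * z\<psi>) / 2 + (\<psi> 0 * z\<phi>) / 2 + (t * ((\<phi> 0 * d\<psi> + \<psi> 0 * d\<phi>) / 2) +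
      \<phi> 0 * \<psi> 0 * ((2 * t * m j n + v j n) / 2))" by (simp add: field_simps)
    show ?thesis unfolding eq R_def
      by (intro abs_half_sum_le order_trans[OF abs_triangle_ineq] add_mono 1 2 3)
  qed
  obtain y where y: "y \<longlonglongrightarrow> 0" and yb:
    "\<And>n f. n \<ge> p - 1 \<Longrightarrow> f \<in> D \<times> D \<Longrightarrow> \<bar>case f of (\<phi>, \<psi>) \<Rightarrow> avg2 n \<phi> \<psi> - ellf s \<phi> \<psi>\<bar> \<le> y n"
  proof (rule uniform_contraction_tendsto_0[where \<beta> = "\<beta>\<^sup>2" and D = "D \<times> D" and r = r and
        ?n0.0 = "p - 1" and e = "\<lambda>n (\<phi>, \<psi>). avg2 n \<phi> \<psi> - ellf s \<phi> \<psi>", OF \<beta>2 r])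
    fix f assume "f \<in> D \<times> D"
    then obtain \<phi> \<psi> where f: "f = (\<phi>, \<psi>)" and \<phi>: "\<phi> \<in> D" and \<psi>: "\<psi> \<in> D" by auto
    have "\<bar>\<Sum>k\<in>gen (p - 1). state \<phi> k * state \<psi> k\<bar> \<le>
      (\<Sum>k\<in>gen (p - 1). (C * (\<Sum>i<p. \<bar>x (k div 2 ^ i)\<bar>)) * (C * (\<Sum>i<p. \<bar>x (k div 2 ^ i)\<bar>)))"
    proof (intro order_trans[OF sum_abs] sum_mono)
      fix k
      have "0 \<le> C * (\<Sum>i<p. \<bar>x (k div 2 ^ i)\<bar>)"
        using order_trans[OF abs_ge_zero state_bound[OF \<phi>]] .
      then show "\<bar>state \<phi> k * state \<psi> k\<bar> \<le>
          (C * (\<Sum>i<p. \<bar>x (k div 2 ^ i)\<bar>)) * (C * (\<Sum>i<p. \<bar>x (k div 2 ^ i)\<bar>))"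
        unfolding abs_mult by (intro mult_mono state_bound \<phi> \<psi> abs_ge_zero)
    qed
    then have "\<bar>avg2 (p - 1) \<phi> \<psi>\<bar> \<le> (\<Sum>k\<in>gen (p - 1). (C * (\<Sum>i<p. \<bar>x (k div 2 ^ i)\<bar>)) * (C * (\<Sum>i<p. \<bar>x (k div 2 ^ i)\<bar>))) / 2 ^ (p - 1)"
      by (simp add: avg2_def divide_right_mono)
    moreover have "\<bar>ellf s \<phi> \<psi>\<bar> \<le> C * C * (\<Sum>i<p. \<Sum>j<p. \<bar>ell p a b s $$ (i, j)\<bar>)"
      unfolding ellf_def by (rule bil_bound[OF \<phi> \<psi>])
    ultimately show "\<bar>case f of (\<phi>, \<psi>) \<Rightarrow> avg2 (p - 1) \<phi> \<psi> - ellf s \<phi> \<psi>\<bar> \<le> K"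
      unfolding K_def f prod.case by linarith
  next
    fix n y f assume n: "n \<ge> p - 1" and "f \<in> D \<times> D"
      and "\<And>f. f \<in> D \<times> D \<Longrightarrow> \<bar>case f of (\<phi>, \<psi>) \<Rightarrow> avg2 n \<phi> \<psi> - ellf s \<phi> \<psi>\<bar> \<le> y"
    then obtain \<phi> \<psi> where f: "f = (\<phi>, \<psi>)" and \<phi>: "\<phi> \<in> D" and \<psi>: "\<psi> \<in> D"
      and y: "\<And>\<phi> \<psi>. \<phi> \<in> D \<Longrightarrow> \<psi> \<in> D \<Longrightarrow> \<bar>avg2 n \<phi> \<psi> - ellf s \<phi> \<psi>\<bar> \<le> y" by fastforce
    let ?d = "\<lambda>\<phi>. avg1 n \<phi> - lamf \<phi>" and ?dd = "\<lambda>\<phi> \<psi>. avg2 n \<phi> \<psi> - ellf s \<phi> \<psi>"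
    have scale2: "?dd (\<lambda>i. t * \<phi> i) (\<lambda>i. t' * \<psi> i) = t * t' * ?dd \<phi> \<psi>" for t t' \<phi> \<psi>
      by (simp add: avg2_scale ellf_scale algebra_simps)
    have scale1: "?d (\<lambda>i. t * \<phi> i) = t * ?d \<phi>" for t \<phi>
      by (simp add: avg1_scale lamf_scale algebra_simps)
    have dd: "\<bar>?dd (adj p a \<phi>) (adj p a \<psi>)\<bar> \<le> \<beta>\<^sup>2 * y" "\<bar>?dd (adj p b \<phi>) (adj p b \<psi>)\<bar> \<le> \<beta>\<^sup>2 * y"
      by (rule bil_adj_bound[of ?dd, OF _ \<phi> \<psi> scale2], erule (1) y)+
    have d: "\<bar>?d (adj p a f)\<bar> \<le> \<beta> * y1 n" "\<bar>?d (adj p b f)\<bar> \<le> \<beta> * y1 n" if "f \<in> D" for f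
      by (rule lin_adj_bound[of ?d, OF _ that scale1], erule y1(2)[OF n])+
    note d\<phi> = d[OF \<phi>] and d\<psi> = d[OF \<psi>]
    have zb: "\<bar>z j n (adj p a f)\<bar> \<le> C * Z j n" "\<bar>z j n (adj p b f)\<bar> \<le> C * Z j n" if "f \<in> D" for f j
      by (rule z_bound, erule adj_bound[OF that])+
    note Ra = R_bound[OF \<phi> \<psi> d\<phi>(1) d\<psi>(1) zb(1)[OF \<phi>] zb(1)[OF \<psi>]]
    note Rb = R_bound[OF \<phi> \<psi> d\<phi>(2) d\<psi>(2) zb(2)[OF \<phi>] zb(2)[OF \<psi>]]
    have eq: "avg2 (Suc n) \<phi> \<psi> - ellf s \<phi> \<psi> =
      ?dd (adj p a \<phi>) (adj p a \<psi>) / 2 + ?dd (adj p b \<phi>) (adj p b \<psi>) / 2 +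
      ((a 0 * (\<phi> 0 * ?d (adj p a \<psi>) + \<psi> 0 * ?d (adj p a \<phi>)) + \<phi> 0 * z 0 n (adj p a \<psi>) + \<psi> 0 * z 0 n (adj p a \<phi>) +
        \<phi> 0 * \<psi> 0 * (2 * a 0 * m 0 n + v 0 n)) / 2 +
      (b 0 * (\<phi> 0 * ?d (adj p b \<psi>) + \<psi> 0 * ?d (adj p b \<phi>)) + \<phi> 0 * z 1 n (adj p b \<psi>) + \<psi> 0 * z 1 n (adj p b \<phi>) +
        \<phi> 0 * \<psi> 0 * (2 * b 0 * m 1 n + v 1 n)) / 2)"
      unfolding avg2_Suc[OF n] ellf_eq[of s \<phi> \<psi>] Tf_def by (simp add: field_simps)
    have "\<bar>avg2 (Suc n) \<phi> \<psi> - ellf s \<phi> \<psi>\<bar> \<le> \<beta>\<^sup>2 * y + r n"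
      unfolding eq r_def
      by (intro abs_half_sum_le dd order_trans[OF abs_triangle_ineq] add_mono Ra Rb)
    then show "\<bar>case f of (\<phi>, \<psi>) \<Rightarrow> avg2 (Suc n) \<phi> \<psi> - ellf s \<phi> \<psi>\<bar> \<le> \<beta>\<^sup>2 * y + r n"
      by (simp add: f)
  qed blast
  show ?thesis
    using yb[of _ "(_, _)"] by (intro that[OF y]) simp
qed

text \<open>The basis vector need not lie in \<open>D\<close>, but its multiple by \<open>c\<close>
  does; the error is then divided by c.\<close>

lemma generation_average_state:
  assumes "i < p"
  shows "(\<lambda>n. (\<Sum>k\<in>gen n. x (k div 2 ^ i)) / 2 ^ n) \<longlonglongrightarrow> lam p a b $ i"
proof -
  obtain y where y: "y \<longlonglongrightarrow> 0"
    "\<And>n \<phi>. n \<ge> p - 1 \<Longrightarrow> \<phi> \<in> D \<Longrightarrow> \<bar>avg1 n \<phi> - lamf \<phi>\<bar> \<le> y n"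
    using avg1_tendsto by blast
  have "c * \<bar>avg1 n (delta i) - lamf (delta i)\<bar> \<le> y n" if "n \<ge> p - 1" for n
  proof -
    have "avg1 n (\<lambda>k. c * delta i k) - lamf (\<lambda>k. c * delta i k) = c * (avg1 n (delta i) - lamf (delta i))"
      unfolding avg1_scale lamf_scale by (rule right_diff_distrib[symmetric])
    then show ?thesis using y(2)[OF that c_delta_in_D[of i]] c by (simp add: abs_mult)
  qed
  then have "norm (avg1 n (delta i) - lamf (delta i)) \<le> y n / c" if "n \<ge> p - 1" for n
    using c that by (simp add: pos_le_divide_eq mult.commute)
  then have "\<forall>\<^sub>F n in sequentially. norm (avg1 n (delta i) - lamf (delta i)) \<le> y n / c"
    by (rule eventually_sequentiallyI)
  moreover have "(\<lambda>n. y n / c) \<longlonglongrightarrow> 0" using tendsto_divide[OF y(1) tendsto_const, of c] c by simp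
  ultimately have "(\<lambda>n. avg1 n (delta i)) \<longlonglongrightarrow> lamf (delta i)"
    by (rule Lim_null[THEN iffD2, OF Lim_null_comparison])
  then show ?thesis
    using assms by (simp add: avg1_def state_def lamf_def lin_delta)
qed

lemma generation_average_state_product:
  assumes "i < p" "j < p"
  shows "(\<lambda>n. (\<Sum>k\<in>gen n. x (k div 2 ^ i) * x (k div 2 ^ j)) / 2 ^ n) \<longlonglongrightarrow> ell p a b s $$ (i, j)"
proof -
  obtain y where y: "y \<longlonglongrightarrow> 0"
    "\<And>n \<phi> \<psi>. n \<ge> p - 1 \<Longrightarrow> \<phi> \<in> D \<Longrightarrow> \<psi> \<in> D \<Longrightarrow> \<bar>avg2 n \<phi> \<psi> - ellf s \<phi> \<psi>\<bar> \<le> y n"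
    using avg2_tendsto by blast
  have "c * c * \<bar>avg2 n (delta i) (delta j) - ellf s (delta i) (delta j)\<bar> \<le> y n" if "n \<ge> p - 1" for n
  proof -
    have "avg2 n (\<lambda>k. c * delta i k) (\<lambda>k. c * delta j k) - ellf s (\<lambda>k. c * delta i k) (\<lambda>k. c * delta j k) =
        c * c * (avg2 n (delta i) (delta j) - ellf s (delta i) (delta j))"
      unfolding avg2_scale ellf_scale by (rule right_diff_distrib[symmetric])
    then show ?thesis
      using y(2)[OF that c_delta_in_D[of i] c_delta_in_D[of j]] c by (simp add: abs_mult)
  qed
  then have "norm (avg2 n (delta i) (delta j) - ellf s (delta i) (delta j)) \<le> y n / (c * c)"
    if "n \<ge> p - 1" for n
    using c that by (simp add: pos_le_divide_eq mult.commute)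
  then have "\<forall>\<^sub>F n in sequentially.
      norm (avg2 n (delta i) (delta j) - ellf s (delta i) (delta j)) \<le> y n / (c * c)"
    by (rule eventually_sequentiallyI)
  moreover have "(\<lambda>n. y n / (c * c)) \<longlonglongrightarrow> 0"
    using tendsto_divide[OF y(1) tendsto_const, of "c * c"] c by simp
  ultimately have "(\<lambda>n. avg2 n (delta i) (delta j)) \<longlonglongrightarrow> ellf s (delta i) (delta j)"
    by (rule Lim_null[THEN iffD2, OF Lim_null_comparison])
  then show ?thesis
    using assms by (simp add: avg2_def state_def ellf_def lin_delta bil_delta)
qed

end

section \<open>The BAR(p) process\<close>

lemma integrable_square_add:
  fixes f g :: "'a \<Rightarrow> real"
  assumes [measurable]: "f \<in> borel_measurable M" "g \<in> borel_measurable M"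
    and "integrable M (\<lambda>x. (f x)\<^sup>2)" "integrable M (\<lambda>x. (g x)\<^sup>2)"
  shows "integrable M (\<lambda>x. (f x + g x)\<^sup>2)"
proof -
  have "integrable M (\<lambda>x. (f x)\<^sup>2 + (g x)\<^sup>2 + 2 * (f x * g x))"
    using assms integrable_mult_of_squares[OF assms] by (intro Bochner_Integration.integrable_add integrable_mult_right)
  then show ?thesis by (simp add: power2_sum mult.assoc)
qed

lemma integrable_square_cmult:
  fixes f :: "'a \<Rightarrow> real"
  assumes "integrable M (\<lambda>x. (f x)\<^sup>2)" shows "integrable M (\<lambda>x. (t * f x)\<^sup>2)"
  using assms by (simp add: power_mult_distrib)

lemma integrable_square_sum:
  fixes f :: "'i \<Rightarrow> 'a \<Rightarrow> real"
  assumes "finite I" "\<And>i. i \<in> I \<Longrightarrow> f i \<in> borel_measurable M"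
    "\<And>i. i \<in> I \<Longrightarrow> integrable M (\<lambda>x. (f i x)\<^sup>2)"
  shows "integrable M (\<lambda>x. (\<Sum>i\<in>I. f i x)\<^sup>2)"
  using assms
proof (induction I rule: finite_induct)
  case (insert i I)
  then have "integrable M (\<lambda>x. (f i x + (\<Sum>i\<in>I. f i x))\<^sup>2)"
    by (intro integrable_square_add borel_measurable_sum) auto
  then show ?case using insert by simp
qed simp

text \<open>Convexity of the square at \<beta> u + (1 - \<beta>) (t / (1 - \<beta>)). The
  coefficient of u^2 stays below 1, so the estimate can be iterated over generations.\<close>

lemma square_add_le_convex:
  fixes \<beta> u t :: real
  assumes "0 < \<beta>" "\<beta> < 1" shows "(\<beta> * u + t)\<^sup>2 \<le> \<beta> * u\<^sup>2 + t\<^sup>2 / (1 - \<beta>)"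
proof -
  have "0 \<le> \<beta> * ((1 - \<beta>) * u - t)\<^sup>2" using assms by simp
  also have "\<dots> = (1 - \<beta>) * (\<beta> * u\<^sup>2) + t\<^sup>2 - (1 - \<beta>) * (\<beta> * u + t)\<^sup>2"
    by (simp add: power2_eq_square algebra_simps)
  finally have "(\<beta> * u + t)\<^sup>2 * (1 - \<beta>) \<le> (1 - \<beta>) * (\<beta> * u\<^sup>2) + t\<^sup>2" by (simp add: mult.commute)
  then have "(\<beta> * u + t)\<^sup>2 \<le> ((1 - \<beta>) * (\<beta> * u\<^sup>2) + t\<^sup>2) / (1 - \<beta>)"
    using assms by (simp add: pos_le_divide_eq)
  then show ?thesis using assms by (simp add: add_divide_distrib)
qed

locale bar_process = prob_space M + dual_ball p a b D \<beta> c C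
  for M :: "'a measure" and p :: nat and a b :: "nat \<Rightarrow> real" and D \<beta> c C +
  fixes X eps :: "nat \<Rightarrow> 'a \<Rightarrow> real" and sigma2 :: real
  assumes X_rv: "n \<ge> 1 \<Longrightarrow> X n \<in> borel_measurable M"
    and eps_rv: "n \<ge> 2 ^ p \<Longrightarrow> eps n \<in> borel_measurable M"
    and even_eq: "n \<ge> 2 ^ (p - 1) \<Longrightarrow> w \<in> space M \<Longrightarrow>
      X (2 * n) w = a 0 + (\<Sum>k = 1..p. a k * X (n div 2 ^ (k - 1)) w) + eps (2 * n) w"
    and odd_eq: "n \<ge> 2 ^ (p - 1) \<Longrightarrow> w \<in> space M \<Longrightarrow>
      X (2 * n + 1) w = b 0 + (\<Sum>k = 1..p. b k * X (n div 2 ^ (k - 1)) w) + eps (2 * n + 1) w"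
    and init: "k \<in> {1..2 ^ p - 1} \<Longrightarrow> integrable M (\<lambda>w. X k w ^ 8)"
    and i_L2: "n \<ge> p - 1 \<Longrightarrow> k \<in> gen (n + 1) \<Longrightarrow> integrable M (\<lambda>w. (eps k w)\<^sup>2)"
    and i_mean: "n \<ge> p - 1 \<Longrightarrow> k \<in> gen (n + 1) \<Longrightarrow>
      AE w in M. real_cond_exp M (tree_filtration M X n) (eps k) w = 0"
    and i_var: "n \<ge> p - 1 \<Longrightarrow> k \<in> gen (n + 1) \<Longrightarrow>
      AE w in M. real_cond_exp M (tree_filtration M X n) (\<lambda>w. (eps k w)\<^sup>2) w = sigma2"
    and ii_indep: "n \<ge> p - 1 \<Longrightarrow> k \<in> gen (n + 1) \<Longrightarrow> l \<in> gen (n + 1) \<Longrightarrow>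
      k \<noteq> l \<Longrightarrow> k div 2 \<noteq> l div 2 \<Longrightarrow>
      cond_indep_var M (tree_filtration M X n) (eps k) (eps l)"
    and iii_L4: "n \<ge> p - 1 \<Longrightarrow> k \<in> gen (n + 1) \<Longrightarrow> integrable M (\<lambda>w. eps k w ^ 4)"
    and iii_sup: "AE w in M.
      (SUP n\<in>{p - 1..}. SUP k\<in>gen (n + 1).
         ereal (real_cond_exp M (tree_filtration M X n) (\<lambda>w. eps k w ^ 4) w)) < \<infinity>"
begin

abbreviation "F \<equiv> tree_filtration M X"

lemma space_F [simp]: "space (F n) = space M"
  by (simp add: tree_filtration_def space_measure_of_conv)

lemma sets_F: "sets (F n) = sigma_sets (space M) {X k -` E \<inter> space M | k E. k \<in> tree n \<and> E \<in> sets borel}"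
  unfolding tree_filtration_def by (intro sets_measure_of) auto

lemma subalgebra_F: "finite_measure_subalgebra M (F n)"
proof -
  have "{X k -` E \<inter> space M | k E. k \<in> tree n \<and> E \<in> sets borel} \<subseteq> sets M"
    using measurable_sets[OF X_rv] by (auto simp: mem_tree_iff)
  then have "subalgebra M (F n)"
    unfolding subalgebra_def sets_F by (auto dest: sets.sigma_sets_subset)
  then show ?thesis
    by (simp add: finite_measure_subalgebra_def finite_measure_subalgebra_axioms_def finite_measure_axioms)
qed

lemma X_measurable_F: "k \<in> tree n \<Longrightarrow> X k \<in> borel_measurable (F n)"
  by (intro measurableI) (auto simp: sets_F)

lemma child:
  assumes "n \<ge> p - 1" "k \<in> gen n" "j < 2"
  shows child_gen: "2 * k + j \<in> gen (n + 1)" and eps_child_measurable: "eps (2 * k + j) \<in> borel_measurable M"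
proof -
  show g: "2 * k + j \<in> gen (n + 1)" using children_in_gen[OF assms(2,3)] by simp
  have "2 ^ p \<le> 2 * k + j" using gen_ge[OF _ g, of p] assms(1) by simp
  then show "eps (2 * k + j) \<in> borel_measurable M" by (rule eps_rv)
qed

text \<open>The parity of a child selects its parameters, which lets both recursions be treated at
  once.\<close>

definition "coef j = (if j = 0 then a else b)"

lemma X_child:
  assumes "n \<ge> 2 ^ (p - 1)" "w \<in> space M" "j < 2"
  shows "X (2 * n + j) w =
    coef j 0 + (\<Sum>k = 1..p. coef j k * X (n div 2 ^ (k - 1)) w) + eps (2 * n + j) w"
proof (cases "j = 0")
  case False
  then have "j = 1" using assms(3) by simp
  then show ?thesis using odd_eq[OF assms(1,2)] by (simp add: coef_def)
qed (use even_eq[OF assms(1,2)] in \<open>simp add: coef_def\<close>)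

lemma generation:
  assumes "k \<ge> 2 ^ (p - 1)" obtains n where "n \<ge> p - 1" "k \<in> gen n"
proof -
  have "k > 0" using assms by (meson less_le_trans zero_less_numeral zero_less_power)
  define n where "n = floor_log k"
  have n: "2 ^ n \<le> k" "k < 2 ^ Suc n"
    using \<open>k > 0\<close> floor_log_exp2_le[of k] floor_log_exp2_gt[of k] by (auto simp: n_def)
  then have "(2::nat) ^ (p - 1) < 2 ^ Suc n" using assms by linarith
  then have "p - 1 < Suc n" by (rule power_less_imp_less_exp[rotated]) simp
  then have "p - 1 \<le> n" by (simp only: less_Suc_eq_le)
  then show ?thesis using n that by (simp add: gen_eq)
qed

section \<open>Second moments of the process\<close>

text \<open>Strong induction along the tree: the initial states are controlled by their eighth
  moments, later ones through the recursion by ancestors with smaller index.\<close>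

lemma integrable_X_square: "k \<ge> 1 \<Longrightarrow> integrable M (\<lambda>w. (X k w)\<^sup>2)"
proof (induction k rule: less_induct)
  case (less k)
  note [measurable] = X_rv[OF less.prems]
  show ?case
  proof (cases "k < 2 ^ p")
    case True
    then have "integrable M (\<lambda>w. 1 + X k w ^ 8)"
      using init[of k] less.prems by (intro Bochner_Integration.integrable_add) auto
    moreover have "y\<^sup>2 \<le> 1 + y ^ 8" for y :: real
    proof -
      \<comment> \<open>These squares add up to 2 y^8 - y^4 - 2 y^2 + 2, and dropping y^4 leaves
        twice the claim.\<close>
      have "0 \<le> (y ^ 4 - 1)\<^sup>2 + (y\<^sup>2 - 1)\<^sup>2 + y ^ 4 * y ^ 4" by simp
      also have "\<dots> = y ^ 8 - 2 * y ^ 4 + 1 + (y ^ 4 - 2 * y\<^sup>2 + 1) + y ^ 8"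
        by (simp add: power2_diff flip: power_add power_mult)
      finally have "y ^ 4 + 2 * y\<^sup>2 \<le> 2 + 2 * y ^ 8" by simp
      moreover have "0 \<le> y ^ 4" by simp
      ultimately show ?thesis by linarith
    qed
    ultimately show ?thesis
      by (elim Bochner_Integration.integrable_bound) (auto intro!: AE_I2 order_trans[OF _ abs_ge_self])
  next
    case False
    define n j where "n = k div 2" and "j = k mod 2"
    have k: "k = 2 * n + j" and j: "j < 2" by (simp_all add: n_def j_def)
    \<comment> \<open>Beyond the initial states, k \<ge> 2^p, the parent n is at least 2^(p-1),
      where the recursion starts.\<close>
    have "2 * 2 ^ (p - 1) \<le> k" using False p by (cases p) auto
    then have n: "n \<ge> 2 ^ (p - 1)" using k j by linarith
    then obtain g where g: "g \<ge> p - 1" "n \<in> gen g" by (rule generation)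
    have anc: "1 \<le> n div 2 ^ (i - 1)" "n div 2 ^ (i - 1) < k" if "i \<in> {1..p}" for i
    proof -
      have "n div 2 ^ (i - 1) \<in> tree g" using that g by (intro ancestor_in_tree) auto
      then show "1 \<le> n div 2 ^ (i - 1)" by (simp add: mem_tree_iff)
      have "n div 2 ^ (i - 1) \<le> n" by simp
      also have "n < k" using k n less.prems by (cases "n = 0") auto
      finally show "n div 2 ^ (i - 1) < k" .
    qed
    note [measurable] = eps_child_measurable[OF g j]
    have "integrable M (\<lambda>w. (coef j 0 + (\<Sum>i = 1..p. coef j i * X (n div 2 ^ (i - 1)) w) + eps (2 * n + j) w)\<^sup>2)"
      using anc
      by (intro integrable_square_add integrable_square_sum integrable_square_cmult less.IH
          i_L2[OF g(1) child_gen[OF g j]] borel_measurable_add borel_measurable_sum borel_measurable_times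
          borel_measurable_const X_rv eps_child_measurable[OF g j]) auto
    then show ?thesis
      by (rule Bochner_Integration.integrable_cong[THEN iffD1, OF refl, rotated])
        (simp add: k X_child[OF n _ j])
  qed
qed

definition "state \<phi> k w = lin p (\<lambda>i. X (k div 2 ^ i) w) \<phi>"

lemma coef_D: "\<phi> \<in> D \<Longrightarrow> (\<lambda>i. adj p (coef j) \<phi> i / \<beta>) \<in> D"
  using D_a D_b by (simp add: coef_def)

text \<open>The parent is tested with an element of \<open>D\<close> again, and the contraction
  factor stands explicitly in front.\<close>

lemma state_child:
  assumes "k \<ge> 2 ^ (p - 1)" "w \<in> space M" "j < 2"
  shows "state \<phi> (2 * k + j) w =
    \<beta> * state (\<lambda>i. adj p (coef j) \<phi> i / \<beta>) k w + \<phi> 0 * (coef j 0 + eps (2 * k + j) w)"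
proof -
  have "state \<phi> (2 * k + j) w = lin p (\<lambda>i. X (k div 2 ^ i) w) (adj p (coef j) \<phi>) +
      \<phi> 0 * (coef j 0 + eps (2 * k + j) w)"
    unfolding state_def using p X_child[OF assms] assms(3)
    by (intro lin_companion_step) (auto simp: div_mult2_eq)
  moreover have "adj p (coef j) \<phi> = (\<lambda>i. \<beta> * (adj p (coef j) \<phi> i / \<beta>))" using \<beta> by simp
  ultimately show ?thesis unfolding state_def by (metis lin_scale)
qed

lemma ancestor_ge_1:
  fixes k :: nat
  assumes "k \<ge> 2 ^ (p - 1)" "i < p" shows "1 \<le> k div 2 ^ i"
proof -
  obtain n where "n \<ge> p - 1" "k \<in> gen n" using assms(1) by (rule generation)
  then have "k div 2 ^ i \<in> tree n" using assms(2) by (intro ancestor_in_tree) auto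
  then show ?thesis by (simp add: mem_tree_iff)
qed

lemma integrable_state_square:
  assumes "k \<ge> 2 ^ (p - 1)" shows "integrable M (\<lambda>w. (state \<phi> k w)\<^sup>2)"
  unfolding state_def lin_def using ancestor_ge_1[OF assms]
  by (intro integrable_square_sum integrable_square_cmult integrable_X_square borel_measurable_times
      borel_measurable_const X_rv) auto

lemma integral_eps_square:
  assumes "n \<ge> p - 1" "k \<in> gen (n + 1)" shows "(\<integral>w. (eps k w)\<^sup>2 \<partial>M) = sigma2"
proof -
  interpret finite_measure_subalgebra M "F n" by (rule subalgebra_F)
  have "(\<integral>w. (eps k w)\<^sup>2 \<partial>M) = (\<integral>w. real_cond_exp M (F n) (\<lambda>w. (eps k w)\<^sup>2) w \<partial>M)"
    using i_L2[OF assms] by (rule real_cond_exp_int(2)[symmetric])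
  also have "\<dots> = (\<integral>w. sigma2 \<partial>M)" using i_var[OF assms] by (intro integral_cong_AE) auto
  finally show ?thesis by (simp add: prob_space)
qed

text \<open>A child's moment is at most \<beta> times a parent's moment plus \<open>B\<close>. The
  induction quantifies over all \<phi> in \<open>D\<close>, because the parent is tested with A^t
  \<phi> / \<beta> or B^t \<phi> / \<beta> instead of \<phi>.\<close>

lemma state_second_moment:
  obtains K where "\<And>k \<phi>. k \<ge> 2 ^ (p - 1) \<Longrightarrow> \<phi> \<in> D \<Longrightarrow> (\<integral>w. (state \<phi> k w)\<^sup>2 \<partial>M) \<le> K"
proof -
  define K1 where "K1 = (\<Sum>k\<in>{1..<2 ^ p}. \<integral>w. (X k w)\<^sup>2 \<partial>M)"
  \<comment> \<open>Bounds the contribution of intercept and noise for both parities: C^2 for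
    \<phi>_0^2, the factor 2 from squaring a sum, and 1 / (1 - \<beta>) from
    \<open>square_add_le_convex\<close>.\<close>
  define B where "B = C\<^sup>2 * (2 * ((a 0)\<^sup>2 + (b 0)\<^sup>2 + sigma2)) / (1 - \<beta>)"
  \<comment> \<open>The second entry ensures \<beta> K + B \<le> K; the first covers the k below
    2^p.\<close>
  define K where "K = max (C\<^sup>2 * (p * (p * K1))) (B / (1 - \<beta>))"
  have "(\<integral>w. (state \<phi> k w)\<^sup>2 \<partial>M) \<le> K" if "k \<ge> 2 ^ (p - 1)" "\<phi> \<in> D" for k \<phi>
    using that
  proof (induction k arbitrary: \<phi> rule: less_induct)
    case (less k)
    show ?case
    proof (cases "k < 2 ^ p")
      case True
      have anc: "k div 2 ^ i \<in> {1..<2 ^ p}" if "i < p" for i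
        using ancestor_ge_1[OF less.prems(1) that] True by (auto intro: le_less_trans[OF div_le_dividend])
      have sq: "integrable M (\<lambda>w. (X (k div 2 ^ i) w)\<^sup>2)" if "i < p" for i
        using anc[OF that] by (intro integrable_X_square) auto
      have "(\<integral>w. (state \<phi> k w)\<^sup>2 \<partial>M) \<le> (\<integral>w. C\<^sup>2 * (p * (\<Sum>i<p. (X (k div 2 ^ i) w)\<^sup>2)) \<partial>M)"
      proof (rule integral_mono)
        show "integrable M (\<lambda>w. (state \<phi> k w)\<^sup>2)" by (rule integrable_state_square[OF less.prems(1)])
        show "integrable M (\<lambda>w. C\<^sup>2 * (p * (\<Sum>i<p. (X (k div 2 ^ i) w)\<^sup>2)))"
          using sq by (intro integrable_mult_right Bochner_Integration.integrable_sum) auto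
        fix w
        have "(state \<phi> k w)\<^sup>2 \<le> (C * (\<Sum>i<p. \<bar>X (k div 2 ^ i) w\<bar>))\<^sup>2"
          unfolding state_def using D_bound[OF less.prems(2)]
          by (intro power2_le_iff_abs_le[THEN iffD2] order_trans[OF lin_bound])
            (auto intro!: mult_nonneg_nonneg sum_nonneg less_imp_le[OF C_pos])
        also have "\<dots> \<le> C\<^sup>2 * (p * (\<Sum>i<p. (X (k div 2 ^ i) w)\<^sup>2))"
          unfolding power_mult_distrib
          using sum_squared_le_sum_of_squares[of "\<lambda>i. \<bar>X (k div 2 ^ i) w\<bar>" "{..<p}"]
          by (intro mult_left_mono) (auto simp: mult.commute)
        finally show "(state \<phi> k w)\<^sup>2 \<le> C\<^sup>2 * (p * (\<Sum>i<p. (X (k div 2 ^ i) w)\<^sup>2))" .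
      qed
      also have "\<dots> = C\<^sup>2 * (p * (\<Sum>i<p. \<integral>w. (X (k div 2 ^ i) w)\<^sup>2 \<partial>M))"
        using sq by simp
      also have "\<dots> \<le> C\<^sup>2 * (p * (\<Sum>i<p. K1))"
        unfolding K1_def using anc
        by (intro mult_left_mono sum_mono member_le_sum[of "k div 2 ^ _"]) auto
      also have "\<dots> \<le> K" by (simp add: K_def)
      finally show ?thesis .
    next
      case False
      define n j where "n = k div 2" and "j = k mod 2"
      have k: "k = 2 * n + j" and j: "j < 2" by (simp_all add: n_def j_def)
      have "2 * 2 ^ (p - 1) \<le> k" using False p by (cases p) auto
      then have n: "n \<ge> 2 ^ (p - 1)" using k j by linarith
      then have "n < k" using k by (cases "n = 0") auto
      obtain g where g: "g \<ge> p - 1" "n \<in> gen g" using n by (rule generation)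
      note [measurable] = eps_child_measurable[OF g j]
      note eps2 = i_L2[OF g(1) child_gen[OF g j]]
      define \<psi> where "\<psi> = (\<lambda>i. adj p (coef j) \<phi> i / \<beta>)"
      have \<psi>: "\<psi> \<in> D" unfolding \<psi>_def by (rule coef_D[OF less.prems(2)])
      let ?R = "\<lambda>w. C\<^sup>2 * (2 * ((coef j 0)\<^sup>2 + (eps k w)\<^sup>2)) / (1 - \<beta>)"
      have intR: "integrable M ?R" using eps2 unfolding k by auto
      have "(\<integral>w. (state \<phi> k w)\<^sup>2 \<partial>M) \<le> (\<integral>w. \<beta> * (state \<psi> n w)\<^sup>2 + ?R w \<partial>M)"
      proof (rule integral_mono)
        show "integrable M (\<lambda>w. (state \<phi> k w)\<^sup>2)" by (rule integrable_state_square[OF less.prems(1)])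
        show "integrable M (\<lambda>w. \<beta> * (state \<psi> n w)\<^sup>2 + ?R w)"
          using integrable_state_square[OF n] intR by (intro Bochner_Integration.integrable_add integrable_mult_right)
        fix w assume w: "w \<in> space M"
        have "(state \<phi> k w)\<^sup>2 \<le> \<beta> * (state \<psi> n w)\<^sup>2 + (\<phi> 0 * (coef j 0 + eps k w))\<^sup>2 / (1 - \<beta>)"
          unfolding k state_child[OF n w j] \<psi>_def by (rule square_add_le_convex[OF \<beta>])
        also have "(\<phi> 0 * (coef j 0 + eps k w))\<^sup>2 / (1 - \<beta>) \<le> ?R w"
        proof (intro divide_right_mono)
          have "(\<phi> 0)\<^sup>2 \<le> C\<^sup>2"
            using D_bound[OF less.prems(2), of 0] p C_pos by (intro power2_le_iff_abs_le[THEN iffD2]) auto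
          moreover have "(coef j 0 + eps k w)\<^sup>2 \<le> 2 * ((coef j 0)\<^sup>2 + (eps k w)\<^sup>2)"
            using sum_squares_bound[of "coef j 0" "eps k w"] by (simp add: power2_sum)
          ultimately show "(\<phi> 0 * (coef j 0 + eps k w))\<^sup>2 \<le> C\<^sup>2 * (2 * ((coef j 0)\<^sup>2 + (eps k w)\<^sup>2))"
            unfolding power_mult_distrib by (intro mult_mono) auto
        qed (use \<beta> in simp)
        finally show "(state \<phi> k w)\<^sup>2 \<le> \<beta> * (state \<psi> n w)\<^sup>2 + ?R w" by simp
      qed
      also have "\<dots> = \<beta> * (\<integral>w. (state \<psi> n w)\<^sup>2 \<partial>M) + C\<^sup>2 * (2 * ((coef j 0)\<^sup>2 + sigma2)) / (1 - \<beta>)"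
        using integrable_state_square[OF n] intR eps2 integral_eps_square[OF g(1) child_gen[OF g j]]
        by (simp add: k prob_space)
      also have "\<dots> \<le> \<beta> * K + B"
      proof (intro add_mono mult_left_mono)
        show "(\<integral>w. (state \<psi> n w)\<^sup>2 \<partial>M) \<le> K" using \<open>n < k\<close> n \<psi> by (rule less.IH)
        show "C\<^sup>2 * (2 * ((coef j 0)\<^sup>2 + sigma2)) / (1 - \<beta>) \<le> B"
          unfolding B_def using \<beta> by (intro divide_right_mono mult_left_mono) (auto simp: coef_def)
      qed (use \<beta> in simp)
      also have "\<dots> \<le> K"
      proof -
        have "B / (1 - \<beta>) \<le> K" by (simp add: K_def)
        then have "B \<le> K * (1 - \<beta>)" using \<beta> by (simp add: pos_divide_le_eq)
        then show ?thesis by (simp add: algebra_simps)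
      qed
      finally show ?thesis .
    qed
  qed
  then show ?thesis by (rule that)
qed

text \<open>Test the state with \<open>c * delta 0\<close>, an element of \<open>D\<close>; the
  initial indices are covered by a finite sum.\<close>

lemma X_second_moment:
  obtains K where "\<And>k. k \<ge> 1 \<Longrightarrow> (\<integral>w. (X k w)\<^sup>2 \<partial>M) \<le> K"
proof -
  obtain K where K: "\<And>k \<phi>. k \<ge> 2 ^ (p - 1) \<Longrightarrow> \<phi> \<in> D \<Longrightarrow> (\<integral>w. (state \<phi> k w)\<^sup>2 \<partial>M) \<le> K"
    using state_second_moment by blast
  define K1 where "K1 = (\<Sum>k\<in>{1..<2 ^ p}. \<integral>w. (X k w)\<^sup>2 \<partial>M)"
  have "(\<integral>w. (X k w)\<^sup>2 \<partial>M) \<le> max (K / c\<^sup>2) K1" if "k \<ge> 1" for k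
  proof (cases "k < 2 ^ p")
    case True
    then have "(\<integral>w. (X k w)\<^sup>2 \<partial>M) \<le> K1"
      unfolding K1_def using that by (intro member_le_sum) auto
    then show ?thesis by simp
  next
    case False
    have "(2::nat) ^ (p - 1) \<le> 2 ^ p" by (intro power_increasing) auto
    then have k: "2 ^ (p - 1) \<le> k" using False by linarith
    have "state (\<lambda>i. c * delta 0 i) k w = c * X k w" for w
      using p by (simp add: state_def lin_scale lin_delta)
    then have "c\<^sup>2 * (\<integral>w. (X k w)\<^sup>2 \<partial>M) \<le> K"
      using K[OF k c_delta_in_D[of 0]] by (simp add: power_mult_distrib)
    then have "(\<integral>w. (X k w)\<^sup>2 \<partial>M) \<le> K / c\<^sup>2" using c by (simp add: pos_le_divide_eq mult.commute)
    then show ?thesis by simp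
  qed
  then show ?thesis by (rule that)
qed

section \<open>Almost sure limits of the noise averages\<close>

text \<open>The common form of three limits: weight 1 or an ancestor's value with f the identity,
  and a truncation with f the centred square. The F_n-measurable weights can be pulled out, so
  orthogonality of two terms reduces to that of f at conditionally independent noises.\<close>

lemma noise_average_tendsto_0:
  assumes j: "j < 2" and f [measurable]: "f \<in> borel_measurable borel"
    and f2: "\<And>n k. n \<ge> p - 1 \<Longrightarrow> k \<in> gen n \<Longrightarrow> integrable M (\<lambda>w. (f (eps (2 * k + j) w))\<^sup>2)"
    and f0: "\<And>n k. n \<ge> p - 1 \<Longrightarrow> k \<in> gen n \<Longrightarrow>
      AE w in M. real_cond_exp M (F n) (\<lambda>w. f (eps (2 * k + j) w)) w = 0"
    and h: "\<And>n k. n \<ge> p - 1 \<Longrightarrow> k \<in> gen n \<Longrightarrow> h n k \<in> borel_measurable (F n)"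
    and H: "\<And>n k. n \<ge> p - 1 \<Longrightarrow> k \<in> gen n \<Longrightarrow> integrable M (H n k)"
    and le: "\<And>n k. n \<ge> p - 1 \<Longrightarrow> k \<in> gen n \<Longrightarrow>
      AE w in M. (h n k w)\<^sup>2 * real_cond_exp M (F n) (\<lambda>w. (f (eps (2 * k + j) w))\<^sup>2) w \<le> H n k w"
    and K: "\<And>n k. n \<ge> p - 1 \<Longrightarrow> k \<in> gen n \<Longrightarrow> (\<integral>w. H n k w \<partial>M) \<le> K"
  shows "AE w in M. (\<lambda>n. (\<Sum>k\<in>gen n. h n k w * f (eps (2 * k + j) w)) / 2 ^ n) \<longlonglongrightarrow> 0"
proof (rule AE_generation_average_tendsto_0[where ?n0.0 = "p - 1" and K = K])
  show "finite (gen n)" "card (gen n) = 2 ^ n" for n by (simp_all add: card_gen)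
next
  fix n k assume nk: "n \<ge> p - 1" "k \<in> gen n"
  interpret finite_measure_subalgebra M "F n" by (rule subalgebra_F)
  note [measurable] = eps_child_measurable[OF nk j] measurable_from_subalg[OF subalg h[OF nk]]
  show "(\<lambda>w. h n k w * f (eps (2 * k + j) w)) \<in> borel_measurable M" by measurable
  have V: "(\<lambda>w. f (eps (2 * k + j) w)) \<in> borel_measurable M" by measurable
  note w = weighted_square_integrable[OF h[OF nk] V f2[OF nk] H[OF nk] le[OF nk]]
  show "integrable M (\<lambda>w. (h n k w * f (eps (2 * k + j) w))\<^sup>2)" by (rule w(1))
  show "(\<integral>w. (h n k w * f (eps (2 * k + j) w))\<^sup>2 \<partial>M) \<le> K" using w(2) K[OF nk] by simp
  fix l assume l: "l \<in> gen n" and kl: "k \<noteq> l"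
  note nl = nk(1) l
  note [measurable] = eps_child_measurable[OF nl j] measurable_from_subalg[OF subalg h[OF nl]]
  have V': "(\<lambda>w. f (eps (2 * l + j) w)) \<in> borel_measurable M" by measurable
  note w' = weighted_square_integrable[OF h[OF nl] V' f2[OF nl] H[OF nl] le[OF nl]]
  have "cond_indep_var M (F n) (eps (2 * k + j)) (eps (2 * l + j))"
    \<comment> \<open>The parents of 2k + j and 2l + j are k and l, so a common parity j and
      different k, l mean different parents.\<close>
    using kl j by (intro ii_indep nk child_gen l) auto
  then have "AE w in M. real_cond_exp M (F n) (\<lambda>w. f (eps (2 * k + j) w) * f (eps (2 * l + j) w)) w = 0"
    by (rule cond_indep_var_orthogonal[OF cond_indep_var_compose[OF _ f f] V V' f2[OF nk] f2[OF nl] f0[OF nk]])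
  then have 0: "AE w in M. (h n k w * h n l w) *
      real_cond_exp M (F n) (\<lambda>w. f (eps (2 * k + j) w) * f (eps (2 * l + j) w)) w = 0"
    by eventually_elim simp
  have hh: "(\<lambda>w. h n k w * h n l w) \<in> borel_measurable (F n)"
    using h[OF nk] h[OF nl] by (rule borel_measurable_times)
  have "integrable M (\<lambda>w. (h n k w * f (eps (2 * k + j) w)) * (h n l w * f (eps (2 * l + j) w)))"
    using w(1) w'(1) by (intro integrable_mult_of_squares) measurable
  then have "integrable M (\<lambda>w. (h n k w * h n l w) * (f (eps (2 * k + j) w) * f (eps (2 * l + j) w)))"
    by (simp add: mult_ac)
  from real_cond_exp_intg(2)[OF this hh]
  have "(\<integral>w. (h n k w * h n l w) * (f (eps (2 * k + j) w) * f (eps (2 * l + j) w)) \<partial>M) =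
    (\<integral>w. (h n k w * h n l w) * real_cond_exp M (F n) (\<lambda>w. f (eps (2 * k + j) w) * f (eps (2 * l + j) w)) w \<partial>M)"
    by simp
  also have "\<dots> = (\<integral>w. 0 \<partial>M)" by (rule integral_cong_AE) (use 0 in auto)
  finally show "(\<integral>w. (h n k w * f (eps (2 * k + j) w)) * (h n l w * f (eps (2 * l + j) w)) \<partial>M) = 0"
    by (simp add: mult_ac)
qed

lemma noise_tendsto_0:
  assumes j: "j < 2"
  shows "AE w in M. (\<lambda>n. (\<Sum>k\<in>gen n. eps (2 * k + j) w) / 2 ^ n) \<longlonglongrightarrow> 0"
proof -
  have "AE w in M. (\<lambda>n. (\<Sum>k\<in>gen n. 1 * eps (2 * k + j) w) / 2 ^ n) \<longlonglongrightarrow> 0"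
  proof (rule noise_average_tendsto_0[OF j, where f = "\<lambda>x. x" and H = "\<lambda>_ _ _. sigma2" and K = sigma2])
    fix n k assume nk: "n \<ge> p - 1" "k \<in> gen n"
    note g = nk(1) child_gen[OF nk j]
    show "integrable M (\<lambda>w. (eps (2 * k + j) w)\<^sup>2)" by (rule i_L2[OF g])
    show "AE w in M. real_cond_exp M (F n) (eps (2 * k + j)) w = 0" by (rule i_mean[OF g])
    show "AE w in M. 1\<^sup>2 * real_cond_exp M (F n) (\<lambda>w. (eps (2 * k + j) w)\<^sup>2) w \<le> sigma2"
      using i_var[OF g] by eventually_elim simp
  qed (auto simp: prob_space)
  then show ?thesis by simp
qed

text \<open>The weight is an ancestor of k of order i \<le> p - 1 \<le> n; it therefore still
  belongs to the tree and is F_n-measurable.\<close>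

lemma noise_state_tendsto_0:
  assumes j: "j < 2" and i: "i < p"
  shows "AE w in M. (\<lambda>n. (\<Sum>k\<in>gen n. eps (2 * k + j) w * X (k div 2 ^ i) w) / 2 ^ n) \<longlonglongrightarrow> 0"
proof -
  obtain K where K: "\<And>k. k \<ge> 1 \<Longrightarrow> (\<integral>w. (X k w)\<^sup>2 \<partial>M) \<le> K" using X_second_moment by blast
  have anc: "k div 2 ^ i \<in> tree n" "1 \<le> k div 2 ^ i" if "n \<ge> p - 1" "k \<in> gen n" for n k
    using ancestor_in_tree[OF that(2), of i] that i by (auto simp: mem_tree_iff)
  have "AE w in M. (\<lambda>n. (\<Sum>k\<in>gen n. X (k div 2 ^ i) w * eps (2 * k + j) w) / 2 ^ n) \<longlonglongrightarrow> 0"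
  proof (rule noise_average_tendsto_0[OF j, where f = "\<lambda>x. x" and K = "\<bar>sigma2\<bar> * K" and
        H = "\<lambda>n k w. \<bar>sigma2\<bar> * (X (k div 2 ^ i) w)\<^sup>2"])
    fix n k assume nk: "n \<ge> p - 1" "k \<in> gen n"
    note g = nk(1) child_gen[OF nk j]
    show "integrable M (\<lambda>w. (eps (2 * k + j) w)\<^sup>2)" by (rule i_L2[OF g])
    show "AE w in M. real_cond_exp M (F n) (eps (2 * k + j)) w = 0" by (rule i_mean[OF g])
    show "X (k div 2 ^ i) \<in> borel_measurable (F n)" by (rule X_measurable_F[OF anc(1)[OF nk]])
    show "AE w in M. (X (k div 2 ^ i) w)\<^sup>2 * real_cond_exp M (F n) (\<lambda>w. (eps (2 * k + j) w)\<^sup>2) w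
        \<le> \<bar>sigma2\<bar> * (X (k div 2 ^ i) w)\<^sup>2"
      using i_var[OF g] by eventually_elim (simp add: mult.commute mult_right_mono)
    show "integrable M (\<lambda>w. \<bar>sigma2\<bar> * (X (k div 2 ^ i) w)\<^sup>2)"
      using integrable_X_square[OF anc(2)[OF nk]] by simp
    show "(\<integral>w. \<bar>sigma2\<bar> * (X (k div 2 ^ i) w)\<^sup>2 \<partial>M) \<le> \<bar>sigma2\<bar> * K"
      using K[OF anc(2)[OF nk]] by (simp add: mult_left_mono)
  qed auto
  then show ?thesis by (simp add: mult.commute)
qed

text \<open>The truncated averages tend to 0 for all natural m simultaneously, almost surely. On a
  path where the conditional fourth moments are bounded, a suitable m makes every truncation factor
  from generation p - 1 on equal to 1.\<close>

lemma noise_square_tendsto_0: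
  assumes j: "j < 2"
  shows "AE w in M. (\<lambda>n. (\<Sum>k\<in>gen n. (eps (2 * k + j) w)\<^sup>2 - sigma2) / 2 ^ n) \<longlonglongrightarrow> 0"
proof -
  let ?f = "\<lambda>x::real. x\<^sup>2 - sigma2"
  define q where "q n k = real_cond_exp M (F n) (\<lambda>w. (?f (eps (2 * k + j) w))\<^sup>2)" for n k
  define h where "h m n k = indicat_real {w \<in> space M. q n k w \<le> real m}" for m n k
  have f2_eq: "(?f x)\<^sup>2 = x ^ 4 - 2 * sigma2 * x\<^sup>2 + sigma2\<^sup>2" for x
    by (simp add: power2_diff flip: power_mult)
  have f2: "integrable M (\<lambda>w. (?f (eps (2 * k + j) w))\<^sup>2)" if nk: "n \<ge> p - 1" "k \<in> gen n" for n k
    unfolding f2_eq using i_L2[OF nk(1) child_gen[OF nk j]] iii_L4[OF nk(1) child_gen[OF nk j]]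
    by (intro Bochner_Integration.integrable_add Bochner_Integration.integrable_diff integrable_mult_right) auto
  have q_le: "AE w in M. q n k w \<le> 2 * real_cond_exp M (F n) (\<lambda>w. eps (2 * k + j) w ^ 4) w + 2 * sigma2\<^sup>2"
    if nk: "n \<ge> p - 1" "k \<in> gen n" for n k
  proof -
    interpret finite_measure_subalgebra M "F n" by (rule subalgebra_F)
    let ?e = "eps (2 * k + j)"
    note i4 = iii_L4[OF nk(1) child_gen[OF nk j]]
    have "(?f x)\<^sup>2 \<le> 2 * x ^ 4 + 2 * sigma2\<^sup>2" for x
    proof -
      \<comment> \<open>The squares of x^2 - sigma2 and x^2 + sigma2 add up to the bound, so
        discarding the second proves it.\<close>
      have "0 \<le> (x\<^sup>2 + sigma2)\<^sup>2" by simp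
      then show ?thesis unfolding f2_eq by (simp add: power2_sum algebra_simps flip: power_mult)
    qed
    then have "AE w in M. q n k w \<le> real_cond_exp M (F n) (\<lambda>w. 2 * ?e w ^ 4 + 2 * sigma2\<^sup>2) w"
      unfolding q_def using f2[OF nk] i4 by (intro real_cond_exp_mono) auto
    moreover have "AE w in M. real_cond_exp M (F n) (\<lambda>w. 2 * ?e w ^ 4 + 2 * sigma2\<^sup>2) w =
        real_cond_exp M (F n) (\<lambda>w. 2 * ?e w ^ 4) w + real_cond_exp M (F n) (\<lambda>w. 2 * sigma2\<^sup>2) w"
      using i4 by (intro real_cond_exp_add) auto
    moreover have "AE w in M. real_cond_exp M (F n) (\<lambda>w. 2 * ?e w ^ 4) w =
        2 * real_cond_exp M (F n) (\<lambda>w. ?e w ^ 4) w"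
      using i4 by (rule real_cond_exp_cmult)
    moreover have "AE w in M. real_cond_exp M (F n) (\<lambda>w. 2 * sigma2\<^sup>2) w = 2 * sigma2\<^sup>2"
      by (rule real_cond_exp_F_meas) auto
    ultimately show ?thesis by eventually_elim simp
  qed
  have trunc: "AE w in M. (\<lambda>n. (\<Sum>k\<in>gen n. h m n k w * ?f (eps (2 * k + j) w)) / 2 ^ n) \<longlonglongrightarrow> 0" for m
  proof (rule noise_average_tendsto_0[OF j, where K = "real m" and H = "\<lambda>_ _ _. real m"])
    fix n k assume nk: "n \<ge> p - 1" "k \<in> gen n"
    interpret finite_measure_subalgebra M "F n" by (rule subalgebra_F)
    note g = nk(1) child_gen[OF nk j]
    show "integrable M (\<lambda>w. (?f (eps (2 * k + j) w))\<^sup>2)" by (rule f2[OF nk])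
    have "AE w in M. real_cond_exp M (F n) (\<lambda>w. ?f (eps (2 * k + j) w)) w =
        real_cond_exp M (F n) (\<lambda>w. (eps (2 * k + j) w)\<^sup>2) w - real_cond_exp M (F n) (\<lambda>w. sigma2) w"
      using i_L2[OF g] by (intro real_cond_exp_diff) auto
    moreover have "AE w in M. real_cond_exp M (F n) (\<lambda>w. sigma2) w = sigma2"
      by (rule real_cond_exp_F_meas) auto
    ultimately show "AE w in M. real_cond_exp M (F n) (\<lambda>w. ?f (eps (2 * k + j) w)) w = 0"
      using i_var[OF g] by eventually_elim simp
    have "{w \<in> space (F n). q n k w \<le> real m} \<in> sets (F n)"
      unfolding q_def by measurable
    then show "h m n k \<in> borel_measurable (F n)" unfolding h_def by simp
    show "AE w in M. (h m n k w)\<^sup>2 * real_cond_exp M (F n) (\<lambda>w. (?f (eps (2 * k + j) w))\<^sup>2) w \<le> real m"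
      by (intro AE_I2) (auto simp: h_def indicator_def q_def)
  qed (auto simp: prob_space)
  have "AE w in M. \<forall>m. (\<lambda>n. (\<Sum>k\<in>gen n. h m n k w * ?f (eps (2 * k + j) w)) / 2 ^ n) \<longlonglongrightarrow> 0"
    using trunc by (simp add: AE_all_countable)
  moreover have "AE w in M. \<forall>n k. n \<ge> p - 1 \<longrightarrow> k \<in> gen n \<longrightarrow>
      q n k w \<le> 2 * real_cond_exp M (F n) (\<lambda>w. eps (2 * k + j) w ^ 4) w + 2 * sigma2\<^sup>2"
    unfolding AE_all_countable using q_le by (intro allI AE_impI)
  ultimately show ?thesis using iii_sup AE_space
  proof eventually_elim
    case (elim w)
    \<comment> \<open>A path-dependent bound for all conditional fourth moments; m is then taken
      large enough for the bound \<open>q_le\<close> on the conditional second moment of the centred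
      square.\<close>
    obtain C4 :: nat where C4: "(SUP n\<in>{p - 1..}. SUP k\<in>gen (n + 1).
         ereal (real_cond_exp M (F n) (\<lambda>w. eps k w ^ 4) w)) < ereal (real C4)"
      using less_PInf_Ex_of_nat[THEN iffD1, OF less_imp_neq[OF elim(3)]] by (rule exE)
    obtain m :: nat where m: "2 * real C4 + 2 * sigma2\<^sup>2 \<le> real m" using real_arch_simple by blast
    have "h m n k w = 1" if nk: "n \<ge> p - 1" "k \<in> gen n" for n k
    proof -
      have "ereal (real_cond_exp M (F n) (\<lambda>w. eps (2 * k + j) w ^ 4) w) \<le>
        (SUP n\<in>{p - 1..}. SUP k\<in>gen (n + 1). ereal (real_cond_exp M (F n) (\<lambda>w. eps k w ^ 4) w))"
        by (rule SUP_upper2[of n], use nk in simp, rule SUP_upper, rule child_gen[OF nk j])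
      also note C4
      finally have "real_cond_exp M (F n) (\<lambda>w. eps (2 * k + j) w ^ 4) w < real C4" by simp
      moreover have "q n k w \<le> 2 * real_cond_exp M (F n) (\<lambda>w. eps (2 * k + j) w ^ 4) w + 2 * sigma2\<^sup>2"
        using elim(2) nk by blast
      ultimately have "q n k w \<le> real m" using m by linarith
      then show ?thesis using elim(4) by (simp add: h_def)
    qed
    then have "\<forall>\<^sub>F n in sequentially. (\<Sum>k\<in>gen n. h m n k w * ?f (eps (2 * k + j) w)) / 2 ^ n =
        (\<Sum>k\<in>gen n. ?f (eps (2 * k + j) w)) / 2 ^ n"
      by (intro eventually_sequentiallyI[of "p - 1"]) simp
    then show ?case by (rule Lim_transform_eventually[OF spec[OF elim(1)]])
  qed
qed

text \<open>The limits are countably many almost sure statements, so they hold together outside one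
  null set.\<close>

lemma AE_bar_path: "AE w in M. bar_path p a b D \<beta> c C (\<lambda>k. X k w) (\<lambda>k. eps k w) sigma2"
proof -
  have "AE w in M. \<forall>j. j < 2 \<longrightarrow> (\<lambda>n. (\<Sum>k\<in>gen n. eps (2 * k + j) w) / 2 ^ n) \<longlonglongrightarrow> 0"
    unfolding AE_all_countable using noise_tendsto_0 by (intro allI AE_impI)
  moreover have "AE w in M. \<forall>j. j < 2 \<longrightarrow> (\<lambda>n. (\<Sum>k\<in>gen n. (eps (2 * k + j) w)\<^sup>2 - sigma2) / 2 ^ n) \<longlonglongrightarrow> 0"
    unfolding AE_all_countable using noise_square_tendsto_0 by (intro allI AE_impI)
  moreover have "AE w in M. \<forall>j i. j < 2 \<longrightarrow> i < p \<longrightarrow>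
      (\<lambda>n. (\<Sum>k\<in>gen n. eps (2 * k + j) w * X (k div 2 ^ i) w) / 2 ^ n) \<longlonglongrightarrow> 0"
    unfolding AE_all_countable using noise_state_tendsto_0 by (intro allI AE_impI)
  ultimately show ?thesis
    using AE_space
  proof eventually_elim
    case (elim w)
    show ?case
      by (intro bar_path.intro bar_path_axioms.intro dual_ball_axioms even_eq odd_eq)
        (use elim in auto)
  qed
qed

end

section \<open>From generation averages to the matrix limit\<close>

lemma (in bar_path) mat_LIMSEQ_S_mat:
  assumes x: "\<And>k. x k = X k w"
  shows "mat_LIMSEQ (\<lambda>n. (1 / real (card (tree n))) \<cdot>\<^sub>m S_mat p X n w) (L_mat p a b s)"
  unfolding mat_LIMSEQ_def
proof (intro conjI allI impI)
  have dim: "dim_row (L_mat p a b s) = Suc p" "dim_col (L_mat p a b s) = Suc p"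
    using L_mat_carrier[of s] by auto
  show "(1 / real (card (tree n))) \<cdot>\<^sub>m S_mat p X n w \<in>
      carrier_mat (dim_row (L_mat p a b s)) (dim_col (L_mat p a b s))" for n
    by (simp add: dim S_mat_def)
  fix i j assume "i < dim_row (L_mat p a b s)" "j < dim_col (L_mat p a b s)"
  then have ij: "i < Suc p" "j < Suc p" by (simp_all add: dim)
  \<comment> \<open>The leading 1 of Y_k separates the entries into a constant, first-order averages
    and second-order averages, matching the blocks of \<open>L_mat\<close>.\<close>
  define y where "y k i = (case i of 0 \<Rightarrow> 1 | Suc i \<Rightarrow> x (k div 2 ^ i))" for k i
  have Y: "Y_vec p X k w $ i = y k i" if "i < Suc p" for k i
    using that by (cases i) (auto simp: Y_vec_def state_vec_def y_def x)
  have "((1 / real (card (tree n))) \<cdot>\<^sub>m S_mat p X n w) $$ (i, j) =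
      (\<Sum>k\<in>tree_from n (p - 1). y k i * y k j) / real (card (tree n))" for n
  proof -
    have "dim_vec (Y_vec p X k w) = Suc p" for k by (simp add: Y_vec_def state_vec_def)
    then show ?thesis using ij by (simp add: S_mat_def outer_def Y)
  qed
  moreover have "(\<lambda>n. (\<Sum>k\<in>tree_from n (p - 1). y k i * y k j) / real (card (tree n)))
      \<longlonglongrightarrow> L_mat p a b s $$ (i, j)"
  proof (rule tendsto_tree_average)
    show "(\<lambda>n. (\<Sum>k\<in>gen n. y k i * y k j) / 2 ^ n) \<longlonglongrightarrow> L_mat p a b s $$ (i, j)"
      using ij p generation_average_state generation_average_state_product
        L_mat_index(1)[of 0 0 s] L_mat_index(2-)[of "i - 1" "j - 1" s]
        L_mat_index(2)[of 0 "j - 1" s] L_mat_index(3)[of "i - 1" 0 s]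
      by (cases i; cases j) (auto simp: y_def card_gen)
  qed
  ultimately show "(\<lambda>n. ((1 / real (card (tree n))) \<cdot>\<^sub>m S_mat p X n w) $$ (i, j))
      \<longlonglongrightarrow> L_mat p a b s $$ (i, j)" by simp
qed

theorem proposition5p1:
  fixes M :: "'a measure"
    and p :: nat
    and X eps :: "nat \<Rightarrow> 'a \<Rightarrow> real"
    and a b :: "nat \<Rightarrow> real"
    and N :: "real Matrix.vec \<Rightarrow> real"
    and sigma2 rho :: real
  assumes "prob_space M"
    and p: "p \<ge> 1"
    and X_rv: "\<And>n. n \<ge> 1 \<Longrightarrow> X n \<in> borel_measurable M"
    and eps_rv: "\<And>n. n \<ge> 2 ^ p \<Longrightarrow> eps n \<in> borel_measurable M"
    and even_eq: "\<And>n w. n \<ge> 2 ^ (p - 1) \<Longrightarrow> w \<in> space M \<Longrightarrow>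
      X (2 * n) w = a 0 + (\<Sum>k = 1..p. a k * X (n div 2 ^ (k - 1)) w) + eps (2 * n) w"
    and odd_eq: "\<And>n w. n \<ge> 2 ^ (p - 1) \<Longrightarrow> w \<in> space M \<Longrightarrow>
      X (2 * n + 1) w = b 0 + (\<Sum>k = 1..p. b k * X (n div 2 ^ (k - 1)) w) + eps (2 * n + 1) w"
    and init: "\<And>k. k \<in> {1..2 ^ p - 1} \<Longrightarrow> integrable M (\<lambda>w. X k w ^ 8)"
    and N: "norm_on_carrier p N"
    and beta: "max (op_norm p N (companion p a)) (op_norm p N (companion p b)) < 1"
    and sigma2: "sigma2 > 0"
    and rho: "\<bar>rho\<bar> < sigma2"
    and i_L2: "\<And>n k. n \<ge> p - 1 \<Longrightarrow> k \<in> gen (n + 1) \<Longrightarrow> integrable M (\<lambda>w. (eps k w)\<^sup>2)"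
    and i_mean: "\<And>n k. n \<ge> p - 1 \<Longrightarrow> k \<in> gen (n + 1) \<Longrightarrow>
      AE w in M. real_cond_exp M (tree_filtration M X n) (eps k) w = 0"
    and i_var: "\<And>n k. n \<ge> p - 1 \<Longrightarrow> k \<in> gen (n + 1) \<Longrightarrow>
      AE w in M. real_cond_exp M (tree_filtration M X n) (\<lambda>w. (eps k w)\<^sup>2) w = sigma2"
    and ii_siblings: "\<And>n k l. n \<ge> p - 1 \<Longrightarrow> k \<in> gen (n + 1) \<Longrightarrow> l \<in> gen (n + 1) \<Longrightarrow>
      k \<noteq> l \<Longrightarrow> k div 2 = l div 2 \<Longrightarrow>
      AE w in M. real_cond_exp M (tree_filtration M X n) (\<lambda>w. eps k w * eps l w) w = rho"
    and ii_indep: "\<And>n k l. n \<ge> p - 1 \<Longrightarrow> k \<in> gen (n + 1) \<Longrightarrow> l \<in> gen (n + 1) \<Longrightarrow>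
      k \<noteq> l \<Longrightarrow> k div 2 \<noteq> l div 2 \<Longrightarrow>
      cond_indep_var M (tree_filtration M X n) (eps k) (eps l)"
    and iii_L4: "\<And>n k. n \<ge> p - 1 \<Longrightarrow> k \<in> gen (n + 1) \<Longrightarrow> integrable M (\<lambda>w. eps k w ^ 4)"
    and iii_sup: "AE w in M.
      (SUP n\<in>{p - 1..}. SUP k\<in>gen (n + 1).
         ereal (real_cond_exp M (tree_filtration M X n) (\<lambda>w. eps k w ^ 4) w)) < \<infinity>"
  shows "positive_definite (L_mat p a b sigma2) \<and>
    (AE w in M. mat_LIMSEQ (\<lambda>n. (1 / real (card (tree n))) \<cdot>\<^sub>m S_mat p X n w) (L_mat p a b sigma2))"
proof -
  \<comment> \<open>From here on the norm N is represented by its dual ball alone.\<close>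
  obtain D \<beta> c C where "dual_ball p a b D \<beta> c C"
    using dual_ball_exists[OF N p beta] .
  then interpret bar_process M p a b D \<beta> c C X eps sigma2
    using assms unfolding bar_process_def bar_process_axioms_def by blast
  show ?thesis
  proof
    show "positive_definite (L_mat p a b sigma2)" by (rule positive_definite_L_mat[OF sigma2])
    show "AE w in M. mat_LIMSEQ (\<lambda>n. (1 / real (card (tree n))) \<cdot>\<^sub>m S_mat p X n w) (L_mat p a b sigma2)"
      using AE_bar_path by eventually_elim (rule bar_path.mat_LIMSEQ_S_mat, assumption, rule refl)
  qed
qed

end
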